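(* There exist a commutative ring $R$ of characteristic $2$ that is a G-GCD ring (and is in fact a unique factorization domain) and a finitely generated abelian group $G$ such that the group ring $RG$ is not a quasi coherent ring. Consequently, the quasi coherent property does not ascend from G-GCD rings $R$ to group rings $RG$ over finitely generated abelian groups $G$.
   Context: All rings are commutative with identity. For a ring $R$ and $c\in R$, write $(0:c)=\{r\in R: rc=0\}$. A ring $R$ is a quasi coherent ring if $a_1R\cap\cdots\cap a_nR$ and $(0:c)$ are finitely generated ideals of $R$ for all $n\ge 1$ and all $a_1,\dots,a_n,c\in R$. A ring $R$ is a G-GCD ring if every principal ideal of $R$ is projective (as an $R$-module) and the intersection of any two finitely generated flat ideals of $R$ is again a finitely generated flat ideal. $RG$ denotes the group ring of $G$ with coefficients in $R$. *)

theory Defs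
  imports "HOL-Algebra.Algebra" "HOL-Library.Z2"
begin

text \<open>
  The predicates below do not include \<^const>\<open>cring\<close>; they are meant for commutative rings. Existence
  statements about rings and groups fix the types in which the carriers live. For a finitely
  generated group, which is countable, \<^typ>\<open>int\<close> is no restriction.
\<close>

section \<open>Ideals and groups\<close>

definition fg_ideal :: "('a, 'x) ring_scheme \<Rightarrow> 'a set \<Rightarrow> bool" where
  "fg_ideal R I \<longleftrightarrow>
     ideal I R \<and> (\<exists>S. finite S \<and> S \<subseteq> carrier R \<and> I = genideal R S)"

definition ann :: "('a, 'x) ring_scheme \<Rightarrow> 'a \<Rightarrow> 'a set" where
  "ann R c = {r \<in> carrier R. r \<otimes>\<^bsub>R\<^esub> c = \<zero>\<^bsub>R\<^esub>}"

text \<open>The additive order of the identity; \<^const>\<open>group.ord\<close> is 0 on elements of infinite order.\<close>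
definition ring_char :: "('a, 'x) ring_scheme \<Rightarrow> nat" where
  "ring_char R = group.ord (add_monoid R) \<one>\<^bsub>R\<^esub>"

definition fg_group :: "('g, 'y) monoid_scheme \<Rightarrow> bool" where
  "fg_group G \<longleftrightarrow> (\<exists>S. finite S \<and> S \<subseteq> carrier G \<and> generate G S = carrier G)"

definition quasi_coherent :: "('a, 'x) ring_scheme \<Rightarrow> bool" where
  "quasi_coherent R \<longleftrightarrow>
     (\<forall>n\<ge>1. \<forall>a. (\<forall>i\<in>{1..n::nat}. a i \<in> carrier R) \<longrightarrow>
        fg_ideal R (\<Inter>i\<in>{1..n}. cgenideal R (a i))) \<and>
     (\<forall>c\<in>carrier R. fg_ideal R (ann R c))"

section \<open>Projective and flat modules\<close>

definition linear_maps ::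
  "('r, 'x) ring_scheme \<Rightarrow> ('r, 'm, 'y) module_scheme \<Rightarrow> ('r, 'n, 'z) module_scheme \<Rightarrow> ('m \<Rightarrow> 'n) set"
where
  "linear_maps R M N = {f \<in> carrier M \<rightarrow> carrier N.
     (\<forall>x\<in>carrier M. \<forall>y\<in>carrier M. f (x \<oplus>\<^bsub>M\<^esub> y) = f x \<oplus>\<^bsub>N\<^esub> f y) \<and>
     (\<forall>r\<in>carrier R. \<forall>x\<in>carrier M. f (r \<odot>\<^bsub>M\<^esub> x) = r \<odot>\<^bsub>N\<^esub> f x)}"

text \<open>
  Lifting along surjections. HOL cannot quantify over all types inside a definition, so the
  carriers of the test modules live in fixed types. These are large enough to contain the
  surjection from the free module on the set \<open>P\<close> (finitely supported functions from \<open>P\<close> to \<open>R\<close>)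
  onto \<open>P\<close>; if the identity of \<open>P\<close> lifts along it, then \<open>P\<close> is a direct summand of a
  free module, and so has the lifting property with respect to all modules.
\<close>
definition projective :: "('r, 'x) ring_scheme \<Rightarrow> ('r, 'p) module \<Rightarrow> bool" where
  "projective R P \<longleftrightarrow> module R P \<and>
     (\<forall>(A :: ('r, 'p \<Rightarrow> 'r) module) (B :: ('r, 'p) module) g f.
        module R A \<and> module R B \<and>
        g \<in> linear_maps R A B \<and> g ` carrier A = carrier B \<and> f \<in> linear_maps R P B \<longrightarrow>
        (\<exists>h\<in>linear_maps R P A. \<forall>x\<in>carrier P. g (h x) = f x))"

text \<open>
  The tensor product is, as an abelian group, the free abelian group on the pairs \<open>(m, n)\<close>
  modulo the subgroup generated by the bilinearity relations.
\<close>
definition tensor_relations ::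
  "('r, 'x) ring_scheme \<Rightarrow> ('r, 'm, 'y) module_scheme \<Rightarrow> ('r, 'n, 'z) module_scheme
     \<Rightarrow> ('m \<times> 'n \<Rightarrow>\<^sub>0 int) set"
where
  "tensor_relations R M N = generate (free_Abelian_group (carrier M \<times> carrier N))
     ({frag_of (m \<oplus>\<^bsub>M\<^esub> m', n) - frag_of (m, n) - frag_of (m', n) | m m' n.
         m \<in> carrier M \<and> m' \<in> carrier M \<and> n \<in> carrier N} \<union>
      {frag_of (m, n \<oplus>\<^bsub>N\<^esub> n') - frag_of (m, n) - frag_of (m, n') | m n n'.
         m \<in> carrier M \<and> n \<in> carrier N \<and> n' \<in> carrier N} \<union>
      {frag_of (r \<odot>\<^bsub>M\<^esub> m, n) - frag_of (m, r \<odot>\<^bsub>N\<^esub> n) | r m n.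
         r \<in> carrier R \<and> m \<in> carrier M \<and> n \<in> carrier N})"

definition tensor_product ::
  "('r, 'x) ring_scheme \<Rightarrow> ('r, 'm, 'y) module_scheme \<Rightarrow> ('r, 'n, 'z) module_scheme
     \<Rightarrow> ('m \<times> 'n \<Rightarrow>\<^sub>0 int) set monoid"
where
  "tensor_product R M N =
     free_Abelian_group (carrier M \<times> carrier N) Mod tensor_relations R M N"

text \<open>
  The map from \<open>M \<otimes> N\<close> to \<open>M \<otimes> N'\<close> induced by \<open>f\<close> from \<open>N\<close> to \<open>N'\<close>: the coset of \<open>z\<close> goes to the
  coset of the image of \<open>z\<close> under \<open>(m, n) \<mapsto> (m, f n)\<close>.
\<close>
definition tensor_map ::
  "('r, 'x) ring_scheme \<Rightarrow> ('r, 'm, 'y) module_scheme \<Rightarrow> ('r, 'k, 'z) module_scheme \<Rightarrow> ('n \<Rightarrow> 'k)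
     \<Rightarrow> ('m \<times> 'n \<Rightarrow>\<^sub>0 int) set \<Rightarrow> ('m \<times> 'k \<Rightarrow>\<^sub>0 int) set"
where
  "tensor_map R M N' f C =
     tensor_relations R M N' <#>\<^bsub>free_Abelian_group (carrier M \<times> carrier N')\<^esub>
       (frag_extend (\<lambda>(m, n). frag_of (m, f n)) ` C)"

text \<open>
  Tensoring with \<open>M\<close> preserves injectivity. The test modules have carriers in the type of \<open>R\<close>;
  these include \<open>R\<close> and all of its ideals, and by the ideal criterion for flatness it suffices to
  test on the inclusions of ideals into \<open>R\<close>.
\<close>
definition flat :: "('r, 'x) ring_scheme \<Rightarrow> ('r, 'm) module \<Rightarrow> bool" where
  "flat R M \<longleftrightarrow> module R M \<and>
     (\<forall>(N :: ('r, 'r) module) (N' :: ('r, 'r) module) f.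
        module R N \<and> module R N' \<and> f \<in> linear_maps R N N' \<and> inj_on f (carrier N) \<longrightarrow>
        inj_on (tensor_map R M N' f) (carrier (tensor_product R M N)))"

text \<open>The fields \<^const>\<open>monoid.mult\<close> and \<^const>\<open>one\<close> are irrelevant for a module.\<close>
definition ideal_module :: "('r, 'x) ring_scheme \<Rightarrow> 'r set \<Rightarrow> ('r, 'r) module" where
  "ideal_module R I =
     \<lparr>carrier = I, monoid.mult = monoid.mult R, one = one R, ring.zero = ring.zero R, add = add R, smult = monoid.mult R\<rparr>"

definition G_GCD_ring :: "('r, 'x) ring_scheme \<Rightarrow> bool" where
  "G_GCD_ring R \<longleftrightarrow>
     (\<forall>a\<in>carrier R. projective R (ideal_module R (cgenideal R a))) \<and>
     (\<forall>I J. fg_ideal R I \<and> flat R (ideal_module R I) \<and>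
            fg_ideal R J \<and> flat R (ideal_module R J) \<longrightarrow>
            fg_ideal R (I \<inter> J) \<and> flat R (ideal_module R (I \<inter> J)))"

section \<open>Group rings\<close>

text \<open>Finitely supported functions, normalised to \<^const>\<open>undefined\<close> outside the carrier of \<open>G\<close>.\<close>
definition group_ring :: "('r, 'x) ring_scheme \<Rightarrow> ('g, 'y) monoid_scheme \<Rightarrow> ('g \<Rightarrow> 'r) ring" where
  "group_ring R G =
     \<lparr>carrier = {f \<in> carrier G \<rightarrow>\<^sub>E carrier R. finite {g \<in> carrier G. f g \<noteq> \<zero>\<^bsub>R\<^esub>}},
      monoid.mult = (\<lambda>f h. \<lambda>x\<in>carrier G.
        \<Oplus>\<^bsub>R\<^esub>a\<in>{a \<in> carrier G. f a \<noteq> \<zero>\<^bsub>R\<^esub>}. f a \<otimes>\<^bsub>R\<^esub> h (inv\<^bsub>G\<^esub> a \<otimes>\<^bsub>G\<^esub> x)),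
      one = (\<lambda>x\<in>carrier G. if x = \<one>\<^bsub>G\<^esub> then \<one>\<^bsub>R\<^esub> else \<zero>\<^bsub>R\<^esub>),
      ring.zero = (\<lambda>x\<in>carrier G. \<zero>\<^bsub>R\<^esub>),
      add = (\<lambda>f h. \<lambda>x\<in>carrier G. f x \<oplus>\<^bsub>R\<^esub> h x)\<rparr>"

locale group_ring_data = R?: cring R + G?: comm_group G
  for R :: "('r, 'x) ring_scheme" (structure) and G :: "('g, 'y) monoid_scheme" (structure)
begin

abbreviation supp :: "('g \<Rightarrow> 'r) \<Rightarrow> 'g set" where
  "supp f \<equiv> {a \<in> carrier G. f a \<noteq> \<zero>\<^bsub>R\<^esub>}"

lemma group_ring_carrier:
  "f \<in> carrier (group_ring R G) \<longleftrightarrow> f \<in> carrier G \<rightarrow>\<^sub>E carrier R \<and> finite (supp f)"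
  by (simp add: group_ring_def)

lemma group_ring_val:
  "f \<in> carrier (group_ring R G) \<Longrightarrow> x \<in> carrier G \<Longrightarrow> f x \<in> carrier R"
  by (auto simp: group_ring_carrier)

lemma group_ring_eqI:
  assumes "f \<in> carrier G \<rightarrow>\<^sub>E carrier R" "h \<in> carrier G \<rightarrow>\<^sub>E carrier R"
    and "\<And>x. x \<in> carrier G \<Longrightarrow> f x = h x"
  shows "f = h"
  using assms by (rule PiE_ext)

lemma group_ring_mult_eq:
  assumes f: "f \<in> carrier (group_ring R G)" and h: "h \<in> carrier (group_ring R G)"
    and A: "finite A" "A \<subseteq> carrier G" "supp f \<subseteq> A" and x: "x \<in> carrier G"
  shows "(f \<otimes>\<^bsub>group_ring R G\<^esub> h) x =
    (\<Oplus>\<^bsub>R\<^esub>a\<in>A. f a \<otimes>\<^bsub>R\<^esub> h (inv\<^bsub>G\<^esub> a \<otimes>\<^bsub>G\<^esub> x))"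
proof -
  have "(\<Oplus>\<^bsub>R\<^esub>a\<in>supp f. f a \<otimes>\<^bsub>R\<^esub> h (inv\<^bsub>G\<^esub> a \<otimes>\<^bsub>G\<^esub> x)) =
    (\<Oplus>\<^bsub>R\<^esub>a\<in>A. f a \<otimes>\<^bsub>R\<^esub> h (inv\<^bsub>G\<^esub> a \<otimes>\<^bsub>G\<^esub> x))"
  proof (rule R.add.finprod_mono_neutral_cong_left)
    show "f i \<otimes>\<^bsub>R\<^esub> h (inv\<^bsub>G\<^esub> i \<otimes>\<^bsub>G\<^esub> x) = \<zero>\<^bsub>R\<^esub>" if "i \<in> A - supp f" for i
    proof -
      have "i \<in> carrier G" "f i = \<zero>\<^bsub>R\<^esub>" using that A by auto
      then show ?thesis using group_ring_val[OF h] x by simp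
    qed
    show "(\<lambda>a. f a \<otimes>\<^bsub>R\<^esub> h (inv\<^bsub>G\<^esub> a \<otimes>\<^bsub>G\<^esub> x)) \<in> A \<rightarrow> carrier R"
      using group_ring_val[OF f] group_ring_val[OF h] x A by (auto simp: subset_iff)
  qed (use A in auto)
  then show ?thesis using x by (simp add: group_ring_def)
qed

lemma group_ring_mult_closed:
  assumes f: "f \<in> carrier (group_ring R G)" and h: "h \<in> carrier (group_ring R G)"
  shows "f \<otimes>\<^bsub>group_ring R G\<^esub> h \<in> carrier (group_ring R G)"
    and "supp (f \<otimes>\<^bsub>group_ring R G\<^esub> h) \<subseteq> (\<lambda>(a, b). a \<otimes>\<^bsub>G\<^esub> b) ` (supp f \<times> supp h)"
proof -
  let ?m = "f \<otimes>\<^bsub>group_ring R G\<^esub> h"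
  have fin: "finite (supp f)" "finite (supp h)" using f h by (auto simp: group_ring_carrier)
  have eq: "?m x = (\<Oplus>\<^bsub>R\<^esub>a\<in>supp f. f a \<otimes>\<^bsub>R\<^esub> h (inv\<^bsub>G\<^esub> a \<otimes>\<^bsub>G\<^esub> x))"
    if "x \<in> carrier G" for x
    by (rule group_ring_mult_eq) (use f h fin that in auto)
  show sub: "supp ?m \<subseteq> (\<lambda>(a, b). a \<otimes>\<^bsub>G\<^esub> b) ` (supp f \<times> supp h)"
  proof
    fix x assume x: "x \<in> supp ?m"
    then have xG: "x \<in> carrier G" and nz: "?m x \<noteq> \<zero>\<^bsub>R\<^esub>" by auto
    have "\<exists>a\<in>supp f. h (inv\<^bsub>G\<^esub> a \<otimes>\<^bsub>G\<^esub> x) \<noteq> \<zero>\<^bsub>R\<^esub>"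
    proof (rule ccontr)
      assume "\<not> ?thesis"
      then have "?m x = \<zero>\<^bsub>R\<^esub>" unfolding eq[OF xG]
        by (intro R.add.finprod_one_eqI) (use group_ring_val[OF f] in auto)
      with nz show False by simp
    qed
    then obtain a where a: "a \<in> supp f" "h (inv\<^bsub>G\<^esub> a \<otimes>\<^bsub>G\<^esub> x) \<noteq> \<zero>\<^bsub>R\<^esub>" by blast
    then have "inv\<^bsub>G\<^esub> a \<otimes>\<^bsub>G\<^esub> x \<in> supp h" using xG by auto
    moreover have "x = a \<otimes>\<^bsub>G\<^esub> (inv\<^bsub>G\<^esub> a \<otimes>\<^bsub>G\<^esub> x)"
      using a xG by (simp add: G.m_assoc[symmetric])
    ultimately show "x \<in> (\<lambda>(a, b). a \<otimes>\<^bsub>G\<^esub> b) ` (supp f \<times> supp h)"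
      using a(1) by (intro image_eqI[where x = "(a, inv\<^bsub>G\<^esub> a \<otimes>\<^bsub>G\<^esub> x)"]) auto
  qed
  have "?m \<in> carrier G \<rightarrow>\<^sub>E carrier R"
  proof (rule PiE_I)
    fix x assume x: "x \<in> carrier G"
    show "?m x \<in> carrier R" unfolding eq[OF x]
      by (rule R.finsum_closed) (use group_ring_val[OF f] group_ring_val[OF h] x in auto)
  next
    fix x assume "x \<notin> carrier G"
    then show "?m x = undefined" by (simp add: group_ring_def)
  qed
  then show "?m \<in> carrier (group_ring R G)"
    using finite_subset[OF sub] fin by (simp add: group_ring_carrier)
qed

lemma group_ring_add_closed:
  assumes f: "f \<in> carrier (group_ring R G)" and h: "h \<in> carrier (group_ring R G)"
  shows "f \<oplus>\<^bsub>group_ring R G\<^esub> h \<in> carrier (group_ring R G)"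
proof -
  have "supp (\<lambda>x\<in>carrier G. f x \<oplus>\<^bsub>R\<^esub> h x) \<subseteq> supp f \<union> supp h" by auto
  moreover have "finite (supp f \<union> supp h)" using f h by (auto simp: group_ring_carrier)
  ultimately have "finite (supp (\<lambda>x\<in>carrier G. f x \<oplus>\<^bsub>R\<^esub> h x))" by (rule finite_subset)
  then show ?thesis using group_ring_val[OF f] group_ring_val[OF h]
    by (simp add: group_ring_def PiE_iff)
qed

lemma group_ring_PiE: "f \<in> carrier (group_ring R G) \<Longrightarrow> f \<in> carrier G \<rightarrow>\<^sub>E carrier R"
  by (simp add: group_ring_carrier)

lemma group_ring_abelian_group: "abelian_group (group_ring R G)"
proof (rule abelian_groupI)
  show "\<zero>\<^bsub>group_ring R G\<^esub> \<in> carrier (group_ring R G)"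
    by (simp add: group_ring_def PiE_iff)
  fix f h k
  assume f: "f \<in> carrier (group_ring R G)"
  note fv = group_ring_val[OF f]
  show "\<zero>\<^bsub>group_ring R G\<^esub> \<oplus>\<^bsub>group_ring R G\<^esub> f = f"
    by (rule group_ring_eqI) (use fv group_ring_PiE[OF f] in \<open>auto simp: group_ring_def\<close>)
  show "\<exists>y\<in>carrier (group_ring R G). y \<oplus>\<^bsub>group_ring R G\<^esub> f = \<zero>\<^bsub>group_ring R G\<^esub>"
  proof (rule bexI)
    let ?n = "\<lambda>x\<in>carrier G. \<ominus>\<^bsub>R\<^esub> f x"
    have "supp ?n \<subseteq> supp f" by auto
    moreover have "finite (supp f)" using f by (simp add: group_ring_carrier)
    ultimately have "finite (supp ?n)" by (rule finite_subset)
    then show "?n \<in> carrier (group_ring R G)" using fv by (simp add: group_ring_carrier PiE_iff)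
    show "?n \<oplus>\<^bsub>group_ring R G\<^esub> f = \<zero>\<^bsub>group_ring R G\<^esub>"
      using fv by (auto simp: group_ring_def R.l_neg fun_eq_iff)
  qed
  assume h: "h \<in> carrier (group_ring R G)"
  note hv = group_ring_val[OF h]
  show "f \<oplus>\<^bsub>group_ring R G\<^esub> h \<in> carrier (group_ring R G)" by (rule group_ring_add_closed[OF f h])
  show "f \<oplus>\<^bsub>group_ring R G\<^esub> h = h \<oplus>\<^bsub>group_ring R G\<^esub> f"
    using fv hv by (auto simp: group_ring_def fun_eq_iff R.a_comm)
  assume k: "k \<in> carrier (group_ring R G)"
  note kv = group_ring_val[OF k]
  show "f \<oplus>\<^bsub>group_ring R G\<^esub> h \<oplus>\<^bsub>group_ring R G\<^esub> k = f \<oplus>\<^bsub>group_ring R G\<^esub> (h \<oplus>\<^bsub>group_ring R G\<^esub> k)"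
    using fv hv kv by (auto simp: group_ring_def fun_eq_iff R.a_assoc)
qed

lemma group_ring_one_closed: "\<one>\<^bsub>group_ring R G\<^esub> \<in> carrier (group_ring R G)"
proof -
  have "supp \<one>\<^bsub>group_ring R G\<^esub> \<subseteq> {\<one>\<^bsub>G\<^esub>}" by (auto simp: group_ring_def)
  then have "finite (supp \<one>\<^bsub>group_ring R G\<^esub>)" by (rule finite_subset) simp
  then show ?thesis by (simp add: group_ring_def PiE_iff)
qed

lemma group_ring_mult_comm:
  assumes f: "f \<in> carrier (group_ring R G)" and h: "h \<in> carrier (group_ring R G)"
  shows "f \<otimes>\<^bsub>group_ring R G\<^esub> h = h \<otimes>\<^bsub>group_ring R G\<^esub> f"
proof (rule group_ring_eqI)
  note fv = group_ring_val[OF f] and hv = group_ring_val[OF h]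
  show "f \<otimes>\<^bsub>group_ring R G\<^esub> h \<in> carrier G \<rightarrow>\<^sub>E carrier R"
       "h \<otimes>\<^bsub>group_ring R G\<^esub> f \<in> carrier G \<rightarrow>\<^sub>E carrier R"
    by (simp_all add: group_ring_PiE group_ring_mult_closed f h)
  fix x assume x: "x \<in> carrier G"
  let ?t = "\<lambda>a. inv\<^bsub>G\<^esub> a \<otimes>\<^bsub>G\<^esub> x"
  let ?A = "supp f \<union> ?t ` supp h"
  have fin: "finite (supp f)" "finite (supp h)" using f h by (auto simp: group_ring_carrier)
  have AG: "?A \<subseteq> carrier G" using x by auto
  have tt: "?t (?t a) = a" if "a \<in> carrier G" for a
  proof -
    have "?t (?t a) = (inv\<^bsub>G\<^esub> x \<otimes>\<^bsub>G\<^esub> a) \<otimes>\<^bsub>G\<^esub> x"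
      using that x by (simp add: G.inv_mult_group)
    also have "\<dots> = (a \<otimes>\<^bsub>G\<^esub> inv\<^bsub>G\<^esub> x) \<otimes>\<^bsub>G\<^esub> x"
      using that x by (simp add: G.m_comm)
    also have "\<dots> = a" using that x by (simp add: G.m_assoc)
    finally show ?thesis .
  qed
  have inj: "inj_on ?t ?A" by (rule inj_on_inverseI[where g = ?t]) (use tt AG in blast)
  have "(h \<otimes>\<^bsub>group_ring R G\<^esub> f) x = (\<Oplus>\<^bsub>R\<^esub>a\<in>?t ` ?A. h a \<otimes>\<^bsub>R\<^esub> f (?t a))"
  proof (rule group_ring_mult_eq)
    show "finite (?t ` ?A)" using fin by simp
    show "?t ` ?A \<subseteq> carrier G" using AG x by auto
    show "supp h \<subseteq> ?t ` ?A"
    proof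
      fix b assume b: "b \<in> supp h"
      then have "b = ?t (?t b)" using tt by simp
      moreover have "?t b \<in> ?A" using b by blast
      ultimately show "b \<in> ?t ` ?A" by (rule image_eqI)
    qed
  qed (use f h x in auto)
  also have "\<dots> = (\<Oplus>\<^bsub>R\<^esub>a\<in>?A. h (?t a) \<otimes>\<^bsub>R\<^esub> f (?t (?t a)))"
    by (rule R.add.finprod_reindex) (use inj fv hv AG x in auto)
  also have "\<dots> = (\<Oplus>\<^bsub>R\<^esub>a\<in>?A. f a \<otimes>\<^bsub>R\<^esub> h (?t a))"
  proof (rule R.add.finprod_cong')
    fix a assume "a \<in> ?A"
    then have a: "a \<in> carrier G" using AG by blast
    then show "h (?t a) \<otimes>\<^bsub>R\<^esub> f (?t (?t a)) = f a \<otimes>\<^bsub>R\<^esub> h (?t a)"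
      unfolding tt[OF a] using fv hv x by (simp add: R.m_comm)
  qed (use fv hv AG x in auto)
  also have "\<dots> = (f \<otimes>\<^bsub>group_ring R G\<^esub> h) x"
    by (rule group_ring_mult_eq[symmetric]) (use f h fin AG x in auto)
  finally show "(f \<otimes>\<^bsub>group_ring R G\<^esub> h) x = (h \<otimes>\<^bsub>group_ring R G\<^esub> f) x" by simp
qed

lemma finsum_swap:
  assumes "finite A" "finite B"
    and "\<And>a b. a \<in> A \<Longrightarrow> b \<in> B \<Longrightarrow> u a b \<in> carrier R"
  shows "(\<Oplus>\<^bsub>R\<^esub>a\<in>A. \<Oplus>\<^bsub>R\<^esub>b\<in>B. u a b) = (\<Oplus>\<^bsub>R\<^esub>b\<in>B. \<Oplus>\<^bsub>R\<^esub>a\<in>A. u a b)"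
  using assms(1,3)
proof (induction A)
  case empty
  then show ?case by simp
next
  case (insert c A)
  have cl: "(\<lambda>b. \<Oplus>\<^bsub>R\<^esub>a\<in>A. u a b) \<in> B \<rightarrow> carrier R"
    using insert.prems by (auto intro!: R.finsum_closed)
  have "(\<Oplus>\<^bsub>R\<^esub>a\<in>insert c A. \<Oplus>\<^bsub>R\<^esub>b\<in>B. u a b) =
      (\<Oplus>\<^bsub>R\<^esub>b\<in>B. u c b) \<oplus>\<^bsub>R\<^esub> (\<Oplus>\<^bsub>R\<^esub>a\<in>A. \<Oplus>\<^bsub>R\<^esub>b\<in>B. u a b)"
    using insert.hyps insert.prems by (intro R.finsum_insert) (auto intro!: R.finsum_closed)
  also have "\<dots> = (\<Oplus>\<^bsub>R\<^esub>b\<in>B. u c b) \<oplus>\<^bsub>R\<^esub> (\<Oplus>\<^bsub>R\<^esub>b\<in>B. \<Oplus>\<^bsub>R\<^esub>a\<in>A. u a b)"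
    using insert by simp
  also have "\<dots> = (\<Oplus>\<^bsub>R\<^esub>b\<in>B. u c b \<oplus>\<^bsub>R\<^esub> (\<Oplus>\<^bsub>R\<^esub>a\<in>A. u a b))"
    using insert.prems cl by (intro R.finsum_addf[symmetric]) auto
  also have "\<dots> = (\<Oplus>\<^bsub>R\<^esub>b\<in>B. \<Oplus>\<^bsub>R\<^esub>a\<in>insert c A. u a b)"
  proof (rule R.add.finprod_cong')
    fix b assume b: "b \<in> B"
    show "u c b \<oplus>\<^bsub>R\<^esub> (\<Oplus>\<^bsub>R\<^esub>a\<in>A. u a b) = (\<Oplus>\<^bsub>R\<^esub>a\<in>insert c A. u a b)"
      using insert.hyps insert.prems b by (intro R.finsum_insert[symmetric]) auto
  qed (use insert.prems in \<open>auto intro!: R.finsum_closed\<close>)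
  finally show ?case .
qed

lemma group_ring_mult_assoc:
  assumes f: "f \<in> carrier (group_ring R G)" and h: "h \<in> carrier (group_ring R G)"
    and k: "k \<in> carrier (group_ring R G)"
  shows "f \<otimes>\<^bsub>group_ring R G\<^esub> h \<otimes>\<^bsub>group_ring R G\<^esub> k =
    f \<otimes>\<^bsub>group_ring R G\<^esub> (h \<otimes>\<^bsub>group_ring R G\<^esub> k)"
proof (rule group_ring_eqI)
  let ?RG = "group_ring R G"
  note fv = group_ring_val[OF f] and hv = group_ring_val[OF h] and kv = group_ring_val[OF k]
  show "f \<otimes>\<^bsub>?RG\<^esub> h \<otimes>\<^bsub>?RG\<^esub> k \<in> carrier G \<rightarrow>\<^sub>E carrier R"
       "f \<otimes>\<^bsub>?RG\<^esub> (h \<otimes>\<^bsub>?RG\<^esub> k) \<in> carrier G \<rightarrow>\<^sub>E carrier R"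
    by (simp_all add: group_ring_PiE group_ring_mult_closed f h k)
  fix x assume x: "x \<in> carrier G"
  let ?A = "supp f" and ?B = "supp h"
  let ?C = "(\<lambda>(a, b). a \<otimes>\<^bsub>G\<^esub> b) ` (?A \<times> ?B)"
  have fin: "finite ?A" "finite ?B" using f h by (auto simp: group_ring_carrier)
  then have finC: "finite ?C" by simp
  have CG: "?C \<subseteq> carrier G" by auto
  have CG': "c \<in> carrier G" if "c \<in> ?C" for c using CG that by blast
  have tR: "f a \<otimes>\<^bsub>R\<^esub> h (inv\<^bsub>G\<^esub> a \<otimes>\<^bsub>G\<^esub> c) \<otimes>\<^bsub>R\<^esub> k (inv\<^bsub>G\<^esub> c \<otimes>\<^bsub>G\<^esub> x) \<in> carrier R"
    if "a \<in> ?A" "c \<in> ?C" for a c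
    using that(1) CG'[OF that(2)] fv hv kv x by simp
  have "(f \<otimes>\<^bsub>?RG\<^esub> h \<otimes>\<^bsub>?RG\<^esub> k) x =
      (\<Oplus>\<^bsub>R\<^esub>c\<in>?C. (f \<otimes>\<^bsub>?RG\<^esub> h) c \<otimes>\<^bsub>R\<^esub> k (inv\<^bsub>G\<^esub> c \<otimes>\<^bsub>G\<^esub> x))"
    by (rule group_ring_mult_eq[OF group_ring_mult_closed(1)[OF f h] k finC CG
          group_ring_mult_closed(2)[OF f h] x])
  also have "\<dots> = (\<Oplus>\<^bsub>R\<^esub>c\<in>?C. \<Oplus>\<^bsub>R\<^esub>a\<in>?A.
      f a \<otimes>\<^bsub>R\<^esub> h (inv\<^bsub>G\<^esub> a \<otimes>\<^bsub>G\<^esub> c) \<otimes>\<^bsub>R\<^esub> k (inv\<^bsub>G\<^esub> c \<otimes>\<^bsub>G\<^esub> x))"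
  proof (rule R.add.finprod_cong')
    fix c assume "c \<in> ?C"
    then have c: "c \<in> carrier G" by (rule CG')
    have "(f \<otimes>\<^bsub>?RG\<^esub> h) c = (\<Oplus>\<^bsub>R\<^esub>a\<in>?A. f a \<otimes>\<^bsub>R\<^esub> h (inv\<^bsub>G\<^esub> a \<otimes>\<^bsub>G\<^esub> c))"
      by (rule group_ring_mult_eq) (use f h fin c in auto)
    then show "(f \<otimes>\<^bsub>?RG\<^esub> h) c \<otimes>\<^bsub>R\<^esub> k (inv\<^bsub>G\<^esub> c \<otimes>\<^bsub>G\<^esub> x) = (\<Oplus>\<^bsub>R\<^esub>a\<in>?A.
        f a \<otimes>\<^bsub>R\<^esub> h (inv\<^bsub>G\<^esub> a \<otimes>\<^bsub>G\<^esub> c) \<otimes>\<^bsub>R\<^esub> k (inv\<^bsub>G\<^esub> c \<otimes>\<^bsub>G\<^esub> x))"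
      using fin fv hv kv c x by (simp add: R.finsum_ldistr Pi_def)
  next
    show "(\<lambda>c. \<Oplus>\<^bsub>R\<^esub>a\<in>?A. f a \<otimes>\<^bsub>R\<^esub> h (inv\<^bsub>G\<^esub> a \<otimes>\<^bsub>G\<^esub> c) \<otimes>\<^bsub>R\<^esub>
        k (inv\<^bsub>G\<^esub> c \<otimes>\<^bsub>G\<^esub> x)) \<in> ?C \<rightarrow> carrier R"
      by (intro Pi_I R.finsum_closed tR)
  qed simp
  also have "\<dots> = (\<Oplus>\<^bsub>R\<^esub>a\<in>?A. \<Oplus>\<^bsub>R\<^esub>c\<in>?C.
      f a \<otimes>\<^bsub>R\<^esub> h (inv\<^bsub>G\<^esub> a \<otimes>\<^bsub>G\<^esub> c) \<otimes>\<^bsub>R\<^esub> k (inv\<^bsub>G\<^esub> c \<otimes>\<^bsub>G\<^esub> x))"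
    by (rule finsum_swap[OF finC fin(1)]) (rule tR)
  also have "\<dots> = (\<Oplus>\<^bsub>R\<^esub>a\<in>?A. f a \<otimes>\<^bsub>R\<^esub> (h \<otimes>\<^bsub>?RG\<^esub> k) (inv\<^bsub>G\<^esub> a \<otimes>\<^bsub>G\<^esub> x))"
  proof (rule R.add.finprod_cong')
    fix a assume a: "a \<in> ?A"
    then have aG: "a \<in> carrier G" by simp
    let ?u = "\<lambda>c. h (inv\<^bsub>G\<^esub> a \<otimes>\<^bsub>G\<^esub> c) \<otimes>\<^bsub>R\<^esub> k (inv\<^bsub>G\<^esub> c \<otimes>\<^bsub>G\<^esub> x)"
    have uR: "?u c \<in> carrier R" if "c \<in> carrier G" for c using hv kv aG x that by simp
    have "(\<Oplus>\<^bsub>R\<^esub>c\<in>?C. f a \<otimes>\<^bsub>R\<^esub> h (inv\<^bsub>G\<^esub> a \<otimes>\<^bsub>G\<^esub> c) \<otimes>\<^bsub>R\<^esub> k (inv\<^bsub>G\<^esub> c \<otimes>\<^bsub>G\<^esub> x))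
        = (\<Oplus>\<^bsub>R\<^esub>c\<in>?C. f a \<otimes>\<^bsub>R\<^esub> ?u c)"
    proof (rule R.add.finprod_cong')
      fix c assume "c \<in> ?C"
      then have c: "c \<in> carrier G" by (rule CG')
      show "f a \<otimes>\<^bsub>R\<^esub> h (inv\<^bsub>G\<^esub> a \<otimes>\<^bsub>G\<^esub> c) \<otimes>\<^bsub>R\<^esub> k (inv\<^bsub>G\<^esub> c \<otimes>\<^bsub>G\<^esub> x) = f a \<otimes>\<^bsub>R\<^esub> ?u c"
        using fv hv kv aG x c by (simp add: R.m_assoc)
    next
      show "(\<lambda>c. f a \<otimes>\<^bsub>R\<^esub> ?u c) \<in> ?C \<rightarrow> carrier R"
        by (intro Pi_I R.m_closed fv[OF aG] uR CG')
    qed simp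
    also have "\<dots> = f a \<otimes>\<^bsub>R\<^esub> (\<Oplus>\<^bsub>R\<^esub>c\<in>?C. ?u c)"
      by (rule R.finsum_rdistr[symmetric, OF finC fv[OF aG]]) (intro Pi_I uR CG')
    also have "(\<Oplus>\<^bsub>R\<^esub>c\<in>?C. ?u c) = (\<Oplus>\<^bsub>R\<^esub>c\<in>(\<lambda>b. a \<otimes>\<^bsub>G\<^esub> b) ` ?B. ?u c)"
    proof (rule R.add.finprod_mono_neutral_cong_right[OF finC])
      show "(\<lambda>b. a \<otimes>\<^bsub>G\<^esub> b) ` ?B \<subseteq> ?C" using a by auto
      fix c assume c: "c \<in> ?C - (\<lambda>b. a \<otimes>\<^bsub>G\<^esub> b) ` ?B"
      then have cG: "c \<in> carrier G" by (intro CG') simp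
      have "c = a \<otimes>\<^bsub>G\<^esub> (inv\<^bsub>G\<^esub> a \<otimes>\<^bsub>G\<^esub> c)" using aG cG by (simp add: G.m_assoc[symmetric])
      then have "inv\<^bsub>G\<^esub> a \<otimes>\<^bsub>G\<^esub> c \<notin> ?B" using c by blast
      then have "h (inv\<^bsub>G\<^esub> a \<otimes>\<^bsub>G\<^esub> c) = \<zero>\<^bsub>R\<^esub>" using aG cG by simp
      then show "?u c = \<zero>\<^bsub>R\<^esub>" using kv cG x by simp
    next
      show "?u \<in> ?C \<rightarrow> carrier R" by (intro Pi_I uR CG')
    qed simp
    also have "\<dots> = (\<Oplus>\<^bsub>R\<^esub>b\<in>?B. ?u (a \<otimes>\<^bsub>G\<^esub> b))"
    proof (rule R.add.finprod_reindex)
      show "?u \<in> (\<lambda>b. a \<otimes>\<^bsub>G\<^esub> b) ` ?B \<rightarrow> carrier R"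
        using aG by (intro Pi_I uR) auto
      show "inj_on (\<lambda>b. a \<otimes>\<^bsub>G\<^esub> b) ?B" using aG by (auto intro!: inj_onI)
    qed
    also have "\<dots> = (\<Oplus>\<^bsub>R\<^esub>b\<in>?B. h b \<otimes>\<^bsub>R\<^esub> k (inv\<^bsub>G\<^esub> b \<otimes>\<^bsub>G\<^esub> (inv\<^bsub>G\<^esub> a \<otimes>\<^bsub>G\<^esub> x)))"
    proof (rule R.add.finprod_cong')
      fix b assume "b \<in> ?B"
      then have b: "b \<in> carrier G" by simp
      have "inv\<^bsub>G\<^esub> a \<otimes>\<^bsub>G\<^esub> (a \<otimes>\<^bsub>G\<^esub> b) = b" using aG b by (simp add: G.m_assoc[symmetric])
      moreover have "inv\<^bsub>G\<^esub> (a \<otimes>\<^bsub>G\<^esub> b) \<otimes>\<^bsub>G\<^esub> x = inv\<^bsub>G\<^esub> b \<otimes>\<^bsub>G\<^esub> (inv\<^bsub>G\<^esub> a \<otimes>\<^bsub>G\<^esub> x)"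
        using aG b x by (simp add: G.inv_mult_group G.m_assoc)
      ultimately show "?u (a \<otimes>\<^bsub>G\<^esub> b) = h b \<otimes>\<^bsub>R\<^esub> k (inv\<^bsub>G\<^esub> b \<otimes>\<^bsub>G\<^esub> (inv\<^bsub>G\<^esub> a \<otimes>\<^bsub>G\<^esub> x))"
        by simp
    qed (use hv kv aG x in auto)
    also have "\<dots> = (h \<otimes>\<^bsub>?RG\<^esub> k) (inv\<^bsub>G\<^esub> a \<otimes>\<^bsub>G\<^esub> x)"
      by (rule group_ring_mult_eq[symmetric]) (use h k fin aG x in auto)
    finally show "(\<Oplus>\<^bsub>R\<^esub>c\<in>?C. f a \<otimes>\<^bsub>R\<^esub> h (inv\<^bsub>G\<^esub> a \<otimes>\<^bsub>G\<^esub> c) \<otimes>\<^bsub>R\<^esub> k (inv\<^bsub>G\<^esub> c \<otimes>\<^bsub>G\<^esub> x))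
        = f a \<otimes>\<^bsub>R\<^esub> (h \<otimes>\<^bsub>?RG\<^esub> k) (inv\<^bsub>G\<^esub> a \<otimes>\<^bsub>G\<^esub> x)" .
  qed (use fv x group_ring_val[OF group_ring_mult_closed(1)[OF h k]] in auto)
  also have "\<dots> = (f \<otimes>\<^bsub>?RG\<^esub> (h \<otimes>\<^bsub>?RG\<^esub> k)) x"
    by (rule group_ring_mult_eq[symmetric])
       (use f group_ring_mult_closed(1)[OF h k] fin x in auto)
  finally show "(f \<otimes>\<^bsub>?RG\<^esub> h \<otimes>\<^bsub>?RG\<^esub> k) x = (f \<otimes>\<^bsub>?RG\<^esub> (h \<otimes>\<^bsub>?RG\<^esub> k)) x" .
qed

lemma group_ring_cring: "cring (group_ring R G)"
proof (rule cringI)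
  let ?RG = "group_ring R G"
  show "abelian_group ?RG" by (rule group_ring_abelian_group)
  have one: "\<one>\<^bsub>?RG\<^esub> \<otimes>\<^bsub>?RG\<^esub> f = f" if f: "f \<in> carrier ?RG" for f
  proof (rule group_ring_eqI)
    note fv = group_ring_val[OF f]
    show "\<one>\<^bsub>?RG\<^esub> \<otimes>\<^bsub>?RG\<^esub> f \<in> carrier G \<rightarrow>\<^sub>E carrier R" "f \<in> carrier G \<rightarrow>\<^sub>E carrier R"
      by (simp_all add: group_ring_PiE group_ring_mult_closed group_ring_one_closed f)
    fix x assume x: "x \<in> carrier G"
    have "(\<one>\<^bsub>?RG\<^esub> \<otimes>\<^bsub>?RG\<^esub> f) x =
        (\<Oplus>\<^bsub>R\<^esub>a\<in>{\<one>\<^bsub>G\<^esub>}. \<one>\<^bsub>?RG\<^esub> a \<otimes>\<^bsub>R\<^esub> f (inv\<^bsub>G\<^esub> a \<otimes>\<^bsub>G\<^esub> x))"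
      by (rule group_ring_mult_eq)
         (use f x group_ring_one_closed in \<open>auto simp: group_ring_def split: if_splits\<close>)
    also have "\<dots> = f x" using fv x by (simp add: group_ring_def)
    finally show "(\<one>\<^bsub>?RG\<^esub> \<otimes>\<^bsub>?RG\<^esub> f) x = f x" .
  qed
  show "comm_monoid ?RG"
    by (rule comm_monoidI)
       (fact group_ring_mult_closed(1) group_ring_one_closed group_ring_mult_assoc
          group_ring_mult_comm one)+
  fix f h k
  assume f: "f \<in> carrier ?RG" and h: "h \<in> carrier ?RG" and k: "k \<in> carrier ?RG"
  note fv = group_ring_val[OF f] and hv = group_ring_val[OF h] and kv = group_ring_val[OF k]
  have "k \<otimes>\<^bsub>?RG\<^esub> (f \<oplus>\<^bsub>?RG\<^esub> h) = k \<otimes>\<^bsub>?RG\<^esub> f \<oplus>\<^bsub>?RG\<^esub> k \<otimes>\<^bsub>?RG\<^esub> h"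
  proof (rule group_ring_eqI)
    show "k \<otimes>\<^bsub>?RG\<^esub> (f \<oplus>\<^bsub>?RG\<^esub> h) \<in> carrier G \<rightarrow>\<^sub>E carrier R"
         "k \<otimes>\<^bsub>?RG\<^esub> f \<oplus>\<^bsub>?RG\<^esub> k \<otimes>\<^bsub>?RG\<^esub> h \<in> carrier G \<rightarrow>\<^sub>E carrier R"
      by (simp_all add: group_ring_PiE group_ring_mult_closed group_ring_add_closed f h k)
    fix x assume x: "x \<in> carrier G"
    have eq: "(k \<otimes>\<^bsub>?RG\<^esub> w) x = (\<Oplus>\<^bsub>R\<^esub>a\<in>supp k. k a \<otimes>\<^bsub>R\<^esub> w (inv\<^bsub>G\<^esub> a \<otimes>\<^bsub>G\<^esub> x))"
      if "w \<in> carrier ?RG" for w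
      by (rule group_ring_mult_eq) (use k that x in \<open>auto simp: group_ring_carrier\<close>)
    have "(k \<otimes>\<^bsub>?RG\<^esub> f \<oplus>\<^bsub>?RG\<^esub> k \<otimes>\<^bsub>?RG\<^esub> h) x = (k \<otimes>\<^bsub>?RG\<^esub> f) x \<oplus>\<^bsub>R\<^esub> (k \<otimes>\<^bsub>?RG\<^esub> h) x"
      using x by (simp add: group_ring_def)
    also have "\<dots> = (\<Oplus>\<^bsub>R\<^esub>a\<in>supp k.
        k a \<otimes>\<^bsub>R\<^esub> f (inv\<^bsub>G\<^esub> a \<otimes>\<^bsub>G\<^esub> x) \<oplus>\<^bsub>R\<^esub> k a \<otimes>\<^bsub>R\<^esub> h (inv\<^bsub>G\<^esub> a \<otimes>\<^bsub>G\<^esub> x))"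
      unfolding eq[OF f] eq[OF h]
      by (rule R.finsum_addf[symmetric]) (use fv hv kv x in auto)
    also have "\<dots> = (\<Oplus>\<^bsub>R\<^esub>a\<in>supp k. k a \<otimes>\<^bsub>R\<^esub> (f \<oplus>\<^bsub>?RG\<^esub> h) (inv\<^bsub>G\<^esub> a \<otimes>\<^bsub>G\<^esub> x))"
    proof (rule R.add.finprod_cong')
      fix a assume "a \<in> supp k"
      then have a: "a \<in> carrier G" by simp
      then have "inv\<^bsub>G\<^esub> a \<otimes>\<^bsub>G\<^esub> x \<in> carrier G" using x by simp
      then have "(f \<oplus>\<^bsub>?RG\<^esub> h) (inv\<^bsub>G\<^esub> a \<otimes>\<^bsub>G\<^esub> x) =
          f (inv\<^bsub>G\<^esub> a \<otimes>\<^bsub>G\<^esub> x) \<oplus>\<^bsub>R\<^esub> h (inv\<^bsub>G\<^esub> a \<otimes>\<^bsub>G\<^esub> x)"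
        by (simp add: group_ring_def)
      then show "k a \<otimes>\<^bsub>R\<^esub> f (inv\<^bsub>G\<^esub> a \<otimes>\<^bsub>G\<^esub> x) \<oplus>\<^bsub>R\<^esub> k a \<otimes>\<^bsub>R\<^esub> h (inv\<^bsub>G\<^esub> a \<otimes>\<^bsub>G\<^esub> x) =
          k a \<otimes>\<^bsub>R\<^esub> (f \<oplus>\<^bsub>?RG\<^esub> h) (inv\<^bsub>G\<^esub> a \<otimes>\<^bsub>G\<^esub> x)"
        using fv hv kv a x by (simp add: R.r_distr)
    qed (use kv x group_ring_val[OF group_ring_add_closed[OF f h]] in auto)
    also have "\<dots> = (k \<otimes>\<^bsub>?RG\<^esub> (f \<oplus>\<^bsub>?RG\<^esub> h)) x"
      by (rule eq[OF group_ring_add_closed[OF f h], symmetric])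
    finally show "(k \<otimes>\<^bsub>?RG\<^esub> (f \<oplus>\<^bsub>?RG\<^esub> h)) x = (k \<otimes>\<^bsub>?RG\<^esub> f \<oplus>\<^bsub>?RG\<^esub> k \<otimes>\<^bsub>?RG\<^esub> h) x"
      by simp
  qed
  then show "(f \<oplus>\<^bsub>?RG\<^esub> h) \<otimes>\<^bsub>?RG\<^esub> k = f \<otimes>\<^bsub>?RG\<^esub> k \<oplus>\<^bsub>?RG\<^esub> h \<otimes>\<^bsub>?RG\<^esub> k"
    unfolding group_ring_mult_comm[OF group_ring_add_closed[OF f h] k]
      group_ring_mult_comm[OF f k] group_ring_mult_comm[OF h k] .
qed

end

end

theory Submission
  imports Defs "HOL-Computational_Algebra.Polynomial"
begin

text \<open>
  The counterexample is a ring of invariants. Over the field with two elements let the additive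
  group act on polynomials in variables \<open>x\<^sub>0, x\<^sub>1, \<dots>\<close> and \<open>y\<^sub>0, y\<^sub>1, \<dots>\<close> by the shear
  \<open>y\<^sub>i \<mapsto> y\<^sub>i + t x\<^sub>i\<close>, and let \<open>R\<close> consist of the invariant polynomials.

  If a product of nonzero polynomials is invariant, then so are its factors, because degrees in \<open>t\<close>
  add up (\<open>psubst_fixed_inert\<close>). Hence \<open>R\<close> inherits unique factorisation from the polynomial ring
  (\<open>shear_ring_factorial\<close>). For the polynomial ring itself only finitely many variables matter at a
  time, and one variable after another is adjoined by a form of Gauss's lemma that works with
  pseudo-division instead of fraction fields (\<open>irreducible_prime_over_insert\<close>).

  A factorial domain is a G-GCD ring. Principal ideals are free of rank at most one, and two of them
  intersect in the ideal of a least common multiple, so it remains to see that a finitely generated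
  flat ideal \<open>I\<close> is principal. If \<open>g a'\<close> and \<open>g b'\<close> lie in \<open>I\<close> with \<open>a'\<close>, \<open>b'\<close> coprime, flatness makes
  the tensors \<open>g b' \<otimes> a'\<close> and \<open>g a' \<otimes> b'\<close> equal already in \<open>I \<otimes> (a', b')\<close>, and this forces \<open>g\<close>
  into \<open>I\<close>
  (\<open>flat_coprime_gcd_mem\<close>).

  On the other hand \<open>R\<close> is far from coherent. With \<open>p\<^sub>i\<^sub>j = x\<^sub>i y\<^sub>j - x\<^sub>j y\<^sub>i\<close>, the relations
  \<open>x\<^sub>k p\<^sub>0\<^sub>1 = x\<^sub>0 p\<^sub>k\<^sub>1 + x\<^sub>1 p\<^sub>0\<^sub>k\<close> put all \<open>x\<^sub>k\<close> into the colon ideal \<open>((x\<^sub>0, x\<^sub>1) : p\<^sub>0\<^sub>1)\<close>. No element of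
  this ideal has a constant term, since invariants have no linear terms in the \<open>y\<^sub>i\<close>; so finitely many
  of its elements can generate only finitely many of the linear forms \<open>x\<^sub>k\<close> (\<open>shear_colon_not_fg\<close>).

  Finally, in characteristic 2 the group ring of the group of order two is \<open>R[y]/(y\<^sup>2)\<close>, and the augmentation maps the
  intersection of the ideals of \<open>a\<^sup>2\<close> and \<open>a c + u y\<close> onto \<open>a\<^sup>2 c ((a, c) : u)\<close> whenever \<open>a\<close> and \<open>c\<close> are
  coprime (\<open>group_ring_C2_not_quasi_coherent\<close>). With \<open>a = x\<^sub>0\<close>, \<open>c = x\<^sub>1\<close> and \<open>u = p\<^sub>0\<^sub>1\<close> this intersection
  is not finitely generated.
\<close>

section \<open>Polynomials over the field with two elements\<close>

type_synonym mpoly2 = "(nat \<Rightarrow>\<^sub>0 nat) \<Rightarrow>\<^sub>0 bit"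

abbreviation lookup where "lookup \<equiv> Poly_Mapping.lookup"
abbreviation keys where "keys \<equiv> Poly_Mapping.keys"
abbreviation single where "single \<equiv> Poly_Mapping.single"
abbreviation pdeg where "pdeg \<equiv> Polynomial.degree"
abbreviation pcoeff where "pcoeff \<equiv> Polynomial.coeff"
abbreviation irred :: "mpoly2 \<Rightarrow> bool" where "irred \<equiv> Factorial_Ring.irreducible"

definition mvar :: "nat \<Rightarrow> mpoly2" where "mvar i = single (single i 1) 1"

lemma mpoly2_two [simp]: "(2 :: mpoly2) = 0"
proof -
  have "(1 :: mpoly2) + 1 = 0" by (rule poly_mapping_eqI) (simp only: lookup_add lookup_zero add_bit_eq_xor xor_self_eq)
  then show ?thesis by simp
qed

lemma mpoly2_poly_two [simp]: "(2 :: mpoly2 poly) = 0"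
  by (metis mpoly2_two of_nat_numeral of_nat_poly pCons_0_0)

lemma mpoly2_add_self: "f + f = (0 :: mpoly2)"
  using mult_2[of f] by simp

lemma mpoly2_poly_add_self: "p + p = (0 :: mpoly2 poly)"
  using mult_2[of p] by simp

lemma mpoly2_uminus [simp]: "- f = (f :: mpoly2)"
  by (metis mpoly2_add_self add_eq_0_iff)

lemma mpoly2_poly_uminus [simp]: "- p = (p :: mpoly2 poly)"
  by (metis mpoly2_poly_add_self add_eq_0_iff)

definition monomial_value :: "(nat \<Rightarrow> 'b :: comm_monoid_mult) \<Rightarrow> (nat \<Rightarrow>\<^sub>0 nat) \<Rightarrow> 'b" where
  "monomial_value v m = (\<Prod>i\<in>keys m. v i ^ lookup m i)"

lemma monomial_value_superset:
  "finite A \<Longrightarrow> keys m \<subseteq> A \<Longrightarrow> monomial_value v m = (\<Prod>i\<in>A. v i ^ lookup m i)"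
  unfolding monomial_value_def by (rule prod.mono_neutral_left) (auto simp: in_keys_iff)

lemma monomial_value_add: "monomial_value v (m + m') = monomial_value v m * monomial_value v m'"
proof -
  let ?A = "keys m \<union> keys m'"
  have "keys (m + m') \<subseteq> ?A" by (rule Poly_Mapping.keys_add)
  then show ?thesis
    by (simp add: monomial_value_superset[of ?A] prod.distrib[symmetric] power_add lookup_add)
qed

lemma monomial_value_0 [simp]: "monomial_value v 0 = 1" by (simp add: monomial_value_def)

lemma monomial_value_single: "monomial_value v (single i n) = v i ^ n"
  by (cases "n = 0") (simp_all add: monomial_value_def)

lemma monomial_value_mvar: "monomial_value mvar m = single m 1"
proof (induction m rule: update_induct)
  case const
  show ?case by simp
next
  case (update m a b)
  have "Poly_Mapping.update a b m = single a b + m"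
    using update.hyps by (intro poly_mapping_eqI) (auto simp: lookup_update lookup_add lookup_single when_def in_keys_iff)
  moreover have "mvar a ^ k = single (single a k) 1" for k
    by (induction k) (simp_all add: mvar_def mult_single single_add[symmetric])
  ultimately show ?case using update.IH by (simp add: monomial_value_add monomial_value_single mult_single)
qed

lemma mpoly2_sum_keys: "f = (\<Sum>m\<in>keys f. single m (1::bit))"
proof (rule poly_mapping_eqI)
  fix k
  have "lookup (\<Sum>m\<in>keys f. single m (1::bit)) k = (\<Sum>m\<in>keys f. if m = k then 1 else 0)"
    by (simp add: lookup_sum lookup_single when_def)
  also have "\<dots> = lookup f k" by (auto simp: in_keys_iff)
  finally show "lookup f k = lookup (\<Sum>m\<in>keys f. single m (1::bit)) k" by simp
qed

lemma mpoly2_induct [case_names zero monomial add]: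
  fixes f :: mpoly2
  assumes "P 0" "\<And>m. m \<in> keys f \<Longrightarrow> P (single m 1)" "\<And>f g. P f \<Longrightarrow> P g \<Longrightarrow> P (f + g)"
  shows "P f"
proof -
  have "P (\<Sum>m\<in>M. single m 1)" if "M \<subseteq> keys f" for M
    using finite_subset[OF that finite_keys] that by (induction M rule: finite_induct) (use assms in auto)
  from this[OF subset_refl] show ?thesis using mpoly2_sum_keys[of f] by simp
qed

text \<open>
  All coefficients are 0 or 1, so a polynomial is the sum of the monomials in its support, and
  substituting into it is a sum over the support; monomials common to two summands cancel because
  the target has characteristic 2. The values live in a polynomial ring in one more variable: the
  degree in that variable then measures how far a substitution moves a polynomial.
\<close>
definition psubst :: "(nat \<Rightarrow> mpoly2 poly) \<Rightarrow> mpoly2 \<Rightarrow> mpoly2 poly" where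
  "psubst v f = (\<Sum>m\<in>keys f. monomial_value v m)"

lemma psubst_superset:
  assumes "finite M" "keys f \<subseteq> M"
  shows "psubst v f = (\<Sum>m\<in>M. if lookup f m = 0 then 0 else monomial_value v m)"
  unfolding psubst_def using assms
  by (intro sum.mono_neutral_cong_left) (auto simp: in_keys_iff)

lemma psubst_0 [simp]: "psubst v 0 = 0" by (simp add: psubst_def)

lemma psubst_monomial [simp]: "psubst v (single m 1) = monomial_value v m" by (simp add: psubst_def)

lemma psubst_1 [simp]: "psubst v 1 = 1" using psubst_monomial[of v 0] by simp

lemma psubst_mvar [simp]: "psubst v (mvar i) = v i" by (simp add: mvar_def monomial_value_single)

lemma psubst_add: "psubst v (f + g) = psubst v f + psubst v g"
proof -
  let ?M = "keys f \<union> keys g"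
  have "keys (f + g) \<subseteq> ?M" by (rule Poly_Mapping.keys_add)
  then have "psubst v (f + g) = (\<Sum>m\<in>?M. if lookup (f + g) m = 0 then 0 else monomial_value v m)"
    by (intro psubst_superset) auto
  also have "\<dots> = (\<Sum>m\<in>?M. (if lookup f m = 0 then 0 else monomial_value v m) + (if lookup g m = 0 then 0 else monomial_value v m))"
    by (intro sum.cong refl) (auto simp: lookup_add)
  also have "\<dots> = psubst v f + psubst v g"
    by (simp add: sum.distrib psubst_superset[of ?M])
  finally show ?thesis .
qed

lemma psubst_mult: "psubst v (f * g) = psubst v f * psubst v g"
proof (induction f rule: mpoly2_induct)
  case (monomial m)
  show ?case
    by (induction g rule: mpoly2_induct)
       (simp_all add: mult_single monomial_value_add psubst_add distrib_left)
qed (simp_all add: psubst_add distrib_right)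

lemma psubst_diff: "psubst v (f - g) = psubst v f - psubst v g"
  using psubst_add[of v f "- g"] by (metis diff_conv_add_uminus mpoly2_uminus mpoly2_poly_uminus)

lemma psubst_power: "psubst v (f ^ n) = psubst v f ^ n"
  by (induction n) (simp_all add: psubst_mult)

lemma psubst_cong:
  assumes "\<And>m i. m \<in> keys f \<Longrightarrow> i \<in> keys m \<Longrightarrow> v i = w i"
  shows "psubst v f = psubst w f"
  unfolding psubst_def monomial_value_def using assms by (intro sum.cong prod.cong refl) auto

lemma poly_monomial_value: "poly (monomial_value v m) e = monomial_value (\<lambda>i. poly (v i) e) m"
  by (simp add: monomial_value_def poly_prod)

lemma psubst_const: "psubst (\<lambda>i. [:mvar i:]) f = [:f:]"
proof (induction f rule: mpoly2_induct)
  case (monomial m)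
  have "monomial_value (\<lambda>i. [:mvar i:]) m = [:monomial_value mvar m:]"
    unfolding monomial_value_def by (simp add: poly_const_pow prod_to_poly)
  then show ?case by (simp add: monomial_value_mvar)
qed (simp_all add: psubst_add)

lemma psubst_retract:
  assumes "\<And>i. poly (v i) e = mvar i"
  shows "poly (psubst v f) e = f"
  by (induction f rule: mpoly2_induct) (simp_all add: psubst_add poly_monomial_value assms monomial_value_mvar)

lemma psubst_eq_0_iff:
  assumes "\<And>i. poly (v i) e = mvar i"
  shows "psubst v f = 0 \<longleftrightarrow> f = 0"
  using psubst_retract[of v e f] assms by (metis poly_0 psubst_0)

text \<open>
  The degree in the auxiliary variable is additive, so both factors of a product of degree 0 have
  degree 0. Specialising the variable to \<open>e\<close> identifies the constant. Both the polynomials that omit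
  a given variable and the invariants of the shear are fixed sets of this kind.
\<close>
lemma psubst_fixed_inert:
  assumes v: "\<And>i. poly (v i) e = mvar i"
    and fixed: "psubst v (f * g) = [:f * g:]" and nz: "f * g \<noteq> 0"
  shows "psubst v f = [:f:]"
proof -
  have "psubst v f \<noteq> 0" "psubst v g \<noteq> 0" using nz psubst_eq_0_iff[of v e] v by auto
  then have "pdeg (psubst v f) + pdeg (psubst v g) = pdeg (psubst v (f * g))"
    by (simp add: psubst_mult degree_mult_eq)
  then have "pdeg (psubst v f) = 0" using fixed by simp
  then obtain c where "psubst v f = [:c:]" by (rule degree_eq_zeroE)
  moreover have "poly (psubst v f) e = f" by (rule psubst_retract) (rule v)
  ultimately show ?thesis by simp
qed

section \<open>Irreducible polynomials are prime\<close>

text \<open>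
  Every variable is scaled by the auxiliary one, so that additivity on products is the one of the
  degree of univariate polynomials.
\<close>
definition total_degree :: "mpoly2 \<Rightarrow> nat" where
  "total_degree f = pdeg (psubst (\<lambda>i. [:0, mvar i:]) f)"

lemma total_degree_mult: "f \<noteq> 0 \<Longrightarrow> g \<noteq> 0 \<Longrightarrow> total_degree (f * g) = total_degree f + total_degree g"
  unfolding total_degree_def psubst_mult
  by (rule degree_mult_eq) (simp_all add: psubst_eq_0_iff[where e = 1])

lemma monomial_value_0_right:
  assumes "\<And>i. v i = (0 :: 'b :: comm_semiring_1)"
  shows "monomial_value v m = (if m = 0 then 1 else 0)"
proof (cases "m = 0")
  case False
  then have "keys m \<noteq> {}" by (metis in_keys_iff lookup_zero poly_mapping_eqI empty_iff)
  then obtain i where i: "i \<in> keys m" by blast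
  then have "v i ^ lookup m i = 0" unfolding assms by (simp add: in_keys_iff zero_power)
  then have "monomial_value v m = 0" unfolding monomial_value_def using i by (intro prod_zero) auto
  then show ?thesis using False by simp
qed simp

lemma psubst_at_0:
  assumes "\<And>i. poly (v i) 0 = 0"
  shows "poly (psubst v f) 0 = (if lookup f 0 = 0 then 0 else 1)"
proof (induction f rule: mpoly2_induct)
  case (monomial m)
  show ?case
    using assms by (simp add: poly_monomial_value monomial_value_0_right lookup_single when_def)
next
  case (add f g)
  then show ?case by (auto simp: psubst_add lookup_add)
qed simp

lemma total_degree_eq_0:
  assumes "total_degree f = 0" "f \<noteq> 0"
  shows "f = 1"
proof -
  let ?p = "psubst (\<lambda>i. [:0, mvar i:]) f"
  obtain c where c: "?p = [:c:]" using assms unfolding total_degree_def by (auto elim: degree_eq_zeroE)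
  have "poly ?p 1 = f" by (rule psubst_retract) simp
  moreover have "poly ?p 0 = (if lookup f 0 = 0 then 0 else 1)" by (rule psubst_at_0) simp
  ultimately show ?thesis using c assms(2) by (auto split: if_splits)
qed

lemma total_degree_1: "total_degree 1 = 0" by (simp add: total_degree_def)

lemma mpoly2_unit_iff: "f dvd 1 \<longleftrightarrow> f = (1 :: mpoly2)"
proof
  assume "f dvd 1"
  then obtain g where g: "1 = f * g" by (elim dvdE)
  then have nz: "f \<noteq> 0" "g \<noteq> 0" by auto
  have "total_degree f = 0" using total_degree_mult[OF nz] g by (simp flip: g add: total_degree_1)
  then show "f = 1" using nz by (intro total_degree_eq_0)
qed simp

lemma total_degree_pos: "f \<noteq> 0 \<Longrightarrow> f \<noteq> 1 \<Longrightarrow> total_degree f > 0"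
  using total_degree_eq_0 by blast

text \<open>
  Splitting off nontrivial factors lowers the total degree, and 1 is the only unit.
\<close>
lemma exists_irreducible_factor:
  assumes "f \<noteq> 0" "f \<noteq> 1"
  shows "\<exists>q g. irred q \<and> f = q * g"
  using assms
proof (induction "total_degree f" arbitrary: f rule: less_induct)
  case less
  show ?case
  proof (cases "irred f")
    case True
    then show ?thesis by (intro exI[of _ f] exI[of _ 1]) simp
  next
    case False
    then obtain a b where ab: "f = a * b" "a \<noteq> 1" "b \<noteq> 1"
      using less.prems unfolding Factorial_Ring.irreducible_def mpoly2_unit_iff by blast
    then have nz: "a \<noteq> 0" "b \<noteq> 0" using less.prems by auto
    then have "total_degree a < total_degree f" using ab total_degree_mult total_degree_pos by simp
    then obtain q g where "irred q" "a = q * g" using less.hyps nz ab by blast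
    then show ?thesis using ab by (intro exI[of _ q] exI[of _ "g * b"]) (simp add: mult.assoc)
  qed
qed

text \<open>
  Divisibility below is always taken in the whole polynomial ring. Factors of a nonzero polynomial
  in the variables \<open>V\<close> again involve only these variables (\<open>polys_over_inert\<close>), so it agrees with
  divisibility among the polynomials in the variables \<open>V\<close>.
\<close>
definition polys_over :: "nat set \<Rightarrow> mpoly2 set" where
  "polys_over V = {f. \<forall>m\<in>keys f. keys m \<subseteq> V}"

lemma polys_over_0 [simp]: "0 \<in> polys_over V" and polys_over_1 [simp]: "1 \<in> polys_over V"
  by (simp_all add: polys_over_def)

lemma polys_over_mvar: "i \<in> V \<Longrightarrow> mvar i \<in> polys_over V" by (simp add: polys_over_def mvar_def)

lemma polys_over_add: "f \<in> polys_over V \<Longrightarrow> g \<in> polys_over V \<Longrightarrow> f + g \<in> polys_over V"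
  unfolding polys_over_def using Poly_Mapping.keys_add[of f g] by blast

lemma polys_over_diff: "f \<in> polys_over V \<Longrightarrow> g \<in> polys_over V \<Longrightarrow> f - g \<in> polys_over V"
  using polys_over_add[of f V g] by (metis diff_conv_add_uminus mpoly2_uminus)

lemma polys_over_mult: "f \<in> polys_over V \<Longrightarrow> g \<in> polys_over V \<Longrightarrow> f * g \<in> polys_over V"
proof -
  assume fg: "f \<in> polys_over V" "g \<in> polys_over V"
  have "keys m \<subseteq> V" if m: "m \<in> keys (f * g)" for m
  proof -
    obtain a b where "m = a + b" "a \<in> keys f" "b \<in> keys g" using m keys_mult[of f g] by blast
    then show ?thesis using fg Poly_Mapping.keys_add[of a b] unfolding polys_over_def by blast
  qed
  then show ?thesis by (simp add: polys_over_def)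
qed

lemma polys_over_sum: "(\<And>i. i \<in> I \<Longrightarrow> h i \<in> polys_over V) \<Longrightarrow> sum h I \<in> polys_over V"
  by (induction I rule: infinite_finite_induct) (auto intro: polys_over_add)

lemma polys_over_power: "f \<in> polys_over V \<Longrightarrow> f ^ n \<in> polys_over V"
  by (induction n) (auto intro: polys_over_mult)

lemma polys_over_mono: "V \<subseteq> W \<Longrightarrow> polys_over V \<subseteq> polys_over W" by (auto simp: polys_over_def)

lemma polys_over_finite: "\<exists>V. finite V \<and> f \<in> polys_over V"
  by (rule exI[of _ "\<Union>m\<in>keys f. keys m"]) (auto simp: polys_over_def)

definition as_poly_in :: "nat \<Rightarrow> mpoly2 \<Rightarrow> mpoly2 poly" where
  "as_poly_in i = psubst (\<lambda>j. if j = i then [:0, 1:] else [:mvar j:])"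

lemma as_poly_in_retract: "poly (as_poly_in i f) (mvar i) = f"
  unfolding as_poly_in_def by (rule psubst_retract) simp

lemma as_poly_in_mult: "as_poly_in i (f * g) = as_poly_in i f * as_poly_in i g"
  and as_poly_in_diff: "as_poly_in i (f - g) = as_poly_in i f - as_poly_in i g"
  and as_poly_in_mvar: "as_poly_in i (mvar i) = [:0, 1:]"
  and as_poly_in_power: "as_poly_in i (f ^ n) = as_poly_in i f ^ n"
  by (simp_all add: as_poly_in_def psubst_mult psubst_add psubst_diff psubst_power)

lemma as_poly_in_eq_0_iff [simp]: "as_poly_in i f = 0 \<longleftrightarrow> f = 0"
  using as_poly_in_retract[of i f] by (auto simp: as_poly_in_def)

lemma as_poly_in_const: "f \<in> polys_over V \<Longrightarrow> i \<notin> V \<Longrightarrow> as_poly_in i f = [:f:]"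
  unfolding as_poly_in_def polys_over_def by (subst psubst_const[symmetric], rule psubst_cong) auto

lemma as_poly_in_coeff:
  assumes "f \<in> polys_over V"
  shows "pcoeff (as_poly_in i f) k \<in> polys_over (V - {i})"
proof -
  let ?P = "\<lambda>p. \<forall>k. pcoeff p k \<in> polys_over (V - {i})"
  have mult: "?P (p * q)" if "?P p" "?P q" for p q
    using that by (auto simp: coeff_mult intro!: polys_over_sum polys_over_mult)
  have one: "?P 1" by (auto simp: coeff_1)
  have power: "?P (p ^ n)" if "?P p" for p n
    using that by (induction n) (auto intro: one mult[rule_format])
  have prod: "?P (\<Prod>j\<in>J. h j)" if "\<And>j. j \<in> J \<Longrightarrow> ?P (h j)" for h :: "nat \<Rightarrow> _" and J
    using that by (induction J rule: infinite_finite_induct) (auto intro: one[rule_format] mult[rule_format])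
  have var: "?P (if j = i then [:0, 1:] else [:mvar j:])" if "j \<in> V" for j
    using that by (auto simp: coeff_pCons polys_over_mvar split: nat.split)
  have "?P (monomial_value (\<lambda>j. if j = i then [:0, 1:] else [:mvar j:]) m)" if "m \<in> keys f" for m
    unfolding monomial_value_def using that assms by (intro prod power var) (auto simp: polys_over_def)
  then show ?thesis unfolding as_poly_in_def psubst_def coeff_sum by (intro polys_over_sum) auto
qed

text \<open>
  A polynomial omits the variable \<open>i\<close> exactly if it is constant as a polynomial in that variable.
\<close>
lemma polys_over_inert:
  assumes "f * g \<in> polys_over V" "f * g \<noteq> 0"
  shows "f \<in> polys_over V"
proof -
  have "f \<in> polys_over (UNIV - {i})" if "i \<notin> V" for i
  proof -
    have "as_poly_in i f = [:f:]" unfolding as_poly_in_def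
      by (rule psubst_fixed_inert[where e = "mvar i" and g = g])
         (use assms that as_poly_in_const[of "f * g" V i] in \<open>auto simp: as_poly_in_def\<close>)
    then show ?thesis using as_poly_in_coeff[of f UNIV i 0] by (simp add: polys_over_def)
  qed
  then show ?thesis unfolding polys_over_def by blast
qed

lemma polys_over_inert': "f * g \<in> polys_over V \<Longrightarrow> f * g \<noteq> 0 \<Longrightarrow> g \<in> polys_over V"
  using polys_over_inert[of g f V] by (simp add: mult.commute)

text \<open>
  The statement for which the variables are adjoined one at a time. Primality is tested only against
  polynomials in the same variables, since the leading coefficients that occur in a pseudo-division
  by \<open>f\<close> and \<open>g\<close> have to be covered by the induction hypothesis.
\<close>
definition irreducible_prime_over :: "nat set \<Rightarrow> bool" where
  "irreducible_prime_over V \<longleftrightarrow> (\<forall>f g h. f \<in> polys_over V \<longrightarrow> g \<in> polys_over V \<longrightarrow> h \<in> polys_over V \<longrightarrow> irred f \<longrightarrow> f dvd g * h \<longrightarrow> f dvd g \<or> f dvd h)"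

lemma irreducible_prime_over_D: "irreducible_prime_over V \<Longrightarrow> irred f \<Longrightarrow> f dvd g * h \<Longrightarrow> f \<in> polys_over V \<Longrightarrow> g \<in> polys_over V \<Longrightarrow> h \<in> polys_over V \<Longrightarrow> f dvd g \<or> f dvd h"
  unfolding irreducible_prime_over_def by blast

lemma irred_nz: "irred f \<Longrightarrow> f \<noteq> 0" and irred_n1: "irred f \<Longrightarrow> f \<noteq> 1"
  and irredD: "irred f \<Longrightarrow> f = a * b \<Longrightarrow> a = 1 \<or> b = 1"
  unfolding Factorial_Ring.irreducible_def mpoly2_unit_iff by auto

lemma polys_over_empty: "f \<in> polys_over {} \<Longrightarrow> f = 0 \<or> f = 1"
proof -
  assume "f \<in> polys_over {}"
  have "m = 0" if "m \<in> keys f" for m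
  proof (rule poly_mapping_eqI)
    have "keys m = {}" using that \<open>f \<in> polys_over {}\<close> unfolding polys_over_def by blast
    then show "lookup m k = lookup 0 k" for k by (metis empty_iff in_keys_iff lookup_zero)
  qed
  then have "keys f \<subseteq> {0}" by blast
  then have "keys f = {} \<or> keys f = {0}" by (rule subset_singletonD)
  then show ?thesis using mpoly2_sum_keys[of f] by auto
qed

lemma irreducible_prime_over_empty: "irreducible_prime_over {}"
  unfolding irreducible_prime_over_def using irred_nz irred_n1 polys_over_empty by metis

lemma dvd_iff_coeffs:
  assumes "p \<in> polys_over V" "i \<notin> V"
  shows "p dvd g \<longleftrightarrow> (\<forall>k. p dvd pcoeff (as_poly_in i g) k)"
proof
  assume "p dvd g"
  then obtain h where "g = p * h" by (elim dvdE)
  then have "as_poly_in i g = [:p:] * as_poly_in i h" by (simp add: as_poly_in_mult as_poly_in_const[OF assms])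
  then show "\<forall>k. p dvd pcoeff (as_poly_in i g) k" by simp
next
  assume "\<forall>k. p dvd pcoeff (as_poly_in i g) k"
  then have "[:p:] dvd as_poly_in i g" by (simp add: const_poly_dvd_iff)
  then obtain q where "as_poly_in i g = [:p:] * q" by (elim dvdE)
  then have "g = p * poly q (mvar i)" using as_poly_in_retract[of i g] by simp
  then show "p dvd g" by simp
qed

text \<open>
  Gauss's argument: if \<open>r\<close> and \<open>s\<close> are the lowest degrees in the new variable at which \<open>p\<close> does not
  divide the coefficient of \<open>g\<close> and of \<open>h\<close>, then in degree \<open>r + s\<close> all terms but the product of these
  two coefficients are divisible by \<open>p\<close>.
\<close>
lemma irred_const_prime:
  assumes uf: "irreducible_prime_over V" and i: "i \<notin> V" and p: "irred p" "p \<in> polys_over V"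
    and g: "g \<in> polys_over (insert i V)" and h: "h \<in> polys_over (insert i V)" and dvd: "p dvd g * h"
  shows "p dvd g \<or> p dvd h"
proof (rule ccontr)
  assume "\<not> ?thesis"
  then have ex: "\<exists>k. \<not> p dvd pcoeff (as_poly_in i g) k" "\<exists>k. \<not> p dvd pcoeff (as_poly_in i h) k"
    using dvd_iff_coeffs[OF p(2) i, of g] dvd_iff_coeffs[OF p(2) i, of h] by blast+
  define r where "r = (LEAST k. \<not> p dvd pcoeff (as_poly_in i g) k)"
  define s where "s = (LEAST k. \<not> p dvd pcoeff (as_poly_in i h) k)"
  have r: "\<not> p dvd pcoeff (as_poly_in i g) r" "\<And>k. k < r \<Longrightarrow> p dvd pcoeff (as_poly_in i g) k"
    unfolding r_def using LeastI_ex[OF ex(1)] not_less_Least by blast+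
  have s: "\<not> p dvd pcoeff (as_poly_in i h) s" "\<And>k. k < s \<Longrightarrow> p dvd pcoeff (as_poly_in i h) k"
    unfolding s_def using LeastI_ex[OF ex(2)] not_less_Least by blast+
  have V: "insert i V - {i} = V" using i by auto
  have "p dvd pcoeff (as_poly_in i g * as_poly_in i h) (r + s)"
    using dvd dvd_iff_coeffs[OF p(2) i, of "g * h"] unfolding as_poly_in_mult by blast
  also have "pcoeff (as_poly_in i g * as_poly_in i h) (r + s) =
      (\<Sum>k\<in>{..r + s} - {r}. pcoeff (as_poly_in i g) k * pcoeff (as_poly_in i h) (r + s - k))
        + pcoeff (as_poly_in i g) r * pcoeff (as_poly_in i h) s"
    unfolding coeff_mult by (subst sum.remove[of _ r]) (auto simp: add.commute)
  also have "p dvd \<dots> \<longleftrightarrow> p dvd pcoeff (as_poly_in i g) r * pcoeff (as_poly_in i h) s"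
  proof (rule dvd_add_right_iff, rule dvd_sum)
    fix k assume "k \<in> {..r + s} - {r}"
    then have "k < r \<or> r + s - k < s" by auto
    then show "p dvd pcoeff (as_poly_in i g) k * pcoeff (as_poly_in i h) (r + s - k)"
      using r(2) s(2) by (auto intro: dvd_mult dvd_mult2)
  qed
  finally show False
    using irreducible_prime_over_D[OF uf p(1) _ p(2)] r(1) s(1) as_poly_in_coeff[OF g, of i r] as_poly_in_coeff[OF h, of i s]
    unfolding V by blast
qed

text \<open>
  The irreducible factors of \<open>a\<close> are prime and cannot divide \<open>f\<close>, which is irreducible and involves
  the new variable; so they divide the cofactor of \<open>f\<close> and can be cancelled one by one.
\<close>
lemma cancel_const:
  assumes uf: "irreducible_prime_over V" and i: "i \<notin> V" and f: "irred f" "f \<in> polys_over (insert i V)" "f \<notin> polys_over V"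
    and a: "a \<in> polys_over V" "a \<noteq> 0" and m: "m \<in> polys_over (insert i V)" and dvd: "f dvd a * m"
  shows "f dvd m"
  using a m dvd
proof (induction "total_degree a" arbitrary: a m rule: less_induct)
  case less
  show ?case
  proof (cases "a = 1 \<or> m = 0")
    case True
    then show ?thesis using less.prems by auto
  next
    case False
    then obtain p a' where p: "irred p" "a = p * a'" using exists_irreducible_factor less.prems by blast
    have pV: "p \<in> polys_over V" "a' \<in> polys_over V" using less.prems p polys_over_inert polys_over_inert' by metis+
    have VV: "polys_over V \<subseteq> polys_over (insert i V)" by (rule polys_over_mono) auto
    have nz: "p \<noteq> 0" "a' \<noteq> 0" using p less.prems by auto
    have lt: "total_degree a' < total_degree a"
      using p nz total_degree_mult total_degree_pos[of p] irred_n1[OF p(1)] by simp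
    obtain k where k: "a * m = f * k" using less.prems by (elim dvdE)
    have fk: "f * k \<in> polys_over (insert i V)" "f * k \<noteq> 0"
      using k less.prems False VV by (auto simp flip: k intro!: polys_over_mult)
    then have kV: "k \<in> polys_over (insert i V)" by (rule polys_over_inert')
    have "p dvd f * k" using k p by (metis dvd_triv_left mult.assoc)
    then have "p dvd f \<or> p dvd k"
      using irred_const_prime[OF uf i p(1) pV(1) f(2) kV] by blast
    moreover have "\<not> p dvd f"
    proof
      assume "p dvd f"
      then obtain u where "f = p * u" by (elim dvdE)
      then have "f = p" using irredD[OF f(1)] irred_n1[OF p(1)] by auto
      then show False using f(3) pV by simp
    qed
    ultimately obtain k' where "k = p * k'" by (auto elim: dvdE)
    then have "p * (a' * m) = p * (f * k')" using k p by (simp add: mult_ac)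
    then have "f dvd a' * m" using nz by simp
    then show ?thesis using less.hyps[OF lt pV(2) nz(2)] less.prems by blast
  qed
qed

text \<open>
  Every irreducible factor of \<open>a\<close> divides \<open>q\<close> or \<open>d\<close> and can be cancelled there. What remains is a
  factorisation of \<open>f\<close>, one of whose two factors is 1; up to the cancelled factors, \<open>d\<close> is then
  either \<open>f\<close> or 1.
\<close>
lemma dvd_or_const:
  assumes uf: "irreducible_prime_over V" and i: "i \<notin> V" and f: "irred f"
    and a: "a \<in> polys_over V" "a \<noteq> 0" and q: "q \<in> polys_over (insert i V)" and d: "d \<in> polys_over (insert i V)"
    and eq: "a * f = q * d"
  shows "f dvd d \<or> d \<in> polys_over V"
  using a q d eq
proof (induction "total_degree a" arbitrary: a q d rule: less_induct)
  case less
  show ?case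
  proof (cases "a = 1")
    case True
    then have "f = q * d" using less.prems by simp
    then show ?thesis using irredD[OF f] by fastforce
  next
    case False
    then obtain p a' where p: "irred p" "a = p * a'" using exists_irreducible_factor less.prems by blast
    have pV: "p \<in> polys_over V" "a' \<in> polys_over V" using less.prems p polys_over_inert polys_over_inert' by metis+
    have nz: "p \<noteq> 0" "a' \<noteq> 0" using p less.prems by auto
    have lt: "total_degree a' < total_degree a"
      using p nz total_degree_mult total_degree_pos[of p] irred_n1[OF p(1)] by simp
    have nz': "a * f \<noteq> 0" using less.prems(2) irred_nz[OF f] by simp
    have "p dvd q * d" using less.prems p by (metis dvd_triv_left mult.assoc)
    then have "p dvd q \<or> p dvd d"
      using irred_const_prime[OF uf i p(1) pV(1)] less.prems by blast
    then show ?thesis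
    proof
      assume "p dvd q"
      then obtain q' where q': "q = p * q'" by (elim dvdE)
      then have "p * (a' * f) = p * (q' * d)" using less.prems p by (simp add: mult_ac)
      then have e: "a' * f = q' * d" using nz by simp
      have "q' \<in> polys_over (insert i V)" using q' less.prems nz' polys_over_inert'[of p q'] by auto
      then show ?thesis using less.hyps[OF lt pV(2) nz(2) _ _ e] less.prems by blast
    next
      assume "p dvd d"
      then obtain d' where d': "d = p * d'" by (elim dvdE)
      then have "p * (a' * f) = p * (q * d')" using less.prems p by (simp add: mult_ac)
      then have e: "a' * f = q * d'" using nz by simp
      have "d' \<in> polys_over (insert i V)" using d' less.prems nz' polys_over_inert'[of p d'] by auto
      then have "f dvd d' \<or> d' \<in> polys_over V" using less.hyps[OF lt pV(2) nz(2) _ _ e] less.prems by blast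
      then show ?thesis using d' pV by (auto intro: polys_over_mult)
    qed
  qed
qed

text \<open>
  The multiplier \<open>a\<close> is a power of the leading coefficient of \<open>d\<close> in the new variable, which is what
  it takes to divide without inverting that coefficient.
\<close>
lemma pseudo_division:
  assumes i: "i \<notin> V" and d: "d \<in> polys_over (insert i V)" "d \<noteq> 0" and f: "f \<in> polys_over (insert i V)"
  shows "\<exists>a q. a \<in> polys_over V \<and> a \<noteq> 0 \<and> q \<in> polys_over (insert i V) \<and>
     (a * f - q * d = 0 \<or> pdeg (as_poly_in i (a * f - q * d)) < pdeg (as_poly_in i d))"
  using f
proof (induction "pdeg (as_poly_in i f)" arbitrary: f rule: less_induct)
  case less
  show ?case
  proof (cases "f = 0 \<or> pdeg (as_poly_in i f) < pdeg (as_poly_in i d)")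
    case True
    then show ?thesis by (intro exI[of _ 1] exI[of _ 0]) auto
  next
    case False
    define b where "b = lead_coeff (as_poly_in i d)"
    define c where "c = lead_coeff (as_poly_in i f)"
    define n where "n = pdeg (as_poly_in i f) - pdeg (as_poly_in i d)"
    define f' where "f' = b * f - c * mvar i ^ n * d"
    have V: "insert i V - {i} = V" using i by auto
    have bV: "b \<in> polys_over V" and cV: "c \<in> polys_over V"
      using as_poly_in_coeff[OF d(1), of i] as_poly_in_coeff[OF less.prems, of i] by (simp_all add: b_def c_def V)
    have b0: "b \<noteq> 0" using d by (simp add: b_def)
    have VV: "polys_over V \<subseteq> polys_over (insert i V)" by (rule polys_over_mono) auto
    have xV: "c * mvar i ^ n \<in> polys_over (insert i V)" using cV VV by (auto intro!: polys_over_mult polys_over_power polys_over_mvar)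
    then have f'V: "f' \<in> polys_over (insert i V)"
      unfolding f'_def using bV VV less.prems d by (auto intro!: polys_over_diff polys_over_mult)
    have eq: "as_poly_in i f' = Polynomial.smult b (as_poly_in i f) - Polynomial.monom c n * as_poly_in i d"
      by (simp add: f'_def as_poly_in_diff as_poly_in_mult as_poly_in_const[OF bV i] as_poly_in_const[OF cV i] as_poly_in_power
          as_poly_in_mvar monom_altdef)
    have deg: "pdeg (as_poly_in i f) = n + pdeg (as_poly_in i d)" using False by (simp add: n_def)
    have 1: "pcoeff (Polynomial.monom c n * as_poly_in i d) k = c * pcoeff (as_poly_in i d) (k - n)"
      if "k \<ge> pdeg (as_poly_in i f)" for k
      using that deg by (simp add: coeff_monom_mult)
    have zero: "pcoeff (as_poly_in i f') k = 0" if k: "k \<ge> pdeg (as_poly_in i f)" for k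
    proof (cases "k = pdeg (as_poly_in i f)")
      case True
      then have "k - n = pdeg (as_poly_in i d)" using deg by simp
      then show ?thesis using True unfolding eq coeff_diff 1[OF k] by (simp add: b_def c_def)
    next
      case False
      then have "pdeg (as_poly_in i d) < k - n" "pdeg (as_poly_in i f) < k" using k deg by auto
      then show ?thesis unfolding eq coeff_diff 1[OF k] by (simp add: coeff_eq_0)
    qed
    have "f' = 0 \<or> pdeg (as_poly_in i f') < pdeg (as_poly_in i f)"
    proof (rule ccontr)
      assume n: "\<not> ?thesis"
      then have "lead_coeff (as_poly_in i f') = 0" using zero by simp
      then show False using n by simp
    qed
    then show ?thesis
    proof
      assume "f' = 0"
      then show ?thesis using bV b0 xV unfolding f'_def by blast
    next
      assume "pdeg (as_poly_in i f') < pdeg (as_poly_in i f)"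
      from less.hyps[OF this f'V] obtain a q where
        aq: "a \<in> polys_over V" "a \<noteq> 0" "q \<in> polys_over (insert i V)"
        "a * f' - q * d = 0 \<or> pdeg (as_poly_in i (a * f' - q * d)) < pdeg (as_poly_in i d)" by blast
      have "a * f' - q * d = (a * b) * f - (a * (c * mvar i ^ n) + q) * d"
        unfolding f'_def by (simp add: algebra_simps)
      moreover have "a * (c * mvar i ^ n) + q \<in> polys_over (insert i V)"
        using aq xV VV by (auto intro!: polys_over_add polys_over_mult)
      moreover have "a * b \<in> polys_over V" "a * b \<noteq> 0" using aq bV b0 by (auto intro: polys_over_mult)
      ultimately show ?thesis using aq(4) by metis
    qed
  qed
qed

text \<open>
  Over the fraction field of the polynomials in \<open>V\<close> one would take a greatest common divisor \<open>d\<close> of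
  \<open>f\<close> and \<open>g\<close>. Here \<open>d\<close> is an element of least degree in the ideal \<open>(f, g)\<close>, and pseudo-division shows
  that it divides multiples \<open>a f\<close> and \<open>a' g\<close> by polynomials in \<open>V\<close>. By \<open>dvd_or_const\<close>, either \<open>f\<close>
  divides \<open>d\<close>, hence \<open>a' g\<close>, hence \<open>g\<close>; or \<open>d\<close> is a polynomial in \<open>V\<close>, and multiplying
  \<open>d = u f + v g\<close> by \<open>h\<close> shows that \<open>f\<close> divides \<open>d h\<close>, hence \<open>h\<close>.
\<close>
lemma irreducible_prime_over_insert:
  assumes uf: "irreducible_prime_over V" and i: "i \<notin> V"
  shows "irreducible_prime_over (insert i V)"
  unfolding irreducible_prime_over_def
proof (intro allI impI)
  fix f g h
  let ?B = "polys_over (insert i V)"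
  assume f: "f \<in> ?B" and g: "g \<in> ?B" and h: "h \<in> ?B" and irr: "irred f" and dvd: "f dvd g * h"
  show "f dvd g \<or> f dvd h"
  proof (cases "f \<in> polys_over V")
    case True
    then show ?thesis using irred_const_prime[OF uf i irr _ g h dvd] by blast
  next
    case fV: False
    note canc = cancel_const[OF uf i irr f fV]
    define S where "S = {u * f + v * g | u v. u \<in> ?B \<and> v \<in> ?B}"
    have "f = 1 * f + 0 * g" by simp
    then have fS: "f \<in> S" unfolding S_def using polys_over_1 polys_over_0 by blast
    have "f \<noteq> 0" using irr by (rule irred_nz)
    then obtain d where d: "d \<in> S" "d \<noteq> 0"
      and min: "\<And>e. e \<in> S \<Longrightarrow> e \<noteq> 0 \<Longrightarrow> pdeg (as_poly_in i d) \<le> pdeg (as_poly_in i e)"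
      using arg_min_nat_lemma[of "\<lambda>d. d \<in> S \<and> d \<noteq> 0" f "\<lambda>d. pdeg (as_poly_in i d)"] fS by blast
    obtain u v where uv: "d = u * f + v * g" "u \<in> ?B" "v \<in> ?B" using d unfolding S_def by blast
    have dB: "d \<in> ?B" using uv f g by (auto intro!: polys_over_add polys_over_mult)
    have VV: "polys_over V \<subseteq> ?B" by (rule polys_over_mono) auto
    have div: "\<exists>a q. a \<in> polys_over V \<and> a \<noteq> 0 \<and> q \<in> ?B \<and> a * e = q * d" if e: "e \<in> ?B" "e \<in> S" for e
    proof -
      obtain a q where aq: "a \<in> polys_over V" "a \<noteq> 0" "q \<in> ?B"
        "a * e - q * d = 0 \<or> pdeg (as_poly_in i (a * e - q * d)) < pdeg (as_poly_in i d)"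
        using pseudo_division[OF i dB d(2) e(1)] by blast
      obtain s t where st: "e = s * f + t * g" "s \<in> ?B" "t \<in> ?B" using e unfolding S_def by blast
      have "a * e - q * d = (a * s - q * u) * f + (a * t - q * v) * g"
        unfolding st uv by (simp add: algebra_simps)
      moreover have "a * s - q * u \<in> ?B" "a * t - q * v \<in> ?B"
        using aq st uv VV by (auto intro!: polys_over_diff polys_over_mult)
      ultimately have "a * e - q * d \<in> S" unfolding S_def by blast
      then have "a * e - q * d = 0" using min aq(4) by (meson leD)
      then show ?thesis using aq by auto
    qed
    obtain a q where aq: "a \<in> polys_over V" "a \<noteq> 0" "q \<in> ?B" "a * f = q * d"
      using div[OF f fS] by blast
    have "g = 0 * f + 1 * g" by simp
    then have "g \<in> S" unfolding S_def using polys_over_1 polys_over_0 by blast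
    then obtain a' q' where aq': "a' \<in> polys_over V" "a' \<noteq> 0" "q' \<in> ?B" "a' * g = q' * d"
      using div[OF g] by blast
    from dvd_or_const[OF uf i irr aq(1,2,3) dB aq(4)] show ?thesis
    proof
      assume "f dvd d"
      then have "f dvd a' * g" using aq' by simp
      then show ?thesis using canc[OF aq'(1,2) g] by blast
    next
      assume dV: "d \<in> polys_over V"
      have "d * h = u * h * f + v * (g * h)" unfolding uv by (simp add: algebra_simps)
      then have "f dvd d * h" using dvd by simp
      then show ?thesis using canc[OF dV d(2) h] by blast
    qed
  qed
qed

theorem mpoly2_irreducible_prime:
  assumes "irred f"
  shows "prime_elem f"
proof (rule prime_elemI)
  show "f \<noteq> 0" "\<not> f dvd 1" using assms by (simp_all add: Factorial_Ring.irreducible_def)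
  fix g h assume dvd: "f dvd g * h"
  obtain F G H where fin: "finite F" "finite G" "finite H" and mem: "f \<in> polys_over F" "g \<in> polys_over G" "h \<in> polys_over H"
    using polys_over_finite by metis
  let ?V = "F \<union> G \<union> H"
  have "irreducible_prime_over V" if "finite V" for V
    using that by (induction V rule: finite_induct) (auto intro: irreducible_prime_over_empty irreducible_prime_over_insert)
  then have "irreducible_prime_over ?V" using fin by simp
  then show "f dvd g \<or> f dvd h"
    by (rule irreducible_prime_over_D[OF _ assms dvd]) (use mem polys_over_mono[of F ?V] polys_over_mono[of G ?V] polys_over_mono[of H ?V] in auto)
qed

section \<open>The invariants of a shear\<close>

text \<open>
  The variables \<open>x\<^sub>i\<close> and \<open>y\<^sub>i\<close> are \<open>mvar (2 * i)\<close> and \<open>mvar (2 * i + 1)\<close>, and the parameter of the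
  shear is the variable of the univariate polynomials.
\<close>
definition shear :: "nat \<Rightarrow> mpoly2 poly" where
  "shear j = (if even j then [:mvar j:] else [:mvar j, mvar (j - 1):])"

definition shear_inv :: "mpoly2 set" where
  "shear_inv = {f. psubst shear f = [:f:]}"

lemma shear_invI: "psubst shear f = [:f:] \<Longrightarrow> f \<in> shear_inv"
  and shear_invD: "f \<in> shear_inv \<Longrightarrow> psubst shear f = [:f:]"
  by (simp_all add: shear_inv_def)

lemma shear_inv_0: "0 \<in> shear_inv" and shear_inv_1: "1 \<in> shear_inv"
  and shear_inv_add: "f \<in> shear_inv \<Longrightarrow> g \<in> shear_inv \<Longrightarrow> f + g \<in> shear_inv"
  and shear_inv_mult: "f \<in> shear_inv \<Longrightarrow> g \<in> shear_inv \<Longrightarrow> f * g \<in> shear_inv"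
  by (simp_all add: shear_inv_def psubst_add psubst_mult one_pCons)

lemma shear_inv_inert:
  assumes "f * g \<in> shear_inv" "f * g \<noteq> 0"
  shows "f \<in> shear_inv" "g \<in> shear_inv"
proof -
  have v: "poly (shear i) 0 = mvar i" for i by (simp add: shear_def)
  show "f \<in> shear_inv"
    by (rule shear_invI, rule psubst_fixed_inert[where v = shear and g = g, OF v]) (use assms shear_invD in auto)
  show "g \<in> shear_inv"
    by (rule shear_invI, rule psubst_fixed_inert[where v = shear and g = f, OF v])
       (use assms shear_invD[of "f * g"] in \<open>auto simp: mult.commute\<close>)
qed

lemma mvar_even_inv: "mvar (2 * i) \<in> shear_inv"
  by (simp add: shear_inv_def shear_def)

text \<open>
  The minors of the matrix with the rows \<open>(x\<^sub>i)\<close> and \<open>(y\<^sub>i)\<close>; the shear adds a multiple of the first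
  row to the second.
\<close>
definition minor :: "nat \<Rightarrow> nat \<Rightarrow> mpoly2" where
  "minor i j = mvar (2 * i) * mvar (2 * j + 1) - mvar (2 * j) * mvar (2 * i + 1)"

lemma minor_inv: "minor i j \<in> shear_inv"
  by (simp add: shear_inv_def minor_def psubst_diff psubst_mult shear_def mult.commute)

text \<open>
  The expansion of a determinant with the rows \<open>x\<close>, \<open>x\<close>, \<open>y\<close>, which vanishes.
\<close>
lemma minor_relation: "mvar (2 * k) * minor i j = mvar (2 * i) * minor k j + mvar (2 * j) * minor i k"
  unfolding minor_def by (simp add: algebra_simps)

lemma psubst_comp:
  "psubst w (poly (psubst v f) e) = psubst (\<lambda>i. psubst w (poly (v i) e)) f"
proof (induction f rule: mpoly2_induct)
  case (monomial m)
  have prod: "psubst w (\<Prod>i\<in>A. h i) = (\<Prod>i\<in>A. psubst w (h i))" for A and h :: "nat \<Rightarrow> mpoly2"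
    by (induction A rule: infinite_finite_induct) (simp_all add: psubst_mult)
  show ?case by (simp add: poly_monomial_value) (simp add: monomial_value_def prod psubst_power)
qed (simp_all add: psubst_add)

lemma coeff_mult_1: "pcoeff (p * q) 1 = pcoeff p 0 * pcoeff q 1 + pcoeff p 1 * pcoeff q 0"
  by (simp add: coeff_mult atMost_Suc add.commute)

text \<open>
  Modulo the square of the auxiliary variable, a substitution depends on its linear terms
  additively, by the product rule.
\<close>
lemma psubst_tangent:
  assumes "\<And>j. pcoeff (u j) 0 = pcoeff (w j) 0 \<and> pcoeff (v j) 0 = pcoeff (w j) 0 \<and>
      pcoeff (w j) 1 = pcoeff (u j) 1 + pcoeff (v j) 1"
  shows "pcoeff (psubst u f) 0 = pcoeff (psubst w f) 0 \<and> pcoeff (psubst v f) 0 = pcoeff (psubst w f) 0 \<and>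
      pcoeff (psubst w f) 1 = pcoeff (psubst u f) 1 + pcoeff (psubst v f) 1"
proof -
  let ?P = "\<lambda>p q r :: mpoly2 poly. pcoeff p 0 = pcoeff r 0 \<and> pcoeff q 0 = pcoeff r 0 \<and> pcoeff r 1 = pcoeff p 1 + pcoeff q 1"
  have mult: "?P (p * p') (q * q') (r * r')" if "?P p q r" "?P p' q' r'" for p p' q q' r r'
    using that unfolding coeff_mult_1 by (simp add: coeff_mult_0 algebra_simps)
  have one: "?P 1 1 1" by simp
  have power: "?P (p ^ n) (q ^ n) (r ^ n)" if "?P p q r" for p q r n
  proof (induction n)
    case (Suc n)
    show ?case unfolding power_Suc by (rule mult[OF that Suc])
  qed (use one in simp)
  have prod: "?P (\<Prod>j\<in>J. a j) (\<Prod>j\<in>J. b j) (\<Prod>j\<in>J. c j)" if "\<And>j. ?P (a j) (b j) (c j)" for a b c and J :: "nat set"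
  proof (induction J rule: infinite_finite_induct)
    case (insert x F)
    show ?case unfolding prod.insert[OF insert.hyps] by (rule mult[OF that insert.IH])
  qed (use one in simp_all)
  show ?thesis
  proof (induction f rule: mpoly2_induct)
    case (monomial m)
    show ?case unfolding psubst_monomial monomial_value_def by (rule prod, rule power, rule assms)
  next
    case (add f g)
    then show ?case by (simp add: psubst_add algebra_simps)
  qed simp
qed

lemma psubst_coeff_1_const:
  assumes "\<And>j. pcoeff (v j) 1 = 0"
  shows "pcoeff (psubst v f) 1 = 0"
  using psubst_tangent[of v v v f] assms by simp

lemma psubst_coeff_1_cong:
  assumes "\<And>j. pcoeff (u j) 0 = pcoeff (w j) 0" "\<And>j. pcoeff (u j) 1 = pcoeff (w j) 1"
  shows "pcoeff (psubst u f) 1 = pcoeff (psubst w f) 1"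
  using psubst_tangent[of u w "\<lambda>j. [:pcoeff (w j) 0:]" f]
    psubst_coeff_1_const[of "\<lambda>j. [:pcoeff (w j) 0:]" f] assms by simp

text \<open>
  The coefficient of the monomial \<open>X\<^sub>a\<close>. It is read off as an element 0 or 1 of the polynomial ring,
  which is where a substitution takes its values; the same holds for the constant coefficient.
\<close>
definition lin_coeff :: "nat \<Rightarrow> mpoly2 \<Rightarrow> mpoly2" where
  "lin_coeff a f = pcoeff (psubst (\<lambda>j. if j = a then [:0, 1:] else 0) f) 1"

definition const_coeff :: "mpoly2 \<Rightarrow> mpoly2" where
  "const_coeff f = (if lookup f 0 = 0 then 0 else 1)"

lemma const_coeff_eq: "(\<And>j. pcoeff (v j) 0 = 0) \<Longrightarrow> pcoeff (psubst v f) 0 = const_coeff f"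
  using psubst_at_0[of v f] by (simp add: poly_0_coeff_0 const_coeff_def)

lemma const_coeff_add: "const_coeff (f + g) = const_coeff f + const_coeff g" and const_coeff_mult: "const_coeff (f * g) = const_coeff f * const_coeff g"
  and const_coeff_0: "const_coeff 0 = 0"
  using const_coeff_eq[of "\<lambda>_. 0" "f + g"] const_coeff_eq[of "\<lambda>_. 0" "f * g"] const_coeff_eq[of "\<lambda>_. 0" "f"]
    const_coeff_eq[of "\<lambda>_. 0" "g"] const_coeff_eq[of "\<lambda>_. 0" 0]
  by (simp_all add: psubst_add psubst_mult coeff_mult_0)

lemma lin_coeff_add: "lin_coeff a (f + g) = lin_coeff a f + lin_coeff a g"
  and lin_coeff_0: "lin_coeff a 0 = 0"
  and lin_coeff_mvar: "lin_coeff a (mvar b) = (if a = b then 1 else 0)"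
  by (simp_all add: lin_coeff_def psubst_add)

lemma lin_coeff_mult: "lin_coeff a (f * g) = const_coeff f * lin_coeff a g + lin_coeff a f * const_coeff g"
  unfolding lin_coeff_def psubst_mult coeff_mult_1 by (subst const_coeff_eq, simp)+ simp

lemma lin_coeff_outside:
  assumes "f \<in> polys_over V" "a \<notin> V"
  shows "lin_coeff a f = 0"
proof -
  have "psubst (\<lambda>j. if j = a then [:0, 1:] else 0) f = psubst (\<lambda>_. 0) f"
    using assms unfolding polys_over_def by (intro psubst_cong) auto
  then show ?thesis unfolding lin_coeff_def using psubst_coeff_1_const[of "\<lambda>_. 0" f] by simp
qed

text \<open>
  For parameter 1 an invariant satisfies \<open>g(x, y + x) = g(x, y)\<close>. The coefficient of \<open>x\<^sub>i\<close> on the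
  left-hand side is the sum of those of \<open>x\<^sub>i\<close> and \<open>y\<^sub>i\<close> in \<open>g\<close>.
\<close>
lemma lin_coeff_shear_inv:
  assumes "g \<in> shear_inv"
  shows "lin_coeff (2 * i + 1) g = 0"
proof -
  let ?v = "\<lambda>a j. if j = a then [:0, 1:] else (0 :: mpoly2 poly)"
  let ?w = "\<lambda>j. psubst (?v (2 * i)) (poly (shear j) 1)"
  have "poly (psubst shear g) 1 = g" using shear_invD[OF assms] by simp
  then have "lin_coeff (2 * i) g = pcoeff (psubst ?w g) 1"
    unfolding lin_coeff_def using psubst_comp[of "?v (2 * i)" shear g 1] by simp
  also have "\<dots> = lin_coeff (2 * i) g + lin_coeff (2 * i + 1) g"
  proof -
    have "?w j = ?v (2 * i) j + ?v (2 * i + 1) j" for j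
      by (auto simp: shear_def psubst_add elim: oddE)
    then show ?thesis unfolding lin_coeff_def
      using psubst_tangent[of "?v (2 * i)" ?w "?v (2 * i + 1)" g] by simp
  qed
  finally show ?thesis by simp
qed

text \<open>
  Substitute \<open>x\<^sub>0 = T\<^sup>2\<close>, \<open>y\<^sub>1 = T\<close> and 0 for all other variables. The minor becomes \<open>T\<^sup>3\<close>, so the
  coefficients of \<open>T\<^sup>3\<close> equate the constant coefficient of \<open>t\<close> with the coefficient of \<open>T\<close> in the
  image of \<open>g\<close>. As \<open>x\<^sub>0\<close> only contributes to higher powers, the latter is the coefficient of \<open>y\<^sub>1\<close> in
  the invariant \<open>g\<close>.
\<close>
lemma colon_no_constant:
  assumes eq: "t * minor 0 1 = mvar 0 * g + mvar 2 * h" and g: "g \<in> shear_inv"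
  shows "const_coeff t = 0"
proof -
  let ?v = "\<lambda>j. if j = 0 then [:0, 0, 1:] else if j = 3 then [:0, 1:] else (0 :: mpoly2 poly)"
  have "psubst ?v (t * minor 0 1) = psubst ?v (mvar 0 * g + mvar 2 * h)" using eq by simp
  then have "psubst ?v t * [:0, 0, 0, 1:] = [:0, 0, 1:] * psubst ?v g"
    by (simp add: psubst_mult psubst_add psubst_diff minor_def numeral_3_eq_3)
  then have "pcoeff (psubst ?v t * [:0, 0, 0, 1:]) 3 = pcoeff ([:0, 0, 1:] * psubst ?v g) 3" by simp
  then have "pcoeff (psubst ?v t) 0 = pcoeff (psubst ?v g) 1"
    by (simp add: numeral_3_eq_3 mult.commute[of "psubst ?v t"])
  moreover have "pcoeff (psubst ?v t) 0 = const_coeff t" by (rule const_coeff_eq) simp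
  moreover have "pcoeff (psubst ?v g) 1 = lin_coeff 3 g"
    unfolding lin_coeff_def by (rule psubst_coeff_1_cong) auto
  ultimately show ?thesis using lin_coeff_shear_inv[OF g, of 1] by simp
qed

lemma mvar_dvd_cancel:
  assumes "mvar i dvd mvar j * p" "i \<noteq> j"
  shows "mvar i dvd p"
proof -
  obtain r where r: "mvar j * p = mvar i * r" using assms by (elim dvdE)
  have "poly (as_poly_in i (mvar j * p)) 0 = poly (as_poly_in i (mvar i * r)) 0" using r by simp
  then have "mvar j * poly (as_poly_in i p) 0 = 0"
    using assms by (simp add: as_poly_in_mult as_poly_in_mvar as_poly_in_const[OF polys_over_mvar[of j "{j}"]])
  moreover have "mvar j \<noteq> 0" by (simp add: mvar_def) (metis lookup_single_eq lookup_zero zero_neq_one)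
  ultimately have "poly (as_poly_in i p) 0 = 0" by simp
  then obtain q where "as_poly_in i p = [:0, 1:] * q" by (auto simp: poly_eq_0_iff_dvd elim: dvdE)
  then have "p = mvar i * poly q (mvar i)" using as_poly_in_retract[of i p] by simp
  then show ?thesis by simp
qed

definition shear_ring :: "mpoly2 ring" where
  "shear_ring = \<lparr>carrier = shear_inv, monoid.mult = (*), one = 1, ring.zero = 0, add = (+)\<rparr>"

lemma shear_ring_simps [simp]:
  "carrier shear_ring = shear_inv" "monoid.mult shear_ring = (*)" "one shear_ring = 1"
  "ring.zero shear_ring = 0" "add shear_ring = (+)"
  by (simp_all add: shear_ring_def)

lemma shear_ring_cring: "cring shear_ring"
proof (rule cringI)
  show "abelian_group shear_ring"
  proof (rule abelian_groupI)
    fix x assume "x \<in> carrier shear_ring"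
    then show "\<exists>y\<in>carrier shear_ring. y \<oplus>\<^bsub>shear_ring\<^esub> x = \<zero>\<^bsub>shear_ring\<^esub>"
      by (intro bexI[of _ x]) (simp_all add: mpoly2_add_self)
  qed (auto simp: shear_inv_add shear_inv_0 add_ac)
  show "comm_monoid shear_ring"
    by (rule comm_monoidI) (auto simp: shear_inv_mult shear_inv_1 mult_ac)
qed (simp add: distrib_right)

lemma shear_ring_domain: "domain shear_ring"
  by (rule domain.intro[OF shear_ring_cring]) (unfold_locales, auto)

lemma shear_inv_dvd: "g = a * k \<Longrightarrow> g \<in> shear_inv \<Longrightarrow> g \<noteq> 0 \<Longrightarrow> k \<in> shear_inv - {0}"
  using shear_inv_inert(2)[of a k] by auto

lemma shear_ring_Units: "Units (mult_of shear_ring) = {1}"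
proof -
  have "x = 1" if "y * x = 1" for x y :: mpoly2
    using that mpoly2_unit_iff[of x] by (metis dvd_triv_right)
  then show ?thesis unfolding Units_def by (auto simp: shear_inv_1)
qed

lemma shear_ring_irreducible:
  assumes a: "a \<in> shear_inv" "a \<noteq> 0" and irr: "Divisibility.irreducible (mult_of shear_ring) a"
  shows "irred a"
proof (rule Factorial_Ring.irreducibleI)
  show "a \<noteq> 0" by fact
  show "\<not> a dvd 1" using irr unfolding Divisibility.irreducible_def shear_ring_Units mpoly2_unit_iff by simp
  fix b c assume bc: "a = b * c"
  have bc': "b \<in> shear_inv - {0}" "c \<in> shear_inv - {0}"
    using shear_inv_inert[of b c] a bc by auto
  show "b dvd 1 \<or> c dvd 1"
  proof (cases "a divides\<^bsub>mult_of shear_ring\<^esub> b")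
    case True
    then obtain d where "b = a * d" by (auto simp: factor_def)
    then have "b * (c * d) = b * 1" using bc by (simp add: mult_ac)
    then have "c * d = 1" using bc' by simp
    then show ?thesis by (metis dvd_triv_left)
  next
    case False
    then have "properfactor (mult_of shear_ring) b a"
      using bc bc' by (auto simp: properfactor_def factor_def)
    then show ?thesis using irr bc' unfolding Divisibility.irreducible_def shear_ring_Units by auto
  qed
qed

text \<open>
  Factors and quotients of nonzero invariants are invariant. So an element that is irreducible among
  the invariants is irreducible and hence prime as a polynomial, and then prime among the invariants.
  Proper divisors have smaller total degree.
\<close>
theorem shear_ring_factorial: "factorial_domain shear_ring"
proof -
  interpret D: domain shear_ring by (rule shear_ring_domain)
  let ?M = "mult_of shear_ring"
  have cc: "comm_monoid_cancel ?M" by unfold_locales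
  have "divisor_chain_condition_monoid ?M"
  proof (rule divisor_chain_condition_monoid.intro[OF cc], unfold_locales)
    have "total_degree x < total_degree y" if xy: "x \<in> carrier ?M" "y \<in> carrier ?M" "properfactor ?M x y" for x y
    proof -
      from xy(3) obtain c where c: "y = x * c" by (auto simp: properfactor_def factor_def)
      have "c \<noteq> 1"
      proof
        assume "c = 1"
        then have "y divides\<^bsub>?M\<^esub> x" using c by (auto simp: factor_def shear_inv_1)
        then show False using xy(3) by (simp add: properfactor_def)
      qed
      then show ?thesis using c xy(1,2) total_degree_mult[of x c] total_degree_pos[of c] by auto
    qed
    then show "wf {(x, y). x \<in> carrier ?M \<and> y \<in> carrier ?M \<and> properfactor ?M x y}"
      by (intro wf_subset[OF wf_measure[of total_degree]]) auto
  qed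
  moreover have "primeness_condition_monoid ?M"
  proof (rule primeness_condition_monoid.intro[OF cc], unfold_locales)
    fix a assume a: "a \<in> carrier ?M" and irr: "Divisibility.irreducible ?M a"
    then have pr: "prime_elem a" using mpoly2_irreducible_prime shear_ring_irreducible by simp
    have div: "a divides\<^bsub>?M\<^esub> g" if "g \<in> shear_inv" "g \<noteq> 0" "a dvd g" for g
      using that shear_inv_dvd by (auto simp: factor_def elim!: dvdE)
    show "Divisibility.prime ?M a"
      unfolding Divisibility.prime_def
    proof (intro conjI ballI impI)
      show "a \<notin> Units ?M" using irr by (simp add: Divisibility.irreducible_def)
      fix g h assume gh: "g \<in> carrier ?M" "h \<in> carrier ?M" "a divides\<^bsub>?M\<^esub> g \<otimes>\<^bsub>?M\<^esub> h"
      then have "a dvd g * h" by (auto simp: factor_def)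
      then have "a dvd g \<or> a dvd h" using pr by (simp add: prime_elem_dvd_mult_iff)
      then show "a divides\<^bsub>?M\<^esub> g \<or> a divides\<^bsub>?M\<^esub> h" using div gh by auto
    qed
  qed
  ultimately have "factorial_monoid ?M" using factorial_condition_one by blast
  then show ?thesis by (rule factorial_domain.intro[OF shear_ring_domain])
qed

lemma shear_ring_char: "ring_char shear_ring = 2"
proof -
  interpret D: domain shear_ring by (rule shear_ring_domain)
  have "1 \<in> carrier (add_monoid shear_ring)" by (simp add: shear_inv_1)
  moreover have "[n] \<cdot>\<^bsub>shear_ring\<^esub> 1 = of_nat n" for n :: nat
    by (induction n) (simp_all add: add_pow_def nat_pow_def add.commute)
  ultimately have ord: "D.add.ord 1 dvd n \<longleftrightarrow> of_nat n = (0 :: mpoly2)" for n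
    using D.add.pow_eq_id[of 1 n] by (simp add: shear_inv_1)
  have "D.add.ord 1 dvd 2" using ord[of 2] by simp
  then have "D.add.ord 1 \<le> 2" "D.add.ord 1 \<noteq> 0"
    by (metis dvd_imp_le zero_less_numeral, metis dvd_0_left_iff zero_neq_numeral)
  moreover have "D.add.ord 1 \<noteq> 1" using ord[of 1] by (metis dvd_refl of_nat_1 zero_neq_one)
  ultimately have "D.add.ord 1 = 2" by linarith
  then show ?thesis by (simp add: ring_char_def)
qed

text \<open>
  The colon ideal \<open>((x\<^sub>0, x\<^sub>1) : p\<^sub>0\<^sub>1)\<close> in the ring of invariants.
\<close>
definition shear_colon :: "mpoly2 set" where
  "shear_colon = {t \<in> shear_inv. \<exists>g\<in>shear_inv. \<exists>h\<in>shear_inv. t * minor 0 1 = mvar 0 * g + mvar 2 * h}"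

text \<open>
  Finitely many polynomials involve finitely many variables. For an \<open>x\<^sub>k\<close> that does not occur in the
  supposed generators, the invariants with neither a constant term nor a term \<open>x\<^sub>k\<close> form an ideal
  that contains the generators, but not the element \<open>x\<^sub>k\<close> of the colon ideal.
\<close>
lemma shear_colon_not_fg: "\<not> fg_ideal shear_ring shear_colon"
proof
  interpret D: domain shear_ring by (rule shear_ring_domain)
  assume "fg_ideal shear_ring shear_colon"
  then obtain S where S: "finite S" "S \<subseteq> shear_inv" "shear_colon = genideal shear_ring S"
    by (auto simp: fg_ideal_def)
  obtain V where V: "finite V" "\<And>s. s \<in> S \<Longrightarrow> s \<in> polys_over V"
  proof -
    obtain W where W: "\<And>s :: mpoly2. finite (W s) \<and> s \<in> polys_over (W s)" using polys_over_finite by metis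
    show ?thesis
    proof (rule that[of "\<Union>(W ` S)"])
      show "finite (\<Union>(W ` S))" using W S(1) by auto
      show "s \<in> polys_over (\<Union>(W ` S))" if "s \<in> S" for s
        using W[of s] that polys_over_mono[of "W s" "\<Union>(W ` S)"] by blast
    qed
  qed
  have "infinite (range (\<lambda>k::nat. 2 * k))" by (rule range_inj_infinite) (auto intro: injI)
  then obtain k where k: "2 * k \<notin> V" using V(1) by (metis finite_subset image_subsetI)
  have "ideal {r \<in> shear_inv. const_coeff r = 0 \<and> lin_coeff (2 * k) r = 0} shear_ring" (is "ideal ?K _")
  proof (rule idealI[OF D.ring_axioms])
    have inv: "\<ominus>\<^bsub>shear_ring\<^esub> x = x" if "x \<in> shear_inv" for x
      using that D.minus_equality[of x x] by (simp add: mpoly2_add_self)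
    show "subgroup ?K (add_monoid shear_ring)"
      by (rule D.add.subgroupI)
         (auto simp: inv shear_inv_0 shear_inv_add const_coeff_0 const_coeff_add lin_coeff_0 lin_coeff_add intro!: exI[of _ 0])
  qed (auto simp: shear_inv_mult const_coeff_mult lin_coeff_mult)
  moreover have "S \<subseteq> ?K"
  proof
    fix s assume s: "s \<in> S"
    then have "s \<in> shear_colon" using S D.genideal_self by auto
    then have "const_coeff s = 0" "s \<in> shear_inv" unfolding shear_colon_def using colon_no_constant by blast+
    then show "s \<in> ?K" using lin_coeff_outside[OF V(2)[OF s] k] by simp
  qed
  ultimately have "shear_colon \<subseteq> ?K" unfolding S(3) by (rule D.genideal_minimal)
  moreover have "mvar (2 * k) \<in> shear_colon"
    using minor_relation[of k 0 1] minor_inv mvar_even_inv unfolding shear_colon_def by auto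
  ultimately show False by (auto simp: lin_coeff_mvar)
qed

section \<open>Relations in a tensor product\<close>

abbreviation tensor_free where
  "tensor_free M N \<equiv> free_Abelian_group (carrier M \<times> carrier N)"

definition tensor_gens where
  "tensor_gens R M N =
     ({frag_of (m \<oplus>\<^bsub>M\<^esub> m', n) - frag_of (m, n) - frag_of (m', n) | m m' n.
         m \<in> carrier M \<and> m' \<in> carrier M \<and> n \<in> carrier N} \<union>
      {frag_of (m, n \<oplus>\<^bsub>N\<^esub> n') - frag_of (m, n) - frag_of (m, n') | m n n'.
         m \<in> carrier M \<and> n \<in> carrier N \<and> n' \<in> carrier N} \<union>
      {frag_of (r \<odot>\<^bsub>M\<^esub> m, n) - frag_of (m, r \<odot>\<^bsub>N\<^esub> n) | r m n.
         r \<in> carrier R \<and> m \<in> carrier M \<and> n \<in> carrier N})"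

lemma tensor_relations_eq: "tensor_relations R M N = generate (tensor_free M N) (tensor_gens R M N)"
  unfolding tensor_relations_def tensor_gens_def ..

lemma keys_diff2: "Poly_Mapping.keys x \<subseteq> S \<Longrightarrow> Poly_Mapping.keys y \<subseteq> S \<Longrightarrow> Poly_Mapping.keys (x - y :: _ \<Rightarrow>\<^sub>0 int) \<subseteq> S"
  using keys_diff[of x y] by blast

locale two_modules =
  M: module R M + N: module R N
  for R :: "('r, 'x) ring_scheme" and M :: "('r, 'm, 'y) module_scheme" and N :: "('r, 'n, 'z) module_scheme"
begin

abbreviation "F \<equiv> tensor_free M N"
abbreviation "K \<equiv> tensor_relations R M N"

lemma gens_carrier: "tensor_gens R M N \<subseteq> carrier F"
proof
  fix x assume "x \<in> tensor_gens R M N"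
  then show "x \<in> carrier F"
    unfolding tensor_gens_def carrier_free_Abelian_group_iff
    by (elim UnE CollectE exE conjE; hypsubst) (intro keys_diff2; simp add: keys_frag_of)+
qed

lemma K_subgroup: "subgroup K F"
  unfolding tensor_relations_eq by (rule group.generate_is_subgroup[OF group_free_Abelian_group gens_carrier])

lemma K_carrier: "z \<in> K \<Longrightarrow> Poly_Mapping.keys z \<subseteq> carrier M \<times> carrier N"
  using subgroup.mem_carrier[OF K_subgroup] by simp

lemma K_0 [simp]: "0 \<in> K"
  using subgroup.one_closed[OF K_subgroup] by simp

lemma K_add: "x \<in> K \<Longrightarrow> y \<in> K \<Longrightarrow> x + y \<in> K"
  using subgroup.m_closed[OF K_subgroup] by simp

lemma K_uminus: "x \<in> K \<Longrightarrow> - x \<in> K"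
  using subgroup.m_inv_closed[OF K_subgroup, of x] K_carrier[of x] by simp

lemma K_diff: "x \<in> K \<Longrightarrow> y \<in> K \<Longrightarrow> x - y \<in> K"
  using K_add[of x "- y"] K_uminus by simp

lemma K_gens: "x \<in> tensor_gens R M N \<Longrightarrow> x \<in> K"
  unfolding tensor_relations_eq by (rule generate.incl)

lemma K_left: "m \<in> carrier M \<Longrightarrow> m' \<in> carrier M \<Longrightarrow> n \<in> carrier N \<Longrightarrow>
    frag_of (m \<oplus>\<^bsub>M\<^esub> m', n) - frag_of (m, n) - frag_of (m', n) \<in> K"
  and K_right: "m \<in> carrier M \<Longrightarrow> n \<in> carrier N \<Longrightarrow> n' \<in> carrier N \<Longrightarrow>
    frag_of (m, n \<oplus>\<^bsub>N\<^esub> n') - frag_of (m, n) - frag_of (m, n') \<in> K"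
  and K_smult: "r \<in> carrier R \<Longrightarrow> m \<in> carrier M \<Longrightarrow> n \<in> carrier N \<Longrightarrow>
    frag_of (r \<odot>\<^bsub>M\<^esub> m, n) - frag_of (m, r \<odot>\<^bsub>N\<^esub> n) \<in> K"
  by (rule K_gens, unfold tensor_gens_def, blast)+

lemma K_induct [consumes 1, case_names zero gen diff]:
  assumes z: "z \<in> K" and P0: "P 0" and Pg: "\<And>x. x \<in> tensor_gens R M N \<Longrightarrow> P x"
    and Pd: "\<And>x y. x \<in> K \<Longrightarrow> y \<in> K \<Longrightarrow> P x \<Longrightarrow> P y \<Longrightarrow> P (x - y)"
  shows "P z"
proof -
  have "z \<in> K \<and> P z" using z unfolding tensor_relations_eq
  proof (induction rule: generate.induct)
    case one
    then show ?case using P0 K_0 by (simp add: tensor_relations_eq)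
  next
    case (incl h)
    then show ?case using Pg generate.incl by metis
  next
    case (inv h)
    then have h: "h \<in> K" "Poly_Mapping.keys h \<subseteq> carrier M \<times> carrier N" using K_gens K_carrier by blast+
    have "- h \<in> K \<and> P (- h)" using Pd[OF K_0 h(1) P0 Pg[OF inv]] K_uminus[OF h(1)] by simp
    then show ?case using h by (simp add: tensor_relations_eq)
  next
    case (eng x y)
    then have xy: "x \<in> K" "P x" "y \<in> K" "P y" by (simp_all add: tensor_relations_eq)
    then have "P (- y)" using Pd[OF K_0 xy(3) P0 xy(4)] by simp
    then have "P (x + y)" using Pd[OF xy(1) K_uminus[OF xy(3)] xy(2)] by simp
    then show ?case using K_add[OF xy(1,3)] by (simp add: tensor_relations_eq)
  qed
  then show ?thesis ..
qed

lemma coset: "K #>\<^bsub>F\<^esub> z = {k + z | k. k \<in> K}"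
  unfolding r_coset_def by auto

lemma coset_eq_iff: "K #>\<^bsub>F\<^esub> z = K #>\<^bsub>F\<^esub> w \<longleftrightarrow> z - w \<in> K"
proof
  assume "K #>\<^bsub>F\<^esub> z = K #>\<^bsub>F\<^esub> w"
  moreover have "z \<in> K #>\<^bsub>F\<^esub> z" unfolding coset using K_0 by force
  ultimately obtain k where "k \<in> K" "z = k + w" unfolding coset by blast
  then show "z - w \<in> K" by simp
next
  assume zw: "z - w \<in> K"
  have "k + z \<in> K #>\<^bsub>F\<^esub> w" if "k \<in> K" for k
    unfolding coset using K_add[OF that zw] by (intro CollectI exI[of _ "k + (z - w)"]) simp
  moreover have "k + w \<in> K #>\<^bsub>F\<^esub> z" if "k \<in> K" for k
    unfolding coset using K_diff[OF that zw] by (intro CollectI exI[of _ "k - (z - w)"]) simp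
  ultimately show "K #>\<^bsub>F\<^esub> z = K #>\<^bsub>F\<^esub> w" unfolding coset[of z] coset[of w] by blast
qed

lemma carrier_tensor: "carrier (tensor_product R M N) = {K #>\<^bsub>F\<^esub> z | z. z \<in> carrier F}"
  unfolding tensor_product_def FactGroup_def RCOSETS_def by auto

text \<open>
  The universal property of the tensor product for maps into the quotient of \<open>W\<close> by \<open>L\<close>, without
  forming the quotient: \<open>\<phi>\<close> has to be bilinear and balanced only up to elements of \<open>L\<close>.
\<close>
lemma hom_from_relations:
  fixes W (structure)
  assumes W: "abelian_group W" and L: "additive_subgroup L W"
    and phi: "\<And>m n. m \<in> carrier M \<Longrightarrow> n \<in> carrier N \<Longrightarrow> \<phi> m n \<in> carrier W"
    and left: "\<And>m m' n. m \<in> carrier M \<Longrightarrow> m' \<in> carrier M \<Longrightarrow> n \<in> carrier N \<Longrightarrow>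
       \<phi> (m \<oplus>\<^bsub>M\<^esub> m') n \<ominus>\<^bsub>W\<^esub> \<phi> m n \<ominus>\<^bsub>W\<^esub> \<phi> m' n \<in> L"
    and right: "\<And>m n n'. m \<in> carrier M \<Longrightarrow> n \<in> carrier N \<Longrightarrow> n' \<in> carrier N \<Longrightarrow>
       \<phi> m (n \<oplus>\<^bsub>N\<^esub> n') \<ominus>\<^bsub>W\<^esub> \<phi> m n \<ominus>\<^bsub>W\<^esub> \<phi> m n' \<in> L"
    and smult: "\<And>r m n. r \<in> carrier R \<Longrightarrow> m \<in> carrier M \<Longrightarrow> n \<in> carrier N \<Longrightarrow>
       \<phi> (r \<odot>\<^bsub>M\<^esub> m) n \<ominus>\<^bsub>W\<^esub> \<phi> m (r \<odot>\<^bsub>N\<^esub> n) \<in> L"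
  obtains h where
    "\<And>m n. m \<in> carrier M \<Longrightarrow> n \<in> carrier N \<Longrightarrow> h (frag_of (m, n)) = \<phi> m n"
    "\<And>x y. x \<in> carrier F \<Longrightarrow> y \<in> carrier F \<Longrightarrow> h (x - y) = h x \<ominus>\<^bsub>W\<^esub> h y"
    "\<And>z. z \<in> K \<Longrightarrow> h z \<in> L"
proof -
  interpret W: abelian_group W by fact
  interpret L: additive_subgroup L W by fact
  obtain h where h: "h \<in> hom F (add_monoid W)"
    "\<And>p. p \<in> carrier M \<times> carrier N \<Longrightarrow> h (frag_of p) = (\<lambda>(m, n). \<phi> m n) p"
    by (rule comm_group.free_Abelian_group_universal[OF W.a_comm_group, of "\<lambda>(m, n). \<phi> m n" "carrier M \<times> carrier N"])
       (use phi in auto)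
  have hc: "h x \<in> carrier W" if "x \<in> carrier F" for x using hom_in_carrier[OF h(1) that] by simp
  have hadd: "h (x + y) = h x \<oplus>\<^bsub>W\<^esub> h y" if "x \<in> carrier F" "y \<in> carrier F" for x y
    using hom_mult[OF h(1) that] by simp
  have hd: "h (x - y) = h x \<ominus>\<^bsub>W\<^esub> h y" if xy: "x \<in> carrier F" "y \<in> carrier F" for x y
  proof -
    have d: "x - y \<in> carrier F" using xy keys_diff2 by simp
    have "h x = h (x - y) \<oplus>\<^bsub>W\<^esub> h y" using hadd[OF d xy(2)] by simp
    then show ?thesis using hc[OF d] hc[OF xy(2)] by (simp add: W.minus_eq W.a_assoc W.r_neg)
  qed
  have hf: "h (frag_of (m, n)) = \<phi> m n" if "m \<in> carrier M" "n \<in> carrier N" for m n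
    using h(2)[of "(m, n)"] that by simp
  have h3: "h (frag_of p - frag_of q - frag_of r) = h (frag_of p) \<ominus>\<^bsub>W\<^esub> h (frag_of q) \<ominus>\<^bsub>W\<^esub> h (frag_of r)"
    if pqr: "p \<in> carrier M \<times> carrier N" "q \<in> carrier M \<times> carrier N" "r \<in> carrier M \<times> carrier N" for p q r
  proof -
    have "frag_of p - frag_of q \<in> carrier F" using pqr by (simp add: keys_diff2 keys_frag_of)
    then show ?thesis using pqr by (simp add: hd keys_frag_of)
  qed
  have hK: "h z \<in> L" if "z \<in> K" for z
    using that
  proof (induction rule: K_induct)
    case zero
    have "h (0 - 0) = h 0 \<ominus>\<^bsub>W\<^esub> h 0" by (rule hd) simp_all
    then show ?case using hc[of 0] by (simp add: W.minus_eq W.r_neg)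
  next
    case (gen x)
    then consider
      (left) m m' n where "x = frag_of (m \<oplus>\<^bsub>M\<^esub> m', n) - frag_of (m, n) - frag_of (m', n)"
         "m \<in> carrier M" "m' \<in> carrier M" "n \<in> carrier N"
      | (right) m n n' where "x = frag_of (m, n \<oplus>\<^bsub>N\<^esub> n') - frag_of (m, n) - frag_of (m, n')"
         "m \<in> carrier M" "n \<in> carrier N" "n' \<in> carrier N"
      | (smult) r m n where "x = frag_of (r \<odot>\<^bsub>M\<^esub> m, n) - frag_of (m, r \<odot>\<^bsub>N\<^esub> n)"
         "r \<in> carrier R" "m \<in> carrier M" "n \<in> carrier N"
      unfolding tensor_gens_def by blast
    then show ?case
    proof cases
      case left
      then show ?thesis using assms(4)[of m m' n] by (simp add: h3 hf)
    next
      case right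
      then show ?thesis using assms(5)[of m n n'] by (simp add: h3 hf)
    next
      case smult
      then show ?thesis using assms(6)[of r m n] by (simp add: hd hf keys_frag_of)
    qed
  next
    case (diff x y)
    then have "h (x - y) = h x \<ominus>\<^bsub>W\<^esub> h y" using K_carrier by (intro hd) simp_all
    then show ?case using diff L.a_inv_closed by (simp add: W.minus_eq)
  qed
  show ?thesis by (rule that[OF hf hd hK])
qed

end

text \<open>
  The homomorphism of free abelian groups that induces \<open>tensor_map\<close> on the quotients.
\<close>
definition tensor_lift where
  "tensor_lift f = frag_extend (\<lambda>(m, n). frag_of (m, f n))"

lemma tensor_lift_simps [simp]:
  "tensor_lift f (frag_of (m, n)) = frag_of (m, f n)"
  "tensor_lift f (x - y) = tensor_lift f x - tensor_lift f y"
  "tensor_lift f (x + y) = tensor_lift f x + tensor_lift f y"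
  "tensor_lift f 0 = 0"
  by (simp_all add: tensor_lift_def frag_extend_diff frag_extend_add)

lemma (in two_modules) lift_relations:
  assumes N': "module R N'" and f: "f \<in> linear_maps R N N'" and z: "z \<in> K"
  shows "tensor_lift f z \<in> tensor_relations R M N'"
proof -
  interpret T: two_modules R M N' using M.module_axioms N' by (rule two_modules.intro)
  have fN: "f n \<in> carrier N'" if "n \<in> carrier N" for n using f that by (auto simp: linear_maps_def)
  have fadd: "f (n \<oplus>\<^bsub>N\<^esub> n') = f n \<oplus>\<^bsub>N'\<^esub> f n'" if "n \<in> carrier N" "n' \<in> carrier N" for n n'
    using f that by (auto simp: linear_maps_def)
  have fsm: "f (r \<odot>\<^bsub>N\<^esub> n) = r \<odot>\<^bsub>N'\<^esub> f n" if "r \<in> carrier R" "n \<in> carrier N" for r n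
    using f that by (auto simp: linear_maps_def)
  show ?thesis using z
  proof (induction rule: K_induct)
    case (gen x)
    then show ?case unfolding tensor_gens_def
      by (auto simp: fadd fsm fN intro!: T.K_left T.K_right T.K_smult)
  qed (auto intro: T.K_diff)
qed

text \<open>
  Passing to differences of representatives removes the cosets from the injectivity condition in
  the definition of flatness.
\<close>
lemma tensor_map_inj_iff:
  assumes M: "module R M" and N: "module R N" and N': "module R N'" and f: "f \<in> linear_maps R N N'"
  shows "inj_on (tensor_map R M N' f) (carrier (tensor_product R M N)) \<longleftrightarrow>
     (\<forall>z\<in>carrier (tensor_free M N). tensor_lift f z \<in> tensor_relations R M N' \<longrightarrow> z \<in> tensor_relations R M N)"
proof -
  interpret S: two_modules R M N using M N by (rule two_modules.intro)
  interpret T: two_modules R M N' using M N' by (rule two_modules.intro)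
  note K = S.lift_relations[OF N' f]
  have map: "tensor_map R M N' f (S.K #>\<^bsub>S.F\<^esub> z) = T.K #>\<^bsub>T.F\<^esub> tensor_lift f z" for z
  proof
    show "tensor_map R M N' f (S.K #>\<^bsub>S.F\<^esub> z) \<subseteq> T.K #>\<^bsub>T.F\<^esub> tensor_lift f z"
    proof
      fix w assume "w \<in> tensor_map R M N' f (S.K #>\<^bsub>S.F\<^esub> z)"
      then obtain k' k where k: "k' \<in> T.K" "k \<in> S.K" "w = k' + tensor_lift f (k + z)"
        unfolding tensor_map_def set_mult_def S.coset tensor_lift_def[symmetric] by auto
      then show "w \<in> T.K #>\<^bsub>T.F\<^esub> tensor_lift f z"
        unfolding T.coset using T.K_add[OF k(1) K[OF k(2)]]
        by (intro CollectI exI[of _ "k' + tensor_lift f k"]) (simp add: add.assoc)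
    qed
    show "T.K #>\<^bsub>T.F\<^esub> tensor_lift f z \<subseteq> tensor_map R M N' f (S.K #>\<^bsub>S.F\<^esub> z)"
    proof
      fix w assume "w \<in> T.K #>\<^bsub>T.F\<^esub> tensor_lift f z"
      then obtain k' where k': "k' \<in> T.K" "w = k' + tensor_lift f z" unfolding T.coset by blast
      have "z \<in> S.K #>\<^bsub>S.F\<^esub> z" unfolding S.coset using S.K_0 by force
      then have "tensor_lift f z \<in> tensor_lift f ` (S.K #>\<^bsub>S.F\<^esub> z)" by (rule imageI)
      then show "w \<in> tensor_map R M N' f (S.K #>\<^bsub>S.F\<^esub> z)"
        unfolding tensor_map_def set_mult_def tensor_lift_def[symmetric] k'(2) using k'(1)
        by (intro UN_I[of k'] UN_I[of "tensor_lift f z"]) simp_all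
    qed
  qed
  show ?thesis
  proof
    assume inj: "inj_on (tensor_map R M N' f) (carrier (tensor_product R M N))"
    show "\<forall>z\<in>carrier S.F. tensor_lift f z \<in> T.K \<longrightarrow> z \<in> S.K"
    proof (intro ballI impI)
      fix z assume z: "z \<in> carrier S.F" "tensor_lift f z \<in> T.K"
      have "tensor_map R M N' f (S.K #>\<^bsub>S.F\<^esub> z) = tensor_map R M N' f (S.K #>\<^bsub>S.F\<^esub> 0)"
        unfolding map T.coset_eq_iff using z by simp
      moreover have "0 \<in> carrier S.F" by simp
      ultimately have "S.K #>\<^bsub>S.F\<^esub> z = S.K #>\<^bsub>S.F\<^esub> 0"
        using z inj unfolding S.carrier_tensor by (intro inj_onD[OF inj]) (auto simp: S.carrier_tensor)
      then show "z \<in> S.K" unfolding S.coset_eq_iff by simp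
    qed
  next
    assume *: "\<forall>z\<in>carrier S.F. tensor_lift f z \<in> T.K \<longrightarrow> z \<in> S.K"
    show "inj_on (tensor_map R M N' f) (carrier (tensor_product R M N))"
    proof (rule inj_onI, unfold S.carrier_tensor, elim CollectE exE conjE)
      fix C D z w assume zw: "z \<in> carrier S.F" "w \<in> carrier S.F" "C = S.K #>\<^bsub>S.F\<^esub> z" "D = S.K #>\<^bsub>S.F\<^esub> w"
        and eq: "tensor_map R M N' f C = tensor_map R M N' f D"
      have "tensor_lift f (z - w) \<in> T.K" using eq unfolding zw map T.coset_eq_iff by simp
      moreover have "z - w \<in> carrier S.F" using zw(1,2) by (simp add: keys_diff2)
      ultimately have "z - w \<in> S.K" using * by blast
      then show "C = D" unfolding zw S.coset_eq_iff .
    qed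
  qed
qed

section \<open>Principal ideals of a domain\<close>

lemma ideal_module_simps [simp]:
  "carrier (ideal_module R I) = I" "add (ideal_module R I) = add R"
  "ring.zero (ideal_module R I) = ring.zero R" "module.smult (ideal_module R I) = monoid.mult R"
  by (simp_all add: ideal_module_def)

context cring begin

lemma ideal_module_module:
  assumes "ideal I R"
  shows "module R (ideal_module R I)"
proof -
  interpret I: ideal I R by fact
  show ?thesis
  proof (rule moduleI[OF is_cring])
    show "abelian_group (ideal_module R I)"
    proof (rule abelian_groupI)
      fix x assume "x \<in> carrier (ideal_module R I)"
      then show "\<exists>y\<in>carrier (ideal_module R I). y \<oplus>\<^bsub>ideal_module R I\<^esub> x = \<zero>\<^bsub>ideal_module R I\<^esub>"
        using I.Icarr I.a_inv_closed l_neg by (intro bexI[of _ "\<ominus> x"]) auto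
    qed (auto simp: a_ac I.Icarr)
  qed (auto simp: I.Icarr I.I_l_closed l_distr r_distr m_assoc)
qed

lemma fg_ideal_principal: "a \<in> carrier R \<Longrightarrow> fg_ideal R (PIdl a)"
  unfolding fg_ideal_def using cgenideal_ideal cgenideal_eq_genideal by (intro conjI exI[of _ "{a}"]) auto

lemma cgenideal_mem: "x \<in> PIdl a \<longleftrightarrow> (\<exists>r\<in>carrier R. x = r \<otimes> a)"
  by (auto simp: cgenideal_def)

lemma cgenideal_subset: "x \<in> PIdl a \<Longrightarrow> a \<in> carrier R \<Longrightarrow> PIdl x \<subseteq> PIdl a"
  by (rule cgenideal_minimal[OF cgenideal_ideal])

lemma cgenideal_zero: "PIdl \<zero> = {\<zero>}"
  unfolding cgenideal_def by (auto intro!: exI[of _ \<zero>])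

lemma linear_maps_zero:
  assumes "module R M" "module R N" "f \<in> linear_maps R M N"
  shows "f \<zero>\<^bsub>M\<^esub> = \<zero>\<^bsub>N\<^esub>"
proof -
  interpret M: module R M by fact
  interpret N: module R N by fact
  have "f (\<zero>\<^bsub>M\<^esub> \<oplus>\<^bsub>M\<^esub> \<zero>\<^bsub>M\<^esub>) = f \<zero>\<^bsub>M\<^esub> \<oplus>\<^bsub>N\<^esub> f \<zero>\<^bsub>M\<^esub>" "f \<zero>\<^bsub>M\<^esub> \<in> carrier N"
    using assms(3) unfolding linear_maps_def by blast+
  then show ?thesis by simp
qed

end

lemma (in abelian_group) sum_minus_minus:
  "x \<in> carrier G \<Longrightarrow> y \<in> carrier G \<Longrightarrow> x \<oplus> y \<ominus> x \<ominus> y = \<zero>"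
  using r_neg[of "x \<oplus> y"] by (simp add: minus_eq a_assoc minus_add)

context domain begin

lemma cgenideal_coeff_unique:
  "a \<in> carrier R \<Longrightarrow> a \<noteq> \<zero> \<Longrightarrow> r \<in> carrier R \<Longrightarrow> s \<in> carrier R \<Longrightarrow> r \<otimes> a = s \<otimes> a \<Longrightarrow> r = s"
  using m_rcancel by auto

text \<open>
  Every \<open>r\<close> satisfies \<open>\<zero> = r \<otimes> \<zero>\<close>, so the coefficient has to be chosen for the zero ideal; the value
  \<open>\<zero>\<close> makes the equation \<open>x = quot_coeff a x \<otimes> a\<close> true in that case as well.
\<close>
definition quot_coeff :: "'a \<Rightarrow> 'a \<Rightarrow> 'a" where
  "quot_coeff a x = (if a = \<zero> then \<zero> else THE r. r \<in> carrier R \<and> x = r \<otimes> a)"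

lemma quot_coeff_mult:
  "quot_coeff a (r \<otimes> a) = r" if "a \<in> carrier R" "a \<noteq> \<zero>" "r \<in> carrier R"
proof -
  have "(THE s. s \<in> carrier R \<and> r \<otimes> a = s \<otimes> a) = r"
    by (rule the_equality) (use that cgenideal_coeff_unique[of a r] in metis)+
  then show ?thesis using that by (simp add: quot_coeff_def)
qed

lemma quot_coeff:
  assumes "a \<in> carrier R" "x \<in> PIdl a"
  shows "quot_coeff a x \<in> carrier R" "x = quot_coeff a x \<otimes> a"
  using assms quot_coeff_mult unfolding cgenideal_mem
  by (cases "a = \<zero>"; auto simp: quot_coeff_def)+

lemma quot_coeff_add:
  assumes "a \<in> carrier R" "a \<noteq> \<zero>" "x \<in> PIdl a" "y \<in> PIdl a"
  shows "quot_coeff a (x \<oplus> y) = quot_coeff a x \<oplus> quot_coeff a y"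
proof -
  obtain r s where "r \<in> carrier R" "x = r \<otimes> a" "s \<in> carrier R" "y = s \<otimes> a"
    using assms(3,4) unfolding cgenideal_mem by blast
  then show ?thesis using assms(1,2) by (simp add: l_distr[symmetric] quot_coeff_mult)
qed

lemma quot_coeff_smult:
  assumes "a \<in> carrier R" "a \<noteq> \<zero>" "x \<in> PIdl a" "t \<in> carrier R"
  shows "quot_coeff a (t \<otimes> x) = t \<otimes> quot_coeff a x"
proof -
  obtain r where "r \<in> carrier R" "x = r \<otimes> a" using assms(3) unfolding cgenideal_mem by blast
  then show ?thesis using assms(1,2,4) by (simp add: m_assoc[symmetric] quot_coeff_mult)
qed

text \<open>
  A nonzero principal ideal is free on its generator, so a lift of \<open>f\<close> is determined by a preimage
  of \<open>f a\<close>.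
\<close>
lemma principal_projective:
  assumes a: "a \<in> carrier R"
  shows "projective R (ideal_module R (PIdl a))"
  unfolding projective_def
proof (intro conjI allI impI)
  let ?P = "ideal_module R (PIdl a)"
  show P: "module R ?P" by (rule ideal_module_module[OF cgenideal_ideal[OF a]])
  fix A :: "('a, 'a \<Rightarrow> 'a) module" and B :: "('a, 'a) module" and g f
  assume *: "module R A \<and> module R B \<and> g \<in> linear_maps R A B \<and> g ` carrier A = carrier B \<and> f \<in> linear_maps R ?P B"
  then interpret A: module R A by blast
  interpret B: module R B using * by blast
  have aP: "a \<in> PIdl a" by (rule cgenideal_self[OF a])
  have fa: "f a \<in> carrier B" using * aP by (auto simp: linear_maps_def)
  show "\<exists>h\<in>linear_maps R ?P A. \<forall>x\<in>carrier ?P. g (h x) = f x"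
  proof (cases "a = \<zero>")
    case True
    have "(\<lambda>x. \<zero>\<^bsub>A\<^esub>) \<in> linear_maps R ?P A" by (simp add: linear_maps_def)
    moreover have "g \<zero>\<^bsub>A\<^esub> = \<zero>\<^bsub>B\<^esub>" "f \<zero> = \<zero>\<^bsub>B\<^esub>"
      using linear_maps_zero[of A B g] linear_maps_zero[of ?P B f] * P by auto
    ultimately show ?thesis using True cgenideal_zero by (intro bexI[of _ "\<lambda>x. \<zero>\<^bsub>A\<^esub>"]) auto
  next
    case False
    have "f a \<in> g ` carrier A" using * fa by simp
    then obtain y where y: "y \<in> carrier A" "g y = f a" by (elim imageE) simp
    let ?h = "\<lambda>x. quot_coeff a x \<odot>\<^bsub>A\<^esub> y"
    have "?h \<in> linear_maps R ?P A"
      using y quot_coeff(1)[OF a]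
      by (auto simp: linear_maps_def quot_coeff_add[OF a False] quot_coeff_smult[OF a False] A.smult_l_distr A.smult_assoc1)
    moreover have "g (?h x) = f x" if x: "x \<in> PIdl a" for x
    proof -
      have "g (?h x) = quot_coeff a x \<odot>\<^bsub>B\<^esub> f a"
      proof -
        have "g \<in> linear_maps R A B" using * by blast
        then have "\<forall>r\<in>carrier R. g (r \<odot>\<^bsub>A\<^esub> y) = r \<odot>\<^bsub>B\<^esub> g y" using y by (simp add: linear_maps_def)
        then show ?thesis using quot_coeff(1)[OF a x] y by simp
      qed
      also have "\<dots> = f (quot_coeff a x \<otimes> a)"
      proof -
        have "f \<in> linear_maps R ?P B" using * by blast
        then have "\<forall>r\<in>carrier R. f (r \<otimes> a) = r \<odot>\<^bsub>B\<^esub> f a" using aP by (simp add: linear_maps_def)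
        then show ?thesis using quot_coeff(1)[OF a x] by simp
      qed
      also have "quot_coeff a x \<otimes> a = x" using quot_coeff(2)[OF a x] by (rule sym)
      finally show ?thesis .
    qed
    ultimately show ?thesis by (intro bexI[of _ ?h]) auto
  qed
qed

text \<open>
  Because \<open>r a \<otimes> n = a \<otimes> r n\<close>, every tensor has the form \<open>a \<otimes> n\<close>. For \<open>a \<noteq> 0\<close> the map
  \<open>r a \<otimes> n' \<mapsto> r n'\<close> recovers \<open>f n\<close> from the image \<open>a \<otimes> f n\<close>, and \<open>f\<close> is injective.
\<close>
lemma principal_flat:
  assumes a: "a \<in> carrier R"
  shows "flat R (ideal_module R (PIdl a))"
  unfolding flat_def
proof (intro conjI allI impI)
  let ?M = "ideal_module R (PIdl a)"
  show M: "module R ?M" by (rule ideal_module_module[OF cgenideal_ideal[OF a]])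
  fix N N' :: "('a, 'a) module" and f
  assume *: "module R N \<and> module R N' \<and> f \<in> linear_maps R N N' \<and> inj_on f (carrier N)"
  then have N: "module R N" and N': "module R N'" and f: "f \<in> linear_maps R N N'" by blast+
  interpret S: two_modules R ?M N using M N by (rule two_modules.intro)
  interpret T: two_modules R ?M N' using M N' by (rule two_modules.intro)
  have aP: "a \<in> PIdl a" by (rule cgenideal_self[OF a])
  have a0: "frag_of (m, \<zero>\<^bsub>N\<^esub>) \<in> S.K" if "m \<in> PIdl a" for m
    using S.K_uminus[OF S.K_right[of m "\<zero>\<^bsub>N\<^esub>" "\<zero>\<^bsub>N\<^esub>"]] that by simp
  have red: "\<exists>n\<in>carrier N. z - frag_of (a, n) \<in> S.K" if "z \<in> carrier S.F" for z
  proof -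
    have "Poly_Mapping.keys z \<subseteq> carrier ?M \<times> carrier N" using that by simp
    then show ?thesis
    proof (induction rule: free_Abelian_group_induct[consumes 1, case_names zero diff one])
      case zero
      show ?case using S.K_uminus[OF a0[OF aP]] by (intro bexI[of _ "\<zero>\<^bsub>N\<^esub>"]) auto
    next
      case (diff x y)
      then obtain n n' where n: "n \<in> carrier N" "n' \<in> carrier N"
        "x - frag_of (a, n) \<in> S.K" "y - frag_of (a, n') \<in> S.K" by blast
      have "n \<ominus>\<^bsub>N\<^esub> n' \<oplus>\<^bsub>N\<^esub> n' = n" using n by (simp add: S.N.minus_eq S.N.a_assoc S.N.l_neg)
      then have "frag_of (a, n) - frag_of (a, n \<ominus>\<^bsub>N\<^esub> n') - frag_of (a, n') \<in> S.K"
        using S.K_right[of a "n \<ominus>\<^bsub>N\<^esub> n'" n'] aP n by simp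
      from S.K_add[OF S.K_diff[OF n(3,4)] this] have "x - y - frag_of (a, n \<ominus>\<^bsub>N\<^esub> n') \<in> S.K"
        by (simp add: algebra_simps)
      then show ?case using n by blast
    next
      case (one p)
      then obtain m n where p: "p = (m, n)" "m \<in> PIdl a" "n \<in> carrier N" by auto
      then obtain r where r: "r \<in> carrier R" "m = r \<otimes> a" unfolding cgenideal_mem by blast
      then show ?case using S.K_smult[of r a n] p aP by (intro bexI[of _ "r \<odot>\<^bsub>N\<^esub> n"]) auto
    qed
  qed
  show "inj_on (tensor_map R ?M N' f) (carrier (tensor_product R ?M N))"
    unfolding tensor_map_inj_iff[OF M N N' f]
  proof (intro ballI impI)
    fix z assume z: "z \<in> carrier S.F" "tensor_lift f z \<in> T.K"
    obtain n where n: "n \<in> carrier N" "z - frag_of (a, n) \<in> S.K" using red[OF z(1)] by blast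
    show "z \<in> S.K"
    proof (cases "a = \<zero>")
      case True
      have "frag_of (\<zero> \<otimes> a, n) - frag_of (a, \<zero> \<odot>\<^bsub>N\<^esub> n) \<in> S.K" using S.K_smult[of \<zero> a n] aP n by simp
      then have "frag_of (a, n) \<in> S.K" using S.K_add[OF _ a0[OF aP]] True n by fastforce
      from S.K_add[OF n(2) this] show ?thesis by simp
    next
      case False
      have fn: "f n \<in> carrier N'" using f n by (auto simp: linear_maps_def)
      have "tensor_lift f (z - frag_of (a, n)) \<in> T.K" using S.lift_relations[OF N' f n(2)] .
      from T.K_diff[OF z(2) this] have K: "frag_of (a, f n) \<in> T.K" by simp
      obtain h where h: "\<And>m n. m \<in> PIdl a \<Longrightarrow> n \<in> carrier N' \<Longrightarrow> h (frag_of (m, n)) = quot_coeff a m \<odot>\<^bsub>N'\<^esub> n"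
        "\<And>z. z \<in> T.K \<Longrightarrow> h z \<in> {\<zero>\<^bsub>N'\<^esub>}"
      proof (rule T.hom_from_relations[of N' "{\<zero>\<^bsub>N'\<^esub>}" "\<lambda>m n. quot_coeff a m \<odot>\<^bsub>N'\<^esub> n"])
        show "abelian_group N'" by (rule T.N.abelian_group_axioms)
        show "additive_subgroup {\<zero>\<^bsub>N'\<^esub>} N'"
          by (rule additive_subgroup.intro) (rule T.N.add.subgroupI; simp)
      next
        fix m m' n assume mn: "m \<in> carrier ?M" "m' \<in> carrier ?M" "n \<in> carrier N'"
        then show "quot_coeff a (m \<oplus>\<^bsub>?M\<^esub> m') \<odot>\<^bsub>N'\<^esub> n \<ominus>\<^bsub>N'\<^esub> quot_coeff a m \<odot>\<^bsub>N'\<^esub> n \<ominus>\<^bsub>N'\<^esub> quot_coeff a m' \<odot>\<^bsub>N'\<^esub> n \<in> {\<zero>\<^bsub>N'\<^esub>}"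
          using quot_coeff(1)[OF a, of m] quot_coeff(1)[OF a, of m']
          by (simp add: quot_coeff_add[OF a False] T.N.smult_l_distr T.N.sum_minus_minus)
      next
        fix m n n' assume mn: "m \<in> carrier ?M" "n \<in> carrier N'" "n' \<in> carrier N'"
        then show "quot_coeff a m \<odot>\<^bsub>N'\<^esub> (n \<oplus>\<^bsub>N'\<^esub> n') \<ominus>\<^bsub>N'\<^esub> quot_coeff a m \<odot>\<^bsub>N'\<^esub> n \<ominus>\<^bsub>N'\<^esub> quot_coeff a m \<odot>\<^bsub>N'\<^esub> n' \<in> {\<zero>\<^bsub>N'\<^esub>}"
          using quot_coeff(1)[OF a, of m] by (simp add: T.N.smult_r_distr T.N.sum_minus_minus)
      next
        fix r m n assume mn: "r \<in> carrier R" "m \<in> carrier ?M" "n \<in> carrier N'"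
        then have "quot_coeff a (r \<otimes> m) \<odot>\<^bsub>N'\<^esub> n = quot_coeff a m \<odot>\<^bsub>N'\<^esub> (r \<odot>\<^bsub>N'\<^esub> n)"
          using quot_coeff(1)[OF a, of m]
          by (simp add: quot_coeff_smult[OF a False] T.N.smult_assoc1[symmetric] m_comm)
        then show "quot_coeff a (r \<odot>\<^bsub>?M\<^esub> m) \<odot>\<^bsub>N'\<^esub> n \<ominus>\<^bsub>N'\<^esub> quot_coeff a m \<odot>\<^bsub>N'\<^esub> (r \<odot>\<^bsub>N'\<^esub> n) \<in> {\<zero>\<^bsub>N'\<^esub>}"
          using mn quot_coeff(1)[OF a, of m] by (simp add: T.N.minus_eq T.N.r_neg)
      qed (use quot_coeff(1)[OF a] in auto)
      have "quot_coeff a a = \<one>" using quot_coeff_mult[OF a False, of \<one>] a by simp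
      then have "f n = \<zero>\<^bsub>N'\<^esub>" using h(1)[OF aP fn] h(2)[OF K] fn by simp
      then have "n = \<zero>\<^bsub>N\<^esub>" using * linear_maps_zero[OF N N' f] n(1) by (metis inj_onD S.N.zero_closed)
      then show ?thesis using S.K_add[OF n(2) a0[OF aP]] by simp
    qed
  qed
qed

end

section \<open>Factorial domains are G-GCD rings\<close>

lemma (in abelian_group) minus_eq_minusI:
  assumes "p \<oplus> q = r \<oplus> s" "p \<in> carrier G" "q \<in> carrier G" "r \<in> carrier G" "s \<in> carrier G"
  shows "p \<ominus> r = s \<ominus> q"
proof -
  have "p = p \<oplus> q \<ominus> q" using assms(2-) by (simp add: minus_eq a_assoc r_neg)
  also have "\<dots> = (s \<ominus> q) \<oplus> r" unfolding assms(1) using assms(2-) by (simp add: minus_eq a_ac)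
  finally have "p \<ominus> r = (s \<ominus> q) \<oplus> r \<ominus> r" by simp
  then show ?thesis using assms(2-) by (simp add: minus_eq a_assoc r_neg)
qed

context factorial_domain begin

lemma lcm_exists:
  assumes a: "a \<in> carrier R" "a \<noteq> \<zero>" and b: "b \<in> carrier R" "b \<noteq> \<zero>"
  obtains l a' b' where "l \<in> carrier R" "a' \<in> carrier R" "b' \<in> carrier R" "l = a \<otimes> b'" "l = b \<otimes> a'" "l \<noteq> \<zero>"
    "\<And>x y. x \<in> carrier R \<Longrightarrow> y \<in> carrier R \<Longrightarrow> a \<otimes> x = b \<otimes> y \<Longrightarrow> \<exists>z\<in>carrier R. a \<otimes> x = l \<otimes> z"
proof -
  obtain l where l: "l \<in> carrier (mult_of R)" "l lcmof\<^bsub>mult_of R\<^esub> a b"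
    using factorial_monoid.lcmof_exists[OF factorial_monoid_axioms, of a b] a b by auto
  then have la: "a divides\<^bsub>mult_of R\<^esub> l" and lb: "b divides\<^bsub>mult_of R\<^esub> l"
    and least: "\<And>y. y \<in> carrier R \<Longrightarrow> y \<noteq> \<zero> \<Longrightarrow> a divides\<^bsub>mult_of R\<^esub> y \<Longrightarrow> b divides\<^bsub>mult_of R\<^esub> y \<Longrightarrow> l divides\<^bsub>mult_of R\<^esub> y"
    unfolding islcm_def by auto
  obtain b' where b': "b' \<in> carrier R" "l = a \<otimes> b'" using la by (auto simp: factor_def)
  obtain a' where a': "a' \<in> carrier R" "l = b \<otimes> a'" using lb by (auto simp: factor_def)
  show ?thesis
  proof (rule that[OF _ a'(1) b'(1) b'(2) a'(2)])
    show "l \<in> carrier R" "l \<noteq> \<zero>" using l by auto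
    fix x y assume xy: "x \<in> carrier R" "y \<in> carrier R" "a \<otimes> x = b \<otimes> y"
    show "\<exists>z\<in>carrier R. a \<otimes> x = l \<otimes> z"
    proof (cases "a \<otimes> x = \<zero>")
      case True
      then show ?thesis using l by (intro bexI[of _ \<zero>]) auto
    next
      case False
      then have "x \<noteq> \<zero>" "y \<noteq> \<zero>" using a b xy by auto
      then have "a divides\<^bsub>mult_of R\<^esub> (a \<otimes> x)"
        unfolding factor_def using xy(1) by (intro bexI[of _ x]) simp_all
      moreover have "b divides\<^bsub>mult_of R\<^esub> (a \<otimes> x)"
        unfolding factor_def using xy(2,3) \<open>y \<noteq> \<zero>\<close> by (intro bexI[of _ y]) simp_all
      ultimately have "l divides\<^bsub>mult_of R\<^esub> (a \<otimes> x)" using least[of "a \<otimes> x"] False a xy(1) by simp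
      then show ?thesis by (auto simp: factor_def)
    qed
  qed
qed

lemma principal_Int_principal:
  assumes a: "a \<in> carrier R" and b: "b \<in> carrier R"
  shows "\<exists>l\<in>carrier R. PIdl a \<inter> PIdl b = PIdl l"
proof (cases "a = \<zero> \<or> b = \<zero>")
  case True
  have "\<zero> \<in> PIdl x" if "x \<in> carrier R" for x
    unfolding cgenideal_mem using that by (intro bexI[of _ \<zero>]) auto
  then have "PIdl a \<inter> PIdl b = PIdl \<zero>" using True a b cgenideal_zero by auto
  then show ?thesis by blast
next
  case False
  then obtain l a' b' where l: "l \<in> carrier R" "a' \<in> carrier R" "b' \<in> carrier R" "l = a \<otimes> b'" "l = b \<otimes> a'"
    and least: "\<And>x y. x \<in> carrier R \<Longrightarrow> y \<in> carrier R \<Longrightarrow> a \<otimes> x = b \<otimes> y \<Longrightarrow> \<exists>z\<in>carrier R. a \<otimes> x = l \<otimes> z"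
    using lcm_exists[OF a _ b] by metis
  have "PIdl a \<inter> PIdl b \<subseteq> PIdl l"
  proof
    fix x assume "x \<in> PIdl a \<inter> PIdl b"
    then obtain r s where rs: "r \<in> carrier R" "x = r \<otimes> a" "s \<in> carrier R" "x = s \<otimes> b"
      unfolding cgenideal_mem Int_iff by blast
    then have "a \<otimes> r = b \<otimes> s" using a b by (simp add: m_comm)
    from least[OF rs(1,3) this] obtain z where "z \<in> carrier R" "a \<otimes> r = l \<otimes> z" by blast
    then show "x \<in> PIdl l" unfolding cgenideal_mem using rs a l(1) by (intro bexI[of _ z]) (auto simp: m_comm)
  qed
  moreover have "l \<in> PIdl a" unfolding cgenideal_mem using l(3,4) a by (intro bexI[of _ b']) (auto simp: m_comm)
  moreover have "l \<in> PIdl b" unfolding cgenideal_mem using l(2,5) b by (intro bexI[of _ a']) (auto simp: m_comm)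
  ultimately have "PIdl a \<inter> PIdl b = PIdl l" using cgenideal_subset a b by blast
  then show ?thesis using l by blast
qed

text \<open>
  If \<open>l\<close> is a least common multiple of \<open>a\<close> and \<open>b\<close>, then \<open>g = a b / l\<close> is their greatest common
  divisor. The last property is the coprimality of \<open>a'\<close> and \<open>b'\<close> in the form in which it is used: a
  relation \<open>x a' = y b'\<close> is a multiple of the obvious one.
\<close>
lemma coprime_decomposition:
  assumes a: "a \<in> carrier R" "a \<noteq> \<zero>" and b: "b \<in> carrier R" "b \<noteq> \<zero>"
  obtains g a' b' where "g \<in> carrier R" "a' \<in> carrier R" "b' \<in> carrier R" "a = g \<otimes> a'" "b = g \<otimes> b'"
    "b' \<noteq> \<zero>"
    "\<And>x y. x \<in> carrier R \<Longrightarrow> y \<in> carrier R \<Longrightarrow> x \<otimes> a' = y \<otimes> b' \<Longrightarrow> x \<in> PIdl b'"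
proof -
  obtain l a' b' where l: "l \<in> carrier R" "a' \<in> carrier R" "b' \<in> carrier R" "l = a \<otimes> b'" "l = b \<otimes> a'" "l \<noteq> \<zero>"
    and least: "\<And>x y. x \<in> carrier R \<Longrightarrow> y \<in> carrier R \<Longrightarrow> a \<otimes> x = b \<otimes> y \<Longrightarrow> \<exists>z\<in>carrier R. a \<otimes> x = l \<otimes> z"
    using lcm_exists[OF a b] by blast
  have "a \<otimes> b = b \<otimes> a" using a b by (simp add: m_comm)
  from least[OF b(1) a(1) this] obtain g where g: "g \<in> carrier R" "a \<otimes> b = l \<otimes> g" by blast
  have "a \<otimes> b = a \<otimes> (g \<otimes> b')" using g l a by (simp add: m_ac)
  then have bg: "b = g \<otimes> b'" using m_lcancel[of a b "g \<otimes> b'"] a b g l by simp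
  have "b \<otimes> a = l \<otimes> g" using g(2) m_comm[OF a(1) b(1)] by simp
  also have "\<dots> = b \<otimes> (g \<otimes> a')" unfolding l(5) using g(1) l(2) b by (simp add: m_ac)
  finally have "b \<otimes> a = b \<otimes> (g \<otimes> a')" .
  then have ag: "a = g \<otimes> a'" using m_lcancel[of b a "g \<otimes> a'"] a b g l by simp
  show ?thesis
  proof (rule that[OF g(1) l(2,3) ag bg])
    show "b' \<noteq> \<zero>" using bg b g by auto
    fix x y assume xy: "x \<in> carrier R" "y \<in> carrier R" "x \<otimes> a' = y \<otimes> b'"
    have "a \<otimes> x = g \<otimes> (x \<otimes> a')" unfolding ag using g(1) xy(1,2) l(1-3) by (simp add: m_ac)
    also have "\<dots> = b \<otimes> y" unfolding xy(3) bg using g(1) xy(1,2) l(1-3) by (simp add: m_ac)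
    finally obtain z where z: "z \<in> carrier R" "a \<otimes> x = l \<otimes> z" using least[OF xy(1,2)] by blast
    then have "a \<otimes> x = a \<otimes> (z \<otimes> b')" unfolding l(4) using a l by (simp add: m_ac)
    then have "x = z \<otimes> b'" using m_lcancel[of a x "z \<otimes> b'"] a xy z l by simp
    then show "x \<in> PIdl b'" unfolding cgenideal_mem using z by blast
  qed
qed

lemma quasi_coherent: "quasi_coherent R"
  unfolding quasi_coherent_def
proof (intro conjI allI impI ballI)
  fix n :: nat and a assume n: "1 \<le> n" and a: "\<forall>i\<in>{1..n}. a i \<in> carrier R"
  have "\<exists>l\<in>carrier R. (\<Inter>i\<in>{1..n}. PIdl (a i)) = PIdl l"
    using n a
  proof (induction n rule: nat_induct_at_least)
    case base
    then show ?case by auto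
  next
    case (Suc n)
    then obtain l where l: "l \<in> carrier R" "(\<Inter>i\<in>{1..n}. PIdl (a i)) = PIdl l" by auto
    have "(\<Inter>i\<in>{1..Suc n}. PIdl (a i)) = PIdl (a (Suc n)) \<inter> PIdl l"
      unfolding l(2)[symmetric] by (simp add: atLeastAtMostSuc_conv)
    then show ?case using principal_Int_principal[of "a (Suc n)" l] l Suc.prems by simp
  qed
  then show "fg_ideal R (\<Inter>i\<in>{1..n}. PIdl (a i))" using fg_ideal_principal by auto
next
  fix c assume c: "c \<in> carrier R"
  have "ann R c = (if c = \<zero> then PIdl \<one> else PIdl \<zero>)"
    using c unfolding ann_def cgenideal_zero by (auto simp: cgenideal_mem integral_iff)
  then show "fg_ideal R (ann R c)" using fg_ideal_principal by simp
qed

text \<open>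
  Let \<open>a = g a'\<close>, \<open>b = g b'\<close> and \<open>N = (a', b')\<close>. In \<open>I \<otimes> R\<close> the tensors \<open>b \<otimes> a'\<close> and \<open>a \<otimes> b'\<close> agree,
  so by flatness they agree in \<open>I \<otimes> N\<close>. As \<open>a'\<close> and \<open>b'\<close> are coprime, \<open>x\<close> is determined by
  \<open>x a' + y b'\<close> up to multiples of \<open>b'\<close>, and \<open>i \<otimes> (x a' + y b') \<mapsto> x i\<close> is well defined modulo \<open>b' I\<close>.
  It maps the two tensors to \<open>b\<close> and 0. Hence \<open>g b' = b\<close> lies in \<open>b' I\<close>, and \<open>g\<close> lies in \<open>I\<close>.
\<close>
lemma flat_coprime_gcd_mem:
  assumes I: "ideal I R" and flat: "flat R (ideal_module R I)"
    and car: "g \<in> carrier R" "a' \<in> carrier R" "b' \<in> carrier R"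
    and ab: "g \<otimes> a' \<in> I" "g \<otimes> b' \<in> I" and b0: "b' \<noteq> \<zero>"
    and cop: "\<And>x y. x \<in> carrier R \<Longrightarrow> y \<in> carrier R \<Longrightarrow> x \<otimes> a' = y \<otimes> b' \<Longrightarrow> x \<in> PIdl b'"
  shows "g \<in> I"
proof -
  interpret I: ideal I R by fact
  let ?N = "{x \<otimes> a' \<oplus> y \<otimes> b' | x y. x \<in> carrier R \<and> y \<in> carrier R}"
  let ?a = "g \<otimes> a'" and ?b = "g \<otimes> b'"
  have Nc: "?N \<subseteq> carrier R" using car by auto
  have N: "ideal ?N R"
  proof (rule idealI[OF ring_axioms])
    show "subgroup ?N (add_monoid R)"
    proof (rule add.subgroupI)
      have "\<zero> \<otimes> a' \<oplus> \<zero> \<otimes> b' \<in> ?N" by blast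
      then show "?N \<noteq> {}" by blast
      fix p q assume "p \<in> ?N" "q \<in> ?N"
      then obtain x y x' y' where *: "x \<in> carrier R" "y \<in> carrier R" "x' \<in> carrier R" "y' \<in> carrier R"
        "p = x \<otimes> a' \<oplus> y \<otimes> b'" "q = x' \<otimes> a' \<oplus> y' \<otimes> b'" by blast
      have "p \<oplus> q = (x \<oplus> x') \<otimes> a' \<oplus> (y \<oplus> y') \<otimes> b'" using * car by (simp add: l_distr a_ac)
      then show "p \<oplus> q \<in> ?N" using * by blast
    next
      fix p assume "p \<in> ?N"
      then obtain x y where *: "x \<in> carrier R" "y \<in> carrier R" "p = x \<otimes> a' \<oplus> y \<otimes> b'" by blast
      have "\<ominus> p = (\<ominus> x) \<otimes> a' \<oplus> (\<ominus> y) \<otimes> b'" using * car by (simp add: minus_add l_minus)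
      then show "\<ominus> p \<in> ?N" using * a_inv_closed by blast
    qed (use Nc in auto)
    fix p r assume "p \<in> ?N" and r: "r \<in> carrier R"
    then obtain x y where *: "x \<in> carrier R" "y \<in> carrier R" "p = x \<otimes> a' \<oplus> y \<otimes> b'" by blast
    have "r \<otimes> p = (r \<otimes> x) \<otimes> a' \<oplus> (r \<otimes> y) \<otimes> b'" using * car r by (simp add: r_distr m_assoc)
    then show "r \<otimes> p \<in> ?N" using * r m_closed by blast
    then show "p \<otimes> r \<in> ?N" using r Nc \<open>p \<in> ?N\<close> by (metis (no_types, lifting) m_comm subsetD)
  qed
  define N where "N = ?N"
  have Nid: "ideal N R" and Nc: "N \<subseteq> carrier R" using N Nc by (simp_all only: N_def)
  let ?MI = "ideal_module R I" and ?MN = "ideal_module R N" and ?MR = "ideal_module R (carrier R)"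
  have mI: "module R ?MI" and mN: "module R ?MN" and mR: "module R ?MR"
    using ideal_module_module I Nid oneideal by blast+
  interpret S: two_modules R ?MI ?MN using mI mN by (rule two_modules.intro)
  interpret T: two_modules R ?MI ?MR using mI mR by (rule two_modules.intro)
  have id: "(\<lambda>x. x) \<in> linear_maps R ?MN ?MR" using Nc by (auto simp: linear_maps_def)
  have "inj_on (tensor_map R ?MI ?MR (\<lambda>x. x)) (carrier (tensor_product R ?MI ?MN))"
  proof -
    have "inj_on (\<lambda>x. x) (carrier ?MN)" by (rule inj_on_id2)
    then show ?thesis using mN mR id flat unfolding flat_def by blast
  qed
  then have inj: "\<And>z. z \<in> carrier S.F \<Longrightarrow> tensor_lift (\<lambda>x. x) z \<in> T.K \<Longrightarrow> z \<in> S.K"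
    unfolding tensor_map_inj_iff[OF mI mN mR id] by blast
  have "\<one> \<otimes> a' \<oplus> \<zero> \<otimes> b' \<in> N" "\<zero> \<otimes> a' \<oplus> \<one> \<otimes> b' \<in> N" unfolding N_def by blast+
  then have a'N: "a' \<in> N" and b'N: "b' \<in> N" using car by simp_all
  have z1: "frag_of (?b, a') - frag_of (?a, b') \<in> S.K"
  proof (rule inj)
    show "frag_of (?b, a') - frag_of (?a, b') \<in> carrier S.F"
      unfolding carrier_free_Abelian_group_iff
      by (intro keys_diff2; unfold keys_frag_of ideal_module_simps) (use a'N b'N ab in blast)+
    have "frag_of (a' \<otimes> ?b, \<one>) - frag_of (?b, a') \<in> T.K" "frag_of (b' \<otimes> ?a, \<one>) - frag_of (?a, b') \<in> T.K"
      using T.K_smult[of a' ?b \<one>] T.K_smult[of b' ?a \<one>] ab car by simp_all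
    moreover have "a' \<otimes> ?b = b' \<otimes> ?a" using car by (simp add: m_ac)
    ultimately have "(frag_of (b' \<otimes> ?a, \<one>) - frag_of (?a, b')) - (frag_of (b' \<otimes> ?a, \<one>) - frag_of (?b, a')) \<in> T.K"
      using T.K_diff by metis
    then show "tensor_lift (\<lambda>x. x) (frag_of (?b, a') - frag_of (?a, b')) \<in> T.K" by simp
  qed
  let ?L = "{i \<otimes> b' | i. i \<in> I}"
  have L: "additive_subgroup ?L R"
  proof (rule additive_subgroup.intro, rule add.subgroupI)
    show "?L \<subseteq> carrier R" using I.Icarr car by auto
    show "?L \<noteq> {}" using ab by blast
    fix p q assume "p \<in> ?L" "q \<in> ?L"
    then obtain i j where ij: "i \<in> I" "j \<in> I" "p = i \<otimes> b'" "q = j \<otimes> b'" by blast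
    have "p \<oplus> q = (i \<oplus> j) \<otimes> b'" using ij I.Icarr car by (simp add: l_distr)
    then show "p \<oplus> q \<in> ?L" using ij I.a_closed by blast
  next
    fix p assume "p \<in> ?L"
    then obtain i where i: "i \<in> I" "p = i \<otimes> b'" by blast
    have "\<ominus> p = (\<ominus> i) \<otimes> b'" using i I.Icarr car by (simp add: l_minus)
    then show "\<ominus> p \<in> ?L" using i I.a_inv_closed by blast
  qed
  interpret L: additive_subgroup ?L R by (rule L)
  have LI: "x \<otimes> i \<in> ?L" if x: "x \<in> PIdl b'" and i: "i \<in> I" for x i
  proof -
    obtain r where r: "r \<in> carrier R" "x = r \<otimes> b'" using x unfolding cgenideal_mem by blast
    then have "x \<otimes> i = (r \<otimes> i) \<otimes> b'" using I.Icarr[OF i] car by (simp add: m_ac)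
    then show ?thesis using I.I_l_closed[OF i r(1)] by blast
  qed
  have "\<forall>n\<in>N. \<exists>x. x \<in> carrier R \<and> (\<exists>y\<in>carrier R. n = x \<otimes> a' \<oplus> y \<otimes> b')" unfolding N_def by blast
  from bchoice[OF this] obtain \<rho> where \<rho>': "\<forall>n\<in>N. \<rho> n \<in> carrier R \<and> (\<exists>y\<in>carrier R. n = \<rho> n \<otimes> a' \<oplus> y \<otimes> b')" by blast
  from bchoice[of N "\<lambda>n y. y \<in> carrier R \<and> n = \<rho> n \<otimes> a' \<oplus> y \<otimes> b'"] \<rho>' obtain \<sigma>
    where \<sigma>: "\<And>n. n \<in> N \<Longrightarrow> \<sigma> n \<in> carrier R" "\<And>n. n \<in> N \<Longrightarrow> n = \<rho> n \<otimes> a' \<oplus> \<sigma> n \<otimes> b'" by blast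
  have \<rho>: "\<rho> n \<in> carrier R" if "n \<in> N" for n using \<rho>' that by blast
  have key: "x \<ominus> \<rho> n \<in> PIdl b'" if "n \<in> N" "x \<in> carrier R" "y \<in> carrier R" "n = x \<otimes> a' \<oplus> y \<otimes> b'" for n x y
  proof (rule cop)
    note c = \<rho>[OF that(1)] \<sigma>(1)[OF that(1)] that(2,3) car
    show "x \<ominus> \<rho> n \<in> carrier R" "\<sigma> n \<ominus> y \<in> carrier R" using c by simp_all
    have "x \<otimes> a' \<oplus> y \<otimes> b' = \<rho> n \<otimes> a' \<oplus> \<sigma> n \<otimes> b'" using \<sigma>(2)[OF that(1)] that(4) by simp
    then have "x \<otimes> a' \<ominus> \<rho> n \<otimes> a' = \<sigma> n \<otimes> b' \<ominus> y \<otimes> b'"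
      using c by (intro minus_eq_minusI) simp_all
    then show "(x \<ominus> \<rho> n) \<otimes> a' = (\<sigma> n \<ominus> y) \<otimes> b'"
      using c by (simp add: minus_eq l_distr l_minus)
  qed
  obtain h where h: "\<And>i n. i \<in> I \<Longrightarrow> n \<in> N \<Longrightarrow> h (frag_of (i, n)) = \<rho> n \<otimes> i"
    "\<And>x y. x \<in> carrier S.F \<Longrightarrow> y \<in> carrier S.F \<Longrightarrow> h (x - y) = h x \<ominus> h y"
    "\<And>z. z \<in> S.K \<Longrightarrow> h z \<in> ?L"
  proof (rule S.hom_from_relations[OF abelian_group_axioms L, of "\<lambda>i n. \<rho> n \<otimes> i"])
    interpret N: ideal N R by (rule Nid)
    show "\<rho> n \<otimes> m \<in> carrier R" if "m \<in> carrier ?MI" "n \<in> carrier ?MN" for m n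
      using \<rho>[of n] I.Icarr[of m] that unfolding ideal_module_simps by (intro m_closed)
    show "\<rho> n \<otimes> (m \<oplus>\<^bsub>?MI\<^esub> m') \<ominus> \<rho> n \<otimes> m \<ominus> \<rho> n \<otimes> m' \<in> ?L"
      if "m \<in> carrier ?MI" "m' \<in> carrier ?MI" "n \<in> carrier ?MN" for m m' n
    proof -
      have "m \<in> carrier R" "m' \<in> carrier R" "\<rho> n \<in> carrier R"
        using that \<rho>[of n] I.Icarr unfolding ideal_module_simps by blast+
      then have "\<rho> n \<otimes> (m \<oplus> m') \<ominus> \<rho> n \<otimes> m \<ominus> \<rho> n \<otimes> m' = \<zero>"
        by (simp add: r_distr sum_minus_minus)
      then show ?thesis using L.zero_closed by (simp only: ideal_module_simps)
    qed
    show "\<rho> (n \<oplus>\<^bsub>?MN\<^esub> n') \<otimes> m \<ominus> \<rho> n \<otimes> m \<ominus> \<rho> n' \<otimes> m \<in> ?L"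
      if "m \<in> carrier ?MI" "n \<in> carrier ?MN" "n' \<in> carrier ?MN" for m n n'
    proof -
      have m: "m \<in> I" and n: "n \<in> N" "n' \<in> N" using that by (simp_all only: ideal_module_simps)
      note c = \<rho>[OF n(1)] \<rho>[OF n(2)] \<sigma>(1)[OF n(1)] \<sigma>(1)[OF n(2)] I.Icarr[OF m] car
      have nn: "n \<oplus> n' \<in> N" by (rule N.a_closed[OF n])
      have "n \<oplus> n' = (\<rho> n \<otimes> a' \<oplus> \<sigma> n \<otimes> b') \<oplus> (\<rho> n' \<otimes> a' \<oplus> \<sigma> n' \<otimes> b')"
        using \<sigma>(2)[OF n(1)] \<sigma>(2)[OF n(2)] by (rule arg_cong2)
      also have "\<dots> = (\<rho> n \<oplus> \<rho> n') \<otimes> a' \<oplus> (\<sigma> n \<oplus> \<sigma> n') \<otimes> b'"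
        using c by (simp add: l_distr a_ac)
      finally have "\<rho> n \<oplus> \<rho> n' \<ominus> \<rho> (n \<oplus> n') \<in> PIdl b'"
        using key[OF nn, of "\<rho> n \<oplus> \<rho> n'" "\<sigma> n \<oplus> \<sigma> n'"] c by simp
      then have "\<ominus> ((\<rho> n \<oplus> \<rho> n' \<ominus> \<rho> (n \<oplus> n')) \<otimes> m) \<in> ?L"
        using LI[OF _ m] L.a_inv_closed by blast
      also have "\<ominus> ((\<rho> n \<oplus> \<rho> n' \<ominus> \<rho> (n \<oplus> n')) \<otimes> m) = \<rho> (n \<oplus> n') \<otimes> m \<ominus> \<rho> n \<otimes> m \<ominus> \<rho> n' \<otimes> m"
        using c \<rho>[OF nn] by (simp add: minus_eq l_distr l_minus minus_add a_ac)
      finally show ?thesis by (simp only: ideal_module_simps)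
    qed
    show "\<rho> n \<otimes> (r \<odot>\<^bsub>?MI\<^esub> m) \<ominus> \<rho> (r \<odot>\<^bsub>?MN\<^esub> n) \<otimes> m \<in> ?L"
      if "r \<in> carrier R" "m \<in> carrier ?MI" "n \<in> carrier ?MN" for r m n
    proof -
      have m: "m \<in> I" and n: "n \<in> N" using that by (simp_all only: ideal_module_simps)
      note c = \<rho>[OF n] \<sigma>(1)[OF n] I.Icarr[OF m] car that(1)
      have rn: "r \<otimes> n \<in> N" by (rule N.I_l_closed[OF n that(1)])
      have "r \<otimes> n = r \<otimes> (\<rho> n \<otimes> a' \<oplus> \<sigma> n \<otimes> b')" using \<sigma>(2)[OF n] by (rule arg_cong)
      also have "\<dots> = (r \<otimes> \<rho> n) \<otimes> a' \<oplus> (r \<otimes> \<sigma> n) \<otimes> b'" using c by (simp add: r_distr m_assoc)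
      finally have "r \<otimes> \<rho> n \<ominus> \<rho> (r \<otimes> n) \<in> PIdl b'"
        using key[OF rn, of "r \<otimes> \<rho> n" "r \<otimes> \<sigma> n"] c by simp
      then have "(r \<otimes> \<rho> n \<ominus> \<rho> (r \<otimes> n)) \<otimes> m \<in> ?L" by (rule LI[OF _ m])
      also have "(r \<otimes> \<rho> n \<ominus> \<rho> (r \<otimes> n)) \<otimes> m = \<rho> n \<otimes> (r \<otimes> m) \<ominus> \<rho> (r \<otimes> n) \<otimes> m"
        using c \<rho>[OF rn] by (simp add: minus_eq l_distr r_distr l_minus r_minus m_ac)
      finally show ?thesis by (simp only: ideal_module_simps)
    qed
  next
    fix h assume h: "\<And>m n. m \<in> carrier ?MI \<Longrightarrow> n \<in> carrier ?MN \<Longrightarrow> h (frag_of (m, n)) = \<rho> n \<otimes> m"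
      "\<And>x y. x \<in> carrier S.F \<Longrightarrow> y \<in> carrier S.F \<Longrightarrow> h (x - y) = h x \<ominus> h y"
      "\<And>z. z \<in> S.K \<Longrightarrow> h z \<in> ?L"
    show thesis by (rule that[OF h(1)[unfolded ideal_module_simps] h(2,3)])
  qed
  have "h (frag_of (?b, a') - frag_of (?a, b')) = \<rho> a' \<otimes> ?b \<ominus> \<rho> b' \<otimes> ?a"
  proof -
    have "frag_of (?b, a') \<in> carrier S.F" "frag_of (?a, b') \<in> carrier S.F"
      unfolding frag_of_in_free_Abelian_group ideal_module_simps using a'N b'N ab by blast+
    then show ?thesis unfolding h(2)[OF \<open>frag_of (?b, a') \<in> carrier S.F\<close> \<open>frag_of (?a, b') \<in> carrier S.F\<close>]
      using h(1)[OF ab(2) a'N] h(1)[OF ab(1) b'N] by simp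
  qed
  then have 1: "\<rho> a' \<otimes> ?b \<ominus> \<rho> b' \<otimes> ?a \<in> ?L" using h(3)[OF z1] by simp
  have 2: "(\<one> \<ominus> \<rho> a') \<otimes> ?b \<in> ?L" by (rule LI[OF key[OF a'N, of \<one> \<zero>] ab(2)]) (use car in simp_all)
  have 3: "(\<zero> \<ominus> \<rho> b') \<otimes> ?a \<in> ?L" by (rule LI[OF key[OF b'N, of \<zero> \<one>] ab(1)]) (use car in simp_all)
  have "(\<one> \<ominus> \<rho> a') \<otimes> ?b \<ominus> (\<zero> \<ominus> \<rho> b') \<otimes> ?a \<oplus> (\<rho> a' \<otimes> ?b \<ominus> \<rho> b' \<otimes> ?a) \<in> ?L"
    by (rule L.a_closed[OF _ 1], subst (1) minus_eq, rule L.a_closed[OF 2 L.a_inv_closed[OF 3]])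
  also have "(\<one> \<ominus> \<rho> a') \<otimes> ?b \<ominus> (\<zero> \<ominus> \<rho> b') \<otimes> ?a \<oplus> (\<rho> a' \<otimes> ?b \<ominus> \<rho> b' \<otimes> ?a) = ?b"
  proof -
    have "(\<one> \<ominus> r) \<otimes> b \<ominus> (\<zero> \<ominus> s) \<otimes> a \<oplus> (r \<otimes> b \<ominus> s \<otimes> a) = b"
      if "r \<in> carrier R" "s \<in> carrier R" "a \<in> carrier R" "b \<in> carrier R" for r s a b
      using that by (simp add: minus_eq l_distr l_minus a_ac r_neg r_neg1 r_neg2)
    then show ?thesis using \<rho>[OF a'N] \<rho>[OF b'N] car by simp
  qed
  finally obtain i where i: "i \<in> I" "g \<otimes> b' = i \<otimes> b'" by auto
  then have "g = i" using m_rcancel[of b' g i] b0 car I.Icarr by auto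
  then show ?thesis using i by simp
qed

text \<open>
  With any two elements the ideal contains a common divisor of them, so by induction it contains a
  common divisor of its generators.
\<close>
lemma fg_flat_principal:
  assumes fg: "fg_ideal R I" and flat: "flat R (ideal_module R I)"
  shows "\<exists>d\<in>carrier R. I = PIdl d"
proof -
  obtain S where S: "finite S" "S \<subseteq> carrier R" "I = genideal R S" and I: "ideal I R"
    using fg unfolding fg_ideal_def by blast
  interpret I: ideal I R by fact
  have two: "\<exists>g\<in>I. a \<in> PIdl g \<and> b \<in> PIdl g" if ab: "a \<in> I" "b \<in> I" for a b
  proof (cases "a = \<zero> \<or> b = \<zero>")
    case True
    have "\<zero> \<in> PIdl x" "x \<in> PIdl x" if "x \<in> I" for x
      unfolding cgenideal_mem using I.Icarr[OF that] by (auto intro: bexI[of _ \<zero>] bexI[of _ \<one>])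
    then show ?thesis using True ab by metis
  next
    case False
    then obtain g a' b' where g: "g \<in> carrier R" "a' \<in> carrier R" "b' \<in> carrier R" "a = g \<otimes> a'" "b = g \<otimes> b'"
      "b' \<noteq> \<zero>" "\<And>x y. x \<in> carrier R \<Longrightarrow> y \<in> carrier R \<Longrightarrow> x \<otimes> a' = y \<otimes> b' \<Longrightarrow> x \<in> PIdl b'"
      using coprime_decomposition[of a b] I.Icarr ab by metis
    have "g \<in> I"
      by (rule flat_coprime_gcd_mem[OF I flat g(1-3) _ _ g(6,7)]) (use ab g(4,5) in simp_all)
    moreover have "a \<in> PIdl g" "b \<in> PIdl g"
      unfolding cgenideal_mem using g by (auto simp: m_comm)
    ultimately show ?thesis by blast
  qed
  have "\<exists>d\<in>I. T \<subseteq> PIdl d" if "finite T" "T \<subseteq> I" for T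
    using that
  proof (induction T rule: finite_induct)
    case empty
    then show ?case using I.zero_closed by blast
  next
    case (insert x T)
    then obtain d where d: "d \<in> I" "T \<subseteq> PIdl d" by auto
    obtain g where g: "g \<in> I" "x \<in> PIdl g" "d \<in> PIdl g" using two[of x d] insert.prems d by auto
    then show ?case using d cgenideal_subset[OF g(3)] I.Icarr by (intro bexI[of _ g]) auto
  qed
  moreover have "S \<subseteq> I" unfolding S(3) by (rule genideal_self[OF S(2)])
  ultimately obtain d where d: "d \<in> I" "S \<subseteq> PIdl d" using S(1) by blast
  have "I \<subseteq> PIdl d" unfolding S(3) by (rule genideal_minimal[OF cgenideal_ideal d(2)]) (rule I.Icarr[OF d(1)])
  moreover have "PIdl d \<subseteq> I" by (rule cgenideal_minimal[OF I d(1)])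
  ultimately show ?thesis using I.Icarr[OF d(1)] by blast
qed

theorem G_GCD_ring: "G_GCD_ring R"
  unfolding G_GCD_ring_def
proof (intro conjI ballI allI impI)
  show "projective R (ideal_module R (PIdl a))" if "a \<in> carrier R" for a
    using that by (rule principal_projective)
  fix I J assume IJ: "fg_ideal R I \<and> flat R (ideal_module R I) \<and> fg_ideal R J \<and> flat R (ideal_module R J)"
  then obtain a b where "a \<in> carrier R" "I = PIdl a" "b \<in> carrier R" "J = PIdl b"
    using fg_flat_principal by meson
  then obtain l where "l \<in> carrier R" "I \<inter> J = PIdl l" using principal_Int_principal by blast
  then show "fg_ideal R (I \<inter> J)" "flat R (ideal_module R (I \<inter> J))"
    using fg_ideal_principal principal_flat by auto
qed

end

section \<open>Group rings over the cyclic group of order two\<close>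

abbreviation C2 :: "int monoid" where "C2 \<equiv> integer_mod_group 2"

locale char2_domain = domain R for R (structure) +
  assumes char2: "\<one> \<oplus> \<one> = \<zero>"
begin

lemma add_self: "x \<in> carrier R \<Longrightarrow> x \<oplus> x = \<zero>"
  using l_distr[of \<one> \<one> x] char2 by simp

lemma add_self_left: "x \<in> carrier R \<Longrightarrow> y \<in> carrier R \<Longrightarrow> x \<oplus> (x \<oplus> y) = y"
  using add_self by (simp flip: a_assoc)

abbreviation A :: "(int \<Rightarrow> 'a) ring" where "A \<equiv> group_ring R C2"

text \<open>
  The element \<open>p + q \<gamma>\<close> of the group ring, where \<open>\<gamma>\<close> generates the group. In characteristic 2 the
  element \<open>y = 1 + \<gamma>\<close> has square zero and augmentation zero.
\<close>
definition pair :: "'a \<Rightarrow> 'a \<Rightarrow> int \<Rightarrow> 'a" where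
  "pair p q = (\<lambda>x\<in>{0, 1}. if x = 0 then p else q)"

definition aug :: "(int \<Rightarrow> 'a) \<Rightarrow> 'a" where "aug f = f 0 \<oplus> f 1"

lemma carrier_C2: "carrier C2 = {0, 1}"
  by (auto simp: carrier_integer_mod_group)

sublocale GR: group_ring_data R C2
  by (rule group_ring_data.intro[OF is_cring abelian_integer_mod_group])

sublocale A: cring A by (rule GR.group_ring_cring)

lemma pair_simps [simp]: "pair p q 0 = p" "pair p q 1 = q" "pair p q (Suc 0) = q"
  by (simp_all add: pair_def)

lemma pair_carrier [simp]: "p \<in> carrier R \<Longrightarrow> q \<in> carrier R \<Longrightarrow> pair p q \<in> carrier A"
  unfolding GR.group_ring_carrier carrier_C2 by (auto simp: pair_def)

lemma val: "f \<in> carrier A \<Longrightarrow> f 0 \<in> carrier R" "f \<in> carrier A \<Longrightarrow> f 1 \<in> carrier R"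
  using GR.group_ring_val carrier_C2 by auto

lemma pair_eta: "f \<in> carrier A \<Longrightarrow> f = pair (f 0) (f 1)"
  using GR.group_ring_PiE[of f] unfolding carrier_C2 pair_def
  by (intro ext) (auto simp: PiE_def extensional_def restrict_def)

lemma mult_vals:
  assumes f: "f \<in> carrier A" and h: "h \<in> carrier A"
  shows "(f \<otimes>\<^bsub>A\<^esub> h) 0 = f 0 \<otimes> h 0 \<oplus> f 1 \<otimes> h 1" "(f \<otimes>\<^bsub>A\<^esub> h) 1 = f 0 \<otimes> h 1 \<oplus> f 1 \<otimes> h 0"
  using GR.group_ring_mult_eq[OF f h, of "{0, 1}" 0] GR.group_ring_mult_eq[OF f h, of "{0, 1}" 1] val[OF f] val[OF h]
  by (auto simp: carrier_C2)

lemma add_vals: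
  "(f \<oplus>\<^bsub>A\<^esub> h) 0 = f 0 \<oplus> h 0" "(f \<oplus>\<^bsub>A\<^esub> h) 1 = f 1 \<oplus> h 1"
  by (simp_all add: group_ring_def carrier_C2)

lemma one_vals: "\<one>\<^bsub>A\<^esub> 0 = \<one>" "\<one>\<^bsub>A\<^esub> 1 = \<zero>"
  by (simp_all add: group_ring_def carrier_C2)

lemma aug_hom: "aug \<in> ring_hom A R"
proof (rule ring_hom_memI)
  fix f h assume fh: "f \<in> carrier A" "h \<in> carrier A"
  note v = val[OF fh(1)] val[OF fh(2)]
  show "aug f \<in> carrier R" using v by (simp add: aug_def)
  show "aug (f \<oplus>\<^bsub>A\<^esub> h) = aug f \<oplus> aug h" using v by (simp add: aug_def add_vals a_ac)
  show "aug (f \<otimes>\<^bsub>A\<^esub> h) = aug f \<otimes> aug h"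
    using v mult_vals[OF fh] by (simp add: aug_def a_ac l_distr r_distr)
qed (simp add: aug_def one_vals)

sublocale aug: ring_hom_cring A R aug
  by (rule ring_hom_cringI[OF A.cring_axioms cring_axioms aug_hom])

text \<open>
  Write \<open>y = 1 + \<gamma>\<close> and consider the ideals of \<open>a\<^sup>2\<close> and \<open>a c + u y\<close>. The augmentation of a common
  multiple is \<open>a\<^sup>2 c t\<close> by coprimality of \<open>a\<close> and \<open>c\<close>, and comparing the coefficients of \<open>y\<close> shows that
  \<open>t u\<close> lies in \<open>(a, c)\<close>; conversely each such \<open>t\<close> occurs. So the augmentations of finitely many
  generators of the intersection would yield generators of the colon ideal \<open>((a, c) : u)\<close>.
\<close>
theorem group_ring_C2_not_quasi_coherent:
  assumes a: "a \<in> carrier R" "a \<noteq> \<zero>" and c: "c \<in> carrier R" "c \<noteq> \<zero>" and u: "u \<in> carrier R"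
    and cop: "\<And>p r. p \<in> carrier R \<Longrightarrow> r \<in> carrier R \<Longrightarrow> a \<otimes> p = c \<otimes> r \<Longrightarrow> \<exists>t\<in>carrier R. p = c \<otimes> t"
    and nfg: "\<not> fg_ideal R {t \<in> carrier R. \<exists>g\<in>carrier R. \<exists>h\<in>carrier R. t \<otimes> u = a \<otimes> g \<oplus> c \<otimes> h}"
      (is "\<not> fg_ideal R ?J")
  shows "\<not> quasi_coherent A"
proof
  assume qc: "quasi_coherent A"
  \<comment> \<open>\<open>\<alpha> = a\<^sup>2\<close> and \<open>\<beta> = a c + u y\<close>, since \<open>pair (p \<oplus> q) q\<close> is \<open>p + q y\<close>\<close>
  define \<alpha> where "\<alpha> = pair (a \<otimes> a) \<zero>"
  define \<beta> where "\<beta> = pair (a \<otimes> c \<oplus> u) u"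
  define k where "k = a \<otimes> a \<otimes> c"
  have k: "k \<in> carrier R" "k \<noteq> \<zero>" using a c by (simp_all add: k_def integral_iff)
  have \<alpha>: "\<alpha> \<in> carrier A" and \<beta>: "\<beta> \<in> carrier A" using a c u by (simp_all add: \<alpha>_def \<beta>_def)
  let ?I = "cgenideal A \<alpha> \<inter> cgenideal A \<beta>"
  let ?s = "\<lambda>i::nat. if i = 1 then \<alpha> else \<beta>"
  have "fg_ideal A (\<Inter>i\<in>{1..2}. cgenideal A (?s i))"
    using qc \<alpha> \<beta> unfolding quasi_coherent_def by (elim conjE allE[of _ 2] impE) auto
  moreover have "{1..2::nat} = {1, 2}" by auto
  ultimately have "fg_ideal A ?I" by simp
  then obtain S where S: "finite S" "S \<subseteq> carrier A" "?I = genideal A S" by (auto simp: fg_ideal_def)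

  have fwd: "\<exists>t\<in>?J. aug x = k \<otimes> t" if x: "x \<in> ?I" for x
  proof -
    obtain y z where y: "y \<in> carrier A" "x = y \<otimes>\<^bsub>A\<^esub> \<alpha>" and z: "z \<in> carrier A" "x = z \<otimes>\<^bsub>A\<^esub> \<beta>"
      using x unfolding cgenideal_def by blast
    define p q r s where "p = y 0" "q = y 1" "r = z 0" "s = z 1"
    note pqrs = this
    have car: "p \<in> carrier R" "q \<in> carrier R" "r \<in> carrier R" "s \<in> carrier R"
      using val y z by (simp_all add: pqrs)
    have "aug x = aug y \<otimes> aug \<alpha>" unfolding y(2) using y(1) \<alpha> by simp
    also have "aug \<alpha> = a \<otimes> a" using a by (simp add: aug_def \<alpha>_def)
    also have "aug y \<otimes> (a \<otimes> a) = a \<otimes> (a \<otimes> (p \<oplus> q))" using car a by (simp add: aug_def pqrs[symmetric] m_ac)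
    finally have 1: "aug x = a \<otimes> (a \<otimes> (p \<oplus> q))" .
    have "aug x = aug z \<otimes> aug \<beta>" unfolding z(2) using z(1) \<beta> by simp
    also have "aug \<beta> = a \<otimes> c" using a c u by (simp add: aug_def \<beta>_def a_assoc add_self)
    also have "aug z \<otimes> (a \<otimes> c) = a \<otimes> (c \<otimes> (r \<oplus> s))" using car a c by (simp add: aug_def pqrs[symmetric] m_ac)
    finally have 2: "a \<otimes> (p \<oplus> q) = c \<otimes> (r \<oplus> s)" using 1 a c car by (simp add: m_lcancel)
    then obtain t where t: "t \<in> carrier R" "p \<oplus> q = c \<otimes> t" using cop[of "p \<oplus> q" "r \<oplus> s"] car by auto
    then have "c \<otimes> (r \<oplus> s) = c \<otimes> (a \<otimes> t)" using 2 a c car by (simp add: m_ac)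
    then have rs: "r \<oplus> s = a \<otimes> t" using m_lcancel[of c "r \<oplus> s" "a \<otimes> t"] a c t car by simp
    have "x 1 = q \<otimes> (a \<otimes> a)" unfolding y(2) mult_vals[OF y(1) \<alpha>] using car a
      by (simp add: \<alpha>_def pqrs[symmetric])
    moreover have "x 1 = s \<otimes> (a \<otimes> c) \<oplus> (r \<oplus> s) \<otimes> u" unfolding z(2) mult_vals[OF z(1) \<beta>] using car a c u
      by (simp add: \<beta>_def pqrs[symmetric] l_distr r_distr a_ac)
    ultimately have "a \<otimes> (a \<otimes> q) = a \<otimes> (c \<otimes> s \<oplus> t \<otimes> u)"
      unfolding rs using car a c u t by (simp add: r_distr m_ac)
    then have "a \<otimes> q = c \<otimes> s \<oplus> t \<otimes> u" using m_lcancel a c u t car by simp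
    then have "t \<otimes> u = a \<otimes> q \<oplus> c \<otimes> s" using car a c u t by (simp add: a_ac add_self_left)
    then have "t \<in> ?J" using t car by blast
    moreover have "aug x = k \<otimes> t" unfolding 1 t(2) k_def using a c t by (simp add: m_ac)
    ultimately show ?thesis by blast
  qed

  have bwd: "\<exists>x\<in>?I. aug x = k \<otimes> t" if tJ: "t \<in> ?J" for t
  proof -
    obtain g h where gh: "g \<in> carrier R" "h \<in> carrier R" "t \<otimes> u = a \<otimes> g \<oplus> c \<otimes> h" and t: "t \<in> carrier R"
      using tJ by blast
    \<comment> \<open>The cofactors \<open>c t + g y\<close> of \<open>\<alpha>\<close> and \<open>a t + h y\<close> of \<open>\<beta>\<close>: both products equal \<open>a\<^sup>2 c t + a\<^sup>2 g y\<close>.\<close>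
    let ?y = "pair (c \<otimes> t \<oplus> g) g" and ?z = "pair (a \<otimes> t \<oplus> h) h"
    have y: "?y \<in> carrier A" and z: "?z \<in> carrier A" using a c t gh by simp_all
    have sub: "u \<otimes> (a \<otimes> t) = a \<otimes> (a \<otimes> g) \<oplus> a \<otimes> (c \<otimes> h)"
    proof -
      have "u \<otimes> (a \<otimes> t) = a \<otimes> (t \<otimes> u)" using a t u by (simp add: m_ac)
      then show ?thesis using gh a c by (simp add: r_distr)
    qed
    have "?y \<otimes>\<^bsub>A\<^esub> \<alpha> = pair ((c \<otimes> t \<oplus> g) \<otimes> (a \<otimes> a)) (g \<otimes> (a \<otimes> a))"
      using pair_eta[of "?y \<otimes>\<^bsub>A\<^esub> \<alpha>"] mult_vals[OF y \<alpha>] y \<alpha> a c t gh by (simp add: \<alpha>_def)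
    also have "\<dots> = ?z \<otimes>\<^bsub>A\<^esub> \<beta>"
    proof -
      have 0: "(?z \<otimes>\<^bsub>A\<^esub> \<beta>) 0 = (a \<otimes> t \<oplus> h) \<otimes> (a \<otimes> c) \<oplus> u \<otimes> (a \<otimes> t)"
        unfolding mult_vals[OF z \<beta>] using a c u t gh
        by (simp add: \<beta>_def l_distr r_distr a_ac m_ac add_self add_self_left)
      have 1: "(?z \<otimes>\<^bsub>A\<^esub> \<beta>) 1 = h \<otimes> (a \<otimes> c) \<oplus> u \<otimes> (a \<otimes> t)"
        unfolding mult_vals[OF z \<beta>] using a c u t gh
        by (simp add: \<beta>_def l_distr r_distr a_ac m_ac add_self add_self_left)
      have "(?z \<otimes>\<^bsub>A\<^esub> \<beta>) 0 = (c \<otimes> t \<oplus> g) \<otimes> (a \<otimes> a)" "(?z \<otimes>\<^bsub>A\<^esub> \<beta>) 1 = g \<otimes> (a \<otimes> a)"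
        unfolding 0 1 sub using a c t gh
        by (simp_all add: l_distr r_distr a_ac m_ac add_self add_self_left)
      then show ?thesis using pair_eta[of "?z \<otimes>\<^bsub>A\<^esub> \<beta>"] z \<beta> by simp
    qed
    finally have "?y \<otimes>\<^bsub>A\<^esub> \<alpha> = ?z \<otimes>\<^bsub>A\<^esub> \<beta>" .
    then have yI: "?y \<otimes>\<^bsub>A\<^esub> \<alpha> \<in> ?I"
    proof -
      have "?y \<otimes>\<^bsub>A\<^esub> \<alpha> \<in> cgenideal A \<alpha>" "?z \<otimes>\<^bsub>A\<^esub> \<beta> \<in> cgenideal A \<beta>"
        unfolding cgenideal_def using y z by blast+
      then show ?thesis using \<open>?y \<otimes>\<^bsub>A\<^esub> \<alpha> = ?z \<otimes>\<^bsub>A\<^esub> \<beta>\<close> by simp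
    qed
    have "aug (?y \<otimes>\<^bsub>A\<^esub> \<alpha>) = aug ?y \<otimes> aug \<alpha>" using y \<alpha> by simp
    also have "aug ?y \<otimes> aug \<alpha> = k \<otimes> t"
      using a c t gh(1,2) by (simp add: aug_def \<alpha>_def a_assoc add_self k_def m_ac)
    finally show ?thesis using yI by blast
  qed

  have "\<forall>x\<in>?I. \<exists>t. t \<in> ?J \<and> aug x = k \<otimes> t" using fwd by blast
  from bchoice[OF this] obtain T where T: "T x \<in> ?J \<and> aug x = k \<otimes> T x" if "x \<in> ?I" for x by blast
  have SI: "S \<subseteq> ?I" unfolding S(3) by (rule A.genideal_self[OF S(2)])
  let ?J' = "genideal R (T ` S)"
  have TS: "T ` S \<subseteq> ?J" using T SI by blast
  then have J': "ideal ?J' R" by (intro genideal_ideal) auto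
  then interpret J': ideal ?J' R .
  have "ideal ?J R"
  proof (rule idealI[OF ring_axioms])
    show "subgroup ?J (add_monoid R)"
    proof (rule add.subgroupI)
      show "?J \<noteq> {}" using a c u by (auto intro!: exI[of _ \<zero>] bexI[of _ \<zero>])
      fix x y assume x: "x \<in> ?J" and y: "y \<in> ?J"
      then obtain g h g' h' where *: "g \<in> carrier R" "h \<in> carrier R" "x \<otimes> u = a \<otimes> g \<oplus> c \<otimes> h"
        "g' \<in> carrier R" "h' \<in> carrier R" "y \<otimes> u = a \<otimes> g' \<oplus> c \<otimes> h'" by blast
      have "(x \<oplus> y) \<otimes> u = a \<otimes> (g \<oplus> g') \<oplus> c \<otimes> (h \<oplus> h')"
        using * x y a c u by (simp add: l_distr r_distr a_ac)
      then show "x \<oplus> y \<in> ?J" using * x y by blast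
    next
      fix x assume x: "x \<in> ?J"
      then have "\<ominus> x = x" using add_self minus_equality by blast
      then show "\<ominus> x \<in> ?J" using x by simp
    qed auto
    fix x r assume x: "x \<in> ?J" and r: "r \<in> carrier R"
    then obtain g h where *: "g \<in> carrier R" "h \<in> carrier R" "x \<otimes> u = a \<otimes> g \<oplus> c \<otimes> h" by blast
    have "r \<otimes> x \<otimes> u = r \<otimes> (x \<otimes> u)" using x r u by (simp add: m_assoc)
    also have "\<dots> = a \<otimes> (r \<otimes> g) \<oplus> c \<otimes> (r \<otimes> h)"
      unfolding * using * r a c by (simp add: r_distr m_ac)
    finally show "r \<otimes> x \<in> ?J" using x r * by blast
    then show "x \<otimes> r \<in> ?J" using x r by (simp add: m_comm)
  qed
  then have "?J' \<subseteq> ?J" using TS by (rule genideal_minimal)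
  moreover have "?J \<subseteq> ?J'"
  proof
    fix t assume t: "t \<in> ?J"
    let ?K = "{x \<in> carrier A. \<exists>j\<in>?J'. aug x = k \<otimes> j}"
    have "ideal ?K A"
    proof (rule idealI[OF A.ring_axioms])
      show "subgroup ?K (add_monoid A)"
      proof (rule A.add.subgroupI)
        show "?K \<noteq> {}" using k by (auto intro!: exI[of _ "\<zero>\<^bsub>A\<^esub>"] bexI[of _ \<zero>])
        fix x y assume x: "x \<in> ?K" and y: "y \<in> ?K"
        then obtain j j' where "j \<in> ?J'" "j' \<in> ?J'" "aug x = k \<otimes> j" "aug y = k \<otimes> j'" by blast
        then show "x \<oplus>\<^bsub>A\<^esub> y \<in> ?K" using x y k J'.Icarr
          by (auto simp: r_distr intro!: bexI[of _ "j \<oplus> j'"])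
      next
        fix x assume x: "x \<in> ?K"
        then obtain j where "j \<in> ?J'" "aug x = k \<otimes> j" by blast
        then show "\<ominus>\<^bsub>A\<^esub> x \<in> ?K" using x k J'.Icarr
          by (auto simp: r_minus intro!: bexI[of _ "\<ominus> j"])
      qed auto
      fix x r assume x: "x \<in> ?K" and r: "r \<in> carrier A"
      then obtain j where j: "j \<in> ?J'" "aug x = k \<otimes> j" by blast
      have "aug r \<otimes> (k \<otimes> j) = k \<otimes> (aug r \<otimes> j)"
        using r k J'.Icarr[OF j(1)] by (simp add: m_ac)
      moreover have "aug r \<otimes> j \<in> ?J'" using J'.I_l_closed[OF j(1)] r by simp
      ultimately show "r \<otimes>\<^bsub>A\<^esub> x \<in> ?K" using x r j by auto
      then show "x \<otimes>\<^bsub>A\<^esub> r \<in> ?K" using x r by (simp add: A.m_comm)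
    qed
    moreover have "S \<subseteq> ?K"
    proof
      fix s assume s: "s \<in> S"
      have "T s \<in> ?J'" using s TS genideal_self[of "T ` S"] by blast
      then show "s \<in> ?K" using T[of s] s SI S(2) by blast
    qed
    ultimately have "?I \<subseteq> ?K" unfolding S(3) by (rule A.genideal_minimal)
    moreover obtain x where "x \<in> ?I" "aug x = k \<otimes> t" using bwd[OF t] by blast
    ultimately obtain j where "j \<in> ?J'" "k \<otimes> t = k \<otimes> j" by auto
    then show "t \<in> ?J'" using m_lcancel[of k t j] k t J'.Icarr by auto
  qed
  ultimately have "?J = ?J'" by (rule antisym[rotated])
  then have "fg_ideal R ?J" unfolding fg_ideal_def
    using J' S(1) TS by (intro conjI exI[of _ "T ` S"]) auto
  then show False using nfg by blast
qed

end

section \<open>A factorial ring with a group ring that is not quasi coherent\<close>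

lemma fg_group_C2: "fg_group C2"
proof -
  have "generate C2 (carrier C2) = carrier C2"
  proof
    show "generate C2 (carrier C2) \<subseteq> carrier C2"
      by (rule group.generate_incl[OF group_integer_mod_group]) (rule subset_refl)
    show "carrier C2 \<subseteq> generate C2 (carrier C2)" by (intro subsetI generate.incl)
  qed
  moreover have "finite (carrier C2)" by (simp add: carrier_integer_mod_group)
  ultimately show ?thesis unfolding fg_group_def by (intro exI[of _ "carrier C2"]) simp
qed

lemma group_ring_shear_ring_not_quasi_coherent: "\<not> quasi_coherent (group_ring shear_ring C2)"
proof -
  interpret char2_domain shear_ring
    by (rule char2_domain.intro[OF shear_ring_domain]) (unfold_locales, simp)
  have nz: "mvar i \<noteq> 0" for i
    by (simp add: mvar_def) (metis lookup_single_eq lookup_zero zero_neq_one)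
  show ?thesis
  proof (rule group_ring_C2_not_quasi_coherent[of "mvar 0" "mvar 2" "minor 0 1"])
    show "mvar 0 \<in> carrier shear_ring" "mvar 2 \<in> carrier shear_ring"
      using mvar_even_inv[of 0] mvar_even_inv[of 1] by simp_all
    show "mvar 0 \<noteq> \<zero>\<^bsub>shear_ring\<^esub>" "mvar 2 \<noteq> \<zero>\<^bsub>shear_ring\<^esub>" using nz by simp_all
    show "minor 0 1 \<in> carrier shear_ring" using minor_inv by simp
    show "\<not> fg_ideal shear_ring {t \<in> carrier shear_ring. \<exists>g\<in>carrier shear_ring. \<exists>h\<in>carrier shear_ring.
        t \<otimes>\<^bsub>shear_ring\<^esub> minor 0 1 = mvar 0 \<otimes>\<^bsub>shear_ring\<^esub> g \<oplus>\<^bsub>shear_ring\<^esub> mvar 2 \<otimes>\<^bsub>shear_ring\<^esub> h}"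
      using shear_colon_not_fg by (simp add: shear_colon_def)
    fix p r assume p: "p \<in> carrier shear_ring" and eq: "mvar 0 \<otimes>\<^bsub>shear_ring\<^esub> p = mvar 2 \<otimes>\<^bsub>shear_ring\<^esub> r"
    then have "mvar 2 dvd mvar 0 * p" by simp
    then have "mvar 2 dvd p" by (rule mvar_dvd_cancel) simp
    then obtain t where t: "p = mvar 2 * t" by (elim dvdE)
    have "t \<in> shear_inv"
    proof (cases "p = 0")
      case True
      then show ?thesis using t nz shear_inv_0 by simp
    next
      case False
      then show ?thesis using t p shear_inv_inert(2)[of "mvar 2" t] by simp
    qed
    then show "\<exists>t\<in>carrier shear_ring. p = mvar 2 \<otimes>\<^bsub>shear_ring\<^esub> t" using t by auto
  qed
qed

theorem theorem3p2:
  shows "(\<exists>(R :: ((nat \<Rightarrow>\<^sub>0 nat) \<Rightarrow>\<^sub>0 bit) ring) (G :: int monoid).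
            cring R \<and> ring_char R = 2 \<and> G_GCD_ring R \<and> factorial_domain R \<and>
            comm_group G \<and> fg_group G \<and>
            \<not> quasi_coherent (group_ring R G)) \<and>
         \<not> (\<forall>(R :: ((nat \<Rightarrow>\<^sub>0 nat) \<Rightarrow>\<^sub>0 bit) ring) (G :: int monoid).
            cring R \<and> G_GCD_ring R \<and> quasi_coherent R \<and> comm_group G \<and> fg_group G \<longrightarrow>
            quasi_coherent (group_ring R G))"
proof -
  interpret factorial_domain shear_ring by (rule shear_ring_factorial)
  show ?thesis
    using is_cring shear_ring_char G_GCD_ring shear_ring_factorial quasi_coherent
      abelian_integer_mod_group[of 2] fg_group_C2 group_ring_shear_ring_not_quasi_coherent
    by blast
qed

end
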